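(* Let $n$ be a positive integer and let $G \in \mathcal{F}_n$, i.e. $G$ is a graph of order $n$ such that $2^{-\lfloor n/2 \rfloor} \det W(G)$ is an odd, cube-free integer and $\operatorname{rank}_p W(G) = n-1$ for every odd prime $p$ dividing $\det W(G)$. Let $k$ be the number of distinct odd primes whose square divides $\det W(G)$. Then $G$ has at most $2^k - 1$ non-isomorphic generalized cospectral mates; that is, up to isomorphism there are at most $2^k-1$ graphs $H$ that are not isomorphic to $G$ and have the same generalized spectrum as $G$.
   Context: All graphs are simple (finite, undirected, no loops or multiple edges). For a graph $G$ on $n$ vertices, $A(G)$ is its adjacency matrix, $\overline{G}$ its complement, and $\operatorname{Spec}(G)$ the multiset of eigenvalues of $A(G)$. The generalized spectrum of $G$ is the pair $(\operatorname{Spec}(G), \operatorname{Spec}(\overline{G}))$. A generalized cospectral mate of $G$ is a graph non-isomorphic to $G$ having the same generalized spectrum as $G$. The walk matrix $W(G)$ is the $n\times n$ matrix with columns $e, A(G)e, \dots, A(G)^{n-1}e$, where $e$ is the all-ones column vector of length $n$. For an integral matrix $M$ and a prime $p$, $\operatorname{rank}_p(M)$ is the rank of $M$ over the field $\mathbb{F}_p$ with $p$ elements. An integer is cube-free if it is not divisible by the cube of any prime. *)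

theory Defs
  imports
    "Graph_Theory.Graph_Theory"
    "Jordan_Normal_Form.Char_Poly"
    "Jordan_Normal_Form.DL_Rank"
    "Berlekamp_Zassenhaus.Finite_Field"
begin

text \<open>
  A simple graph is a \<^const>\<open>pair_graph\<close>: a finite vertex set together with a symmetric and
  irreflexive set of ordered pairs of vertices.
\<close>

definition graph_iso :: "'a pair_pre_digraph \<Rightarrow> 'b pair_pre_digraph \<Rightarrow> bool" where
  "graph_iso G H \<longleftrightarrow> digraph_iso (with_proj G) (with_proj H)"

definition graph_complement :: "'a pair_pre_digraph \<Rightarrow> 'a pair_pre_digraph" where
  "graph_complement G =
     \<lparr>pverts = pverts G,
      parcs = {(u, v). u \<in> pverts G \<and> v \<in> pverts G \<and> u \<noteq> v \<and> (u, v) \<notin> parcs G}\<rparr>"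

text \<open>
  The rows and columns of the adjacency matrix are indexed by the vertices in increasing order.
  Another order would conjugate the matrix by a permutation matrix and permute the rows of the
  walk matrix; the spectrum, the determinant of the walk matrix up to sign and its ranks
  do not change.
\<close>

definition adjacency_matrix :: "'a::linorder pair_pre_digraph \<Rightarrow> int mat" where
  "adjacency_matrix G =
     (let vs = sorted_list_of_set (pverts G); n = card (pverts G)
      in mat n n (\<lambda>(i, j). if (vs ! i, vs ! j) \<in> parcs G then 1 else 0))"

definition walk_matrix :: "'a::linorder pair_pre_digraph \<Rightarrow> int mat" where
  "walk_matrix G =
     (let n = card (pverts G); e = vec n (\<lambda>_. 1)
      in mat_of_cols n (map (\<lambda>j. (adjacency_matrix G ^\<^sub>m j) *\<^sub>v e) [0..<n]))"

text \<open>Eigenvalues are counted with algebraic multiplicity.\<close>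

definition Spec :: "'a::linorder pair_pre_digraph \<Rightarrow> complex multiset" where
  "Spec G = proots (char_poly (map_mat complex_of_int (adjacency_matrix G)))"

definition generalized_spectrum ::
    "'a::linorder pair_pre_digraph \<Rightarrow> complex multiset \<times> complex multiset" where
  "generalized_spectrum G = (Spec G, Spec (graph_complement G))"

text \<open>
  The vertices of a mate may have any linearly ordered type. Every finite graph is isomorphic to
  one with vertices in \<^typ>\<open>nat\<close>, so the mates over \<^typ>\<open>nat\<close> represent all of them up to isomorphism.
\<close>

definition generalized_cospectral_mates ::
    "'a::linorder pair_pre_digraph \<Rightarrow> 'b::linorder pair_pre_digraph set" where
  "generalized_cospectral_mates G =
     {H. pair_graph H \<and> \<not> graph_iso G H \<and> generalized_spectrum H = generalized_spectrum G}"

definition isomorphism_classes :: "'a pair_pre_digraph set \<Rightarrow> 'a pair_pre_digraph set set" where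
  "isomorphism_classes S = S // {(G, H). G \<in> S \<and> H \<in> S \<and> graph_iso G H}"

text \<open>
  The prime \<open>p\<close> is a value here, so the field with \<open>p\<close> elements cannot be a type. The columns
  indexed by \<open>J\<close> are linearly independent over that field if every integer combination of them
  that vanishes modulo \<open>p\<close> has all its coefficients divisible by \<open>p\<close>. For a fixed prime the
  resulting rank is the library's, see \<open>rank_mod_eq_rank\<close> below.
\<close>

definition cols_independent_mod :: "nat \<Rightarrow> int mat \<Rightarrow> nat set \<Rightarrow> bool" where
  "cols_independent_mod p M J \<longleftrightarrow>
     (\<forall>c :: nat \<Rightarrow> int. (\<forall>i<dim_row M. int p dvd (\<Sum>j\<in>J. c j * M $$ (i, j))) \<longrightarrow>
        (\<forall>j\<in>J. int p dvd c j))"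

definition rank_mod :: "nat \<Rightarrow> int mat \<Rightarrow> nat" where
  "rank_mod p M = Max {card J | J. J \<subseteq> {..<dim_col M} \<and> cols_independent_mod p M J}"

definition cube_free :: "int \<Rightarrow> bool" where
  "cube_free d \<longleftrightarrow> (\<forall>p. prime p \<longrightarrow> \<not> p ^ 3 dvd d)"

definition graph_family :: "nat \<Rightarrow> 'a::linorder pair_pre_digraph set" where
  "graph_family n =
     {G. pair_graph G \<and> card (pverts G) = n \<and>
         (\<exists>d :: int. rat_of_int (det (walk_matrix G)) / 2 ^ (n div 2) = rat_of_int d \<and>
                     odd d \<and> cube_free d) \<and>
         (\<forall>p :: nat. prime p \<and> odd p \<and> int p dvd det (walk_matrix G) \<longrightarrow>
                     rank_mod p (walk_matrix G) = n - 1)}"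

lemma graph_iso_iff:
  assumes "pair_graph G" "pair_graph H"
  shows "graph_iso G H \<longleftrightarrow>
    (\<exists>f. bij_betw f (pverts G) (pverts H) \<and>
         (\<forall>u\<in>pverts G. \<forall>v\<in>pverts G. (u, v) \<in> parcs G \<longleftrightarrow> (f u, f v) \<in> parcs H))"
proof
  interpret G: pair_graph G by fact
  interpret H: pair_graph H by fact
  have G: "fst e \<in> pverts G" "snd e \<in> pverts G" if "e \<in> parcs G" for e
    using that G.arc_fst_in_verts G.arc_snd_in_verts by auto
  have H: "fst e \<in> pverts H" "snd e \<in> pverts H" if "e \<in> parcs H" for e
    using that H.arc_fst_in_verts H.arc_snd_in_verts by auto
  {
    assume "graph_iso G H"
    then obtain h where h: "G.digraph_isomorphism h" "with_proj H = app_iso h (with_proj G)"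
      unfolding graph_iso_def digraph_iso_def by auto
    let ?f = "iso_verts h"
    have inj: "inj_on ?f (pverts G)" using h(1) by (simp add: G.digraph_isomorphism_def)
    have V: "pverts H = ?f ` pverts G" and E: "parcs H = iso_arcs h ` parcs G"
      and t: "iso_tail h = fst" and hd: "iso_head h = snd"
      using arg_cong[OF h(2), of verts] arg_cong[OF h(2), of arcs]
        arg_cong[OF h(2), of tail] arg_cong[OF h(2), of head] by simp_all
    have arc: "iso_arcs h e = (?f (fst e), ?f (snd e))" if "e \<in> parcs G" for e
      using h(1) that t hd by (auto simp: G.digraph_isomorphism_def prod_eq_iff)
    have "(u, v) \<in> parcs G \<longleftrightarrow> (?f u, ?f v) \<in> parcs H" if uv: "u \<in> pverts G" "v \<in> pverts G" for u v
    proof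
      assume "(u, v) \<in> parcs G"
      then show "(?f u, ?f v) \<in> parcs H" unfolding E using arc by force
    next
      assume "(?f u, ?f v) \<in> parcs H"
      then obtain e where "e \<in> parcs G" "(?f u, ?f v) = (?f (fst e), ?f (snd e))"
        unfolding E using arc by force
      then show "(u, v) \<in> parcs G"
        using inj uv G[of e] by (metis inj_onD prod.collapse prod.inject)
    qed
    then show "\<exists>f. bij_betw f (pverts G) (pverts H) \<and>
         (\<forall>u\<in>pverts G. \<forall>v\<in>pverts G. (u, v) \<in> parcs G \<longleftrightarrow> (f u, f v) \<in> parcs H)"
      using inj V by (auto simp: bij_betw_def)
  }
  assume "\<exists>f. bij_betw f (pverts G) (pverts H) \<and>
         (\<forall>u\<in>pverts G. \<forall>v\<in>pverts G. (u, v) \<in> parcs G \<longleftrightarrow> (f u, f v) \<in> parcs H)"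
  then obtain f where f: "inj_on f (pverts G)" "pverts H = f ` pverts G"
    and e: "\<And>u v. u \<in> pverts G \<Longrightarrow> v \<in> pverts G \<Longrightarrow> (u, v) \<in> parcs G \<longleftrightarrow> (f u, f v) \<in> parcs H"
    by (auto simp: bij_betw_def)
  define h where "h = \<lparr>iso_verts = f, iso_arcs = map_prod f f, iso_head = snd, iso_tail = fst\<rparr>"
  have "inj_on (map_prod f f) (parcs G)"
    using f(1) G by (intro inj_onI) (metis fst_map_prod snd_map_prod inj_onD prod_eq_iff)
  then have "G.digraph_isomorphism h"
    using f(1) G.wf_digraph_axioms by (simp add: G.digraph_isomorphism_def h_def)
  moreover have "parcs H = map_prod f f ` parcs G"
  proof (intro equalityI subsetI)
    fix x assume x: "x \<in> parcs H"
    then obtain u v where uv: "x = (f u, f v)" "u \<in> pverts G" "v \<in> pverts G"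
      using H[OF x] f(2) by (metis imageE prod.collapse)
    then have "(u, v) \<in> parcs G" using e x by blast
    then have "map_prod f f (u, v) \<in> map_prod f f ` parcs G" by (rule imageI)
    then show "x \<in> map_prod f f ` parcs G" unfolding uv(1) map_prod_simp .
  next
    fix x assume "x \<in> map_prod f f ` parcs G"
    then obtain y where y: "x = map_prod f f y" "y \<in> parcs G" by (rule imageE)
    have "(f (fst y), f (snd y)) \<in> parcs H"
      using e[OF G[OF y(2)]] y(2) unfolding prod.collapse by (rule iffD1)
    then show "x \<in> parcs H" unfolding y(1) map_prod_def case_prod_beta .
  qed
  then have "with_proj H = app_iso h (with_proj G)"
    using f(2) by (simp add: app_iso_def with_proj_def h_def)
  ultimately show "graph_iso G H" unfolding graph_iso_def digraph_iso_def by blast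
qed

lemma equiv_graph_iso:
  fixes S :: "'a pair_pre_digraph set"
  assumes "\<And>G. G \<in> S \<Longrightarrow> pair_graph G"
  shows "equiv S {(G, H). G \<in> S \<and> H \<in> S \<and> graph_iso G H}"
proof (rule equivI)
  show "{(G, H). G \<in> S \<and> H \<in> S \<and> graph_iso G H} \<subseteq> S \<times> S" by auto
  show "refl_on S {(G, H). G \<in> S \<and> H \<in> S \<and> graph_iso G H}"
    by (auto simp: refl_on_def graph_iso_iff assms intro!: exI[of _ id])
  show "sym {(G, H). G \<in> S \<and> H \<in> S \<and> graph_iso G H}"
  proof (intro symI, clarsimp simp: graph_iso_iff assms)
    fix G H :: "'a pair_pre_digraph" and f assume f: "bij_betw f (pverts G) (pverts H)"
      "\<forall>u\<in>pverts G. \<forall>v\<in>pverts G. ((u, v) \<in> parcs G) = ((f u, f v) \<in> parcs H)"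
    show "\<exists>f. bij_betw f (pverts H) (pverts G) \<and>
      (\<forall>u\<in>pverts H. \<forall>v\<in>pverts H. ((u, v) \<in> parcs H) = ((f u, f v) \<in> parcs G))"
      using f bij_betw_inv_into[OF f(1)]
      by (intro exI[of _ "inv_into (pverts G) f"])
        (auto simp: bij_betw_inv_into_right[OF f(1)] bij_betwE)
  qed
  show "trans {(G, H). G \<in> S \<and> H \<in> S \<and> graph_iso G H}"
  proof (rule transI)
    fix G H K assume "(G, H) \<in> {(G, H). G \<in> S \<and> H \<in> S \<and> graph_iso G H}"
      "(H, K) \<in> {(G, H). G \<in> S \<and> H \<in> S \<and> graph_iso G H}"
    then have S: "G \<in> S" "H \<in> S" "K \<in> S" and iso: "graph_iso G H" "graph_iso H K" by auto
    obtain f where f: "bij_betw f (pverts G) (pverts H)"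
      "\<And>u v. u \<in> pverts G \<Longrightarrow> v \<in> pverts G \<Longrightarrow> (u, v) \<in> parcs G \<longleftrightarrow> (f u, f v) \<in> parcs H"
      using iso(1) S assms graph_iso_iff by metis
    obtain g where g: "bij_betw g (pverts H) (pverts K)"
      "\<And>u v. u \<in> pverts H \<Longrightarrow> v \<in> pverts H \<Longrightarrow> (u, v) \<in> parcs H \<longleftrightarrow> (g u, g v) \<in> parcs K"
      using iso(2) S assms graph_iso_iff by metis
    have "(u, v) \<in> parcs G \<longleftrightarrow> ((g \<circ> f) u, (g \<circ> f) v) \<in> parcs K"
      if "u \<in> pverts G" "v \<in> pverts G" for u v
      using f(2)[OF that] g(2)[OF bij_betw_apply[OF f(1)] bij_betw_apply[OF f(1)]] that by simp
    then have "graph_iso G K"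
      using bij_betw_trans[OF f(1) g(1)] S assms graph_iso_iff by metis
    with S show "(G, K) \<in> {(G, H). G \<in> S \<and> H \<in> S \<and> graph_iso G H}" by simp
  qed
qed

lemma of_int_mod_ring_eq_0_iff:
  "(of_int x :: 'p::prime_card mod_ring) = 0 \<longleftrightarrow> int CARD('p) dvd x"
  unfolding of_int_of_int_mod_ring by (transfer) (simp add: dvd_eq_mod_eq_0)

lemma cols_independent_mod_iff:
  fixes M :: "int mat"
  defines "A \<equiv> map_mat of_int M :: 'p::prime_card mod_ring mat"
  assumes J: "J \<subseteq> {..<dim_col M}"
  shows "cols_independent_mod CARD('p) M J \<longleftrightarrow>
    inj_on (col A) J \<and>
      module.lin_indpt class_ring (module_vec TYPE('p mod_ring) (dim_row M)) (col A ` J)"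
proof -
  interpret vec_space "TYPE('p mod_ring)" "dim_row M" .
  have finJ: "finite J" using J finite_subset by blast
  have S: "col A ` J \<subseteq> carrier_vec (dim_row M)" unfolding A_def using J by auto
  have ent: "col A j $ i = of_int (M $$ (i, j))" if "i < dim_row M" "j \<in> J" for i j
    using that J unfolding A_def by auto
  have comb: "int CARD('p) dvd (\<Sum>j\<in>J. c j * M $$ (i, j)) \<longleftrightarrow>
      (\<Sum>j\<in>J. of_int (c j) * col A j $ i) = 0" if "i < dim_row M" for i c
  proof -
    have "(\<Sum>j\<in>J. of_int (c j) * col A j $ i) = of_int (\<Sum>j\<in>J. c j * M $$ (i, j))"
      unfolding of_int_sum using ent[OF that] by (intro sum.cong) auto
    then show ?thesis using of_int_mod_ring_eq_0_iff[where 'p='p] by metis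
  qed
  show ?thesis
  proof
    assume ind: "cols_independent_mod CARD('p) M J"
    have ind': "of_int (c j) = (0::'p mod_ring)"
      if "\<And>i. i < dim_row M \<Longrightarrow> (\<Sum>j\<in>J. of_int (c j) * col A j $ i) = 0" "j \<in> J" for c j
      using ind that comb unfolding cols_independent_mod_def of_int_mod_ring_eq_0_iff by blast
    have inj: "inj_on (col A) J"
    proof (rule inj_onI, rule ccontr)
      fix j k assume jk: "j \<in> J" "k \<in> J" "col A j = col A k" "j \<noteq> k"
      define c :: "nat \<Rightarrow> int" where "c = (\<lambda>x. (if x = j then 1 else 0) - (if x = k then 1 else 0))"
      have "(\<Sum>x\<in>J. of_int (c x) * col A x $ i) = 0" if "i < dim_row M" for i
      proof -
        have "(\<Sum>x\<in>J. of_int (c x) * col A x $ i) =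
            (\<Sum>x\<in>J. (if x = j then col A x $ i else 0) - (if x = k then col A x $ i else 0))"
          by (intro sum.cong) (auto simp: c_def)
        also have "\<dots> = col A j $ i - col A k $ i"
          using finJ jk by (simp add: sum_subtractf)
        finally show ?thesis using jk by simp
      qed
      from ind'[OF this jk(1)] show False using jk(4) by (simp add: c_def)
    qed
    moreover have "lin_indpt (col A ` J)"
    proof
      assume "lin_dep (col A ` J)"
      then obtain a v where a: "lincomb a (col A ` J) = \<zero>\<^bsub>V\<^esub>" "v \<in> col A ` J" "a v \<noteq> 0"
        using finite_lin_dep[of "col A ` J"] finJ S by (auto simp: class_ring_simps)
      define c where "c j = to_int_mod_ring (a (col A j))" for j
      have c: "of_int (c j) = a (col A j)" for j
        unfolding c_def by (simp add: of_int_of_int_mod_ring)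
      have "(\<Sum>j\<in>J. of_int (c j) * col A j $ i) = 0" if "i < dim_row M" for i
      proof -
        have "(\<Sum>j\<in>J. of_int (c j) * col A j $ i) = (\<Sum>v\<in>col A ` J. a v * v $ i)"
          by (simp add: sum.reindex[OF inj] c)
        also have "\<dots> = lincomb a (col A ` J) $ i" using lincomb_index[OF that S] by simp
        also have "\<dots> = 0" using a(1) that by (simp add: module_vec_def)
        finally show ?thesis .
      qed
      from ind'[OF this] a(2,3) c show False by auto
    qed
    ultimately show "inj_on (col A) J \<and> lin_indpt (col A ` J)" by blast
  next
    assume R: "inj_on (col A) J \<and> lin_indpt (col A ` J)"
    then have inj: "inj_on (col A) J" by blast
    show "cols_independent_mod CARD('p) M J"
      unfolding cols_independent_mod_def
    proof (intro allI impI ballI)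
      fix c j assume c: "\<forall>i<dim_row M. int CARD('p) dvd (\<Sum>j\<in>J. c j * M $$ (i, j))"
        and j: "j \<in> J"
      define a :: "'p mod_ring vec \<Rightarrow> 'p mod_ring" where
        "a v = of_int (c (inv_into J (col A) v))" for v
      have a: "a (col A k) = of_int (c k)" if "k \<in> J" for k
        using that inj by (simp add: a_def)
      have "lincomb a (col A ` J) = 0\<^sub>v (dim_row M)"
      proof (rule eq_vecI)
        show "dim_vec (lincomb a (col A ` J)) = dim_vec (0\<^sub>v (dim_row M))"
          using lincomb_dim[OF _ S] finJ by simp
        fix i assume "i < dim_vec (0\<^sub>v (dim_row M) :: 'p mod_ring vec)"
        then have i: "i < dim_row M" by simp
        have "lincomb a (col A ` J) $ i = (\<Sum>v\<in>col A ` J. a v * v $ i)"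
          by (rule lincomb_index[OF i S])
        also have "\<dots> = (\<Sum>j\<in>J. of_int (c j) * col A j $ i)"
          by (simp add: sum.reindex[OF inj] a)
        also have "\<dots> = 0" using c comb i by blast
        finally show "lincomb a (col A ` J) $ i = 0\<^sub>v (dim_row M) $ i" using i by simp
      qed
      then have "a (col A j) = 0"
        using R j lin_dep_crit[where S = "col A ` J" and A = "col A ` J" and a = a and v = "col A j"] finJ S
        by (auto simp: class_ring_simps module_vec_def)
      then show "int CARD('p) dvd c j" using a[OF j] of_int_mod_ring_eq_0_iff by metis
    qed
  qed
qed

lemma rank_mod_eq_rank:
  fixes M :: "int mat"
  shows "rank_mod CARD('p) M =
    vec_space.rank (dim_row M) (map_mat of_int M :: 'p::prime_card mod_ring mat)"
proof -
  interpret vec_space "TYPE('p mod_ring)" "dim_row M" .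
  define A where "A = (map_mat of_int M :: 'p mod_ring mat)"
  have A: "A \<in> carrier_mat (dim_row M) (dim_col M)" by (simp add: A_def)
  have cols: "set (cols A) = col A ` {..<dim_col M}"
    by (auto simp: A_def cols_def)
  have "Max {card J | J. J \<subseteq> {..<dim_col M} \<and> cols_independent_mod CARD('p) M J} = rank A"
  proof (rule Max_eqI)
    have "{card J | J. J \<subseteq> {..<dim_col M} \<and> cols_independent_mod CARD('p) M J}
        \<subseteq> card ` Pow {..<dim_col M}" by auto
    then show "finite {card J | J. J \<subseteq> {..<dim_col M} \<and> cols_independent_mod CARD('p) M J}"
      by (rule finite_subset) auto
  next
    fix y assume "y \<in> {card J | J. J \<subseteq> {..<dim_col M} \<and> cols_independent_mod CARD('p) M J}"
    then obtain J where J: "y = card J" "J \<subseteq> {..<dim_col M}"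
      "cols_independent_mod CARD('p) M J" by blast
    then have *: "inj_on (col A) J" "lin_indpt (col A ` J)"
      using cols_independent_mod_iff[OF J(2), where 'p='p] unfolding A_def by blast+
    have "card (col A ` J) \<le> rank A"
      using rank_ge_card_indpt[OF A _ *(2)] J(2) cols by auto
    then show "y \<le> rank A" using J(1) card_image[OF *(1)] by simp
  next
    obtain S where S: "maximal S (\<lambda>T. T \<subseteq> set (cols A) \<and> lin_indpt T)"
      using maximal_exists[of "\<lambda>T. T \<subseteq> set (cols A) \<and> lin_indpt T" "card (set (cols A))" "{}"]
      by (meson List.finite_set card_mono empty_iff empty_subsetI finite_lin_indpt2 rev_finite_subset)
    then have S': "S \<subseteq> col A ` {..<dim_col M}" "lin_indpt S"
      using cols by (auto simp: maximal_def)
    then obtain J where J: "J \<subseteq> {..<dim_col M}" "inj_on (col A) J" "S = col A ` J"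
      by (metis subset_image_inj)
    have "cols_independent_mod CARD('p) M J"
      using cols_independent_mod_iff[OF J(1), where 'p='p] J S' unfolding A_def by blast
    moreover have "rank A = card J"
      using rank_card_indpt[OF A S] J card_image by metis
    ultimately show
      "rank A \<in> {card J | J. J \<subseteq> {..<dim_col M} \<and> cols_independent_mod CARD('p) M J}"
      using J(1) by blast
  qed
  then show ?thesis unfolding rank_mod_def A_def .
qed

end

theory Submission
  imports Defs
begin

text \<open>
  Let \<open>A\<close> be the adjacency matrix and \<open>W\<close> the walk matrix of \<open>G\<close>, and let \<open>e\<close> be the all-ones vector.
  A graph \<open>H\<close> with the same generalized spectrum has the same numbers \<open>e\<^sup>T A\<^sup>k e\<close>, so \<open>W(G) W(H)\<^sup>-\<^sup>1\<close>
  is a rational orthogonal matrix \<open>Q\<close> with \<open>Q e = e\<close> and \<open>A Q = Q A(H)\<close>. Let \<open>l\<close> be the least positive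
  integer (the level) such that \<open>U = l Q\<close> is integral. The columns \<open>u\<close> of \<open>U\<close> satisfy
  \<open>W\<^sup>T u \<equiv> 0\<close> modulo \<open>l\<close> and \<open>u\<^sup>T A\<^sup>k u \<equiv> 0\<close> modulo \<open>l\<^sup>2\<close>.

  If \<open>l\<close> is even, the quadratic condition for all \<open>k\<close> forces \<open>u \<equiv> 0\<close> modulo 2. If an odd prime \<open>p\<close>
  divides \<open>l\<close>, then \<open>p\<close> divides \<open>det W\<close> and the kernel of \<open>W\<^sup>T\<close> is a line modulo \<open>p\<close>; if \<open>p\<^sup>a\<close> is the
  exact power of \<open>p\<close> in \<open>det W\<close>, then \<open>p\<^sup>a\<close> cannot divide \<open>l\<close>. Hence \<open>l\<close> is a product of distinct odd
  primes whose squares divide \<open>det W\<close>. Two graphs \<open>H\<close>, \<open>H'\<close> with the same level have \<open>U\<^sup>T U' \<equiv> 0\<close> modulo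
  \<open>l\<^sup>2\<close>, since a hyperbolic plane has only two isotropic lines. So \<open>Q\<^sup>T Q'\<close> is an integral orthogonal
  matrix fixing \<open>e\<close>, that is, a permutation matrix, and \<open>H\<close> and \<open>H'\<close> are isomorphic. Level 1 gives \<open>G\<close>
  itself, which leaves \<open>2\<^sup>k - 1\<close> levels for the mates.
\<close>

section \<open>Integer matrices modulo a prime\<close>

definition dvd_vec :: "int \<Rightarrow> int vec \<Rightarrow> bool" where
  "dvd_vec m v \<longleftrightarrow> (\<forall>i<dim_vec v. m dvd v $ i)"

lemma dvd_vecE:
  assumes "dvd_vec m v" "v \<in> carrier_vec n"
  obtains y where "y \<in> carrier_vec n" "v = m \<cdot>\<^sub>v y"
proof
  show "vec n (\<lambda>i. v $ i div m) \<in> carrier_vec n" by simp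
  show "v = m \<cdot>\<^sub>v vec n (\<lambda>i. v $ i div m)"
    using assms by (intro eq_vecI) (auto simp: dvd_vec_def)
qed

lemma dvd_vec_smult [simp]: "dvd_vec m (m \<cdot>\<^sub>v y)"
  by (simp add: dvd_vec_def)

lemma dvd_vec_zero [simp]: "dvd_vec m (0\<^sub>v n)"
  by (simp add: dvd_vec_def)

lemma dvd_vec_add: "dvd_vec m x \<Longrightarrow> dvd_vec m y \<Longrightarrow> dim_vec x = dim_vec y \<Longrightarrow> dvd_vec m (x + y)"
  by (simp add: dvd_vec_def)

lemma dvd_vec_diff: "dvd_vec m x \<Longrightarrow> dvd_vec m y \<Longrightarrow> dim_vec x = dim_vec y \<Longrightarrow> dvd_vec m (x - y)"
  by (simp add: dvd_vec_def)

lemma dvd_vec_smultI: "dvd_vec m x \<Longrightarrow> dvd_vec m (c \<cdot>\<^sub>v x)"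
  by (simp add: dvd_vec_def)

lemma dvd_vec_trans: "m dvd k \<Longrightarrow> dvd_vec k x \<Longrightarrow> dvd_vec m x"
  by (auto simp: dvd_vec_def intro: dvd_trans)

lemma dvd_vec_mult_mat: "dvd_vec m x \<Longrightarrow> dim_col M = dim_vec x \<Longrightarrow> dvd_vec m (M *\<^sub>v x)"
  by (auto simp: dvd_vec_def scalar_prod_def intro!: dvd_sum)

lemma dvd_vec_smult_cancel:
  "coprime m c \<Longrightarrow> dvd_vec m (c \<cdot>\<^sub>v x) \<Longrightarrow> dvd_vec m x"
  by (auto simp: dvd_vec_def coprime_dvd_mult_right_iff)

lemma adj_mat_mult_vec:
  assumes "M \<in> carrier_mat n n" "x \<in> carrier_vec n"
  shows "adj_mat M *\<^sub>v (M *\<^sub>v x) = det M \<cdot>\<^sub>v x" "M *\<^sub>v (adj_mat M *\<^sub>v x) = det M \<cdot>\<^sub>v x"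
proof -
  have 1: "(c \<cdot>\<^sub>m 1\<^sub>m n) *\<^sub>v x = c \<cdot>\<^sub>v x" for c
    using assms(2) by (intro eq_vecI) (auto simp: row_smult smult_scalar_prod_distrib[of _ n])
  show "adj_mat M *\<^sub>v (M *\<^sub>v x) = det M \<cdot>\<^sub>v x"
    by (subst assoc_mult_mat_vec[symmetric, of _ n n _ n]) (use assms adj_mat[OF assms(1)] 1 in auto)
  show "M *\<^sub>v (adj_mat M *\<^sub>v x) = det M \<cdot>\<^sub>v x"
    by (subst assoc_mult_mat_vec[symmetric, of _ n n _ n]) (use assms adj_mat[OF assms(1)] 1 in auto)
qed

text \<open>Multiplying by the adjugate turns \<open>M\<close> into the scalar \<open>det M\<close>,
  which is a unit modulo \<open>m\<close>.\<close>

lemma dvd_vec_mat_cancel: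
  assumes "M \<in> carrier_mat n n" "x \<in> carrier_vec n" "coprime m (det M)" "dvd_vec m (M *\<^sub>v x)"
  shows "dvd_vec m x"
proof -
  have "dvd_vec m (adj_mat M *\<^sub>v (M *\<^sub>v x))"
    by (rule dvd_vec_mult_mat[OF assms(4)]) (use assms(1) adj_mat(1)[OF assms(1)] in simp)
  then show ?thesis
    unfolding adj_mat_mult_vec(1)[OF assms(1,2)] by (rule dvd_vec_smult_cancel[OF assms(3)])
qed

lemma mult_mat_vec_cancel:
  fixes M :: "'a::idom mat"
  assumes "M \<in> carrier_mat n n" "x \<in> carrier_vec n" "y \<in> carrier_vec n" "det M \<noteq> 0"
    and "M *\<^sub>v x = M *\<^sub>v y"
  shows "x = y"
proof -
  have "M *\<^sub>v (x - y) = 0\<^sub>v n"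
    using assms by (simp add: mult_minus_distrib_mat_vec[of M n n])
  then have "x - y = 0\<^sub>v n"
    using det_0_iff_vec_prod_zero[OF assms(1)] assms(2-4) by (metis minus_carrier_vec)
  show ?thesis
  proof (rule eq_vecI)
    fix i assume "i < dim_vec y"
    then have "(x - y) $ i = 0" using \<open>x - y = 0\<^sub>v n\<close> assms(3) by simp
    then show "x $ i = y $ i" using \<open>i < dim_vec y\<close> by simp
  qed (use assms in auto)
qed

lemma det_cong_mod:
  fixes A B :: "int mat"
  assumes "A \<in> carrier_mat n n" "B \<in> carrier_mat n n"
    and "\<And>i j. i < n \<Longrightarrow> j < n \<Longrightarrow> [A $$ (i, j) = B $$ (i, j)] (mod m)"
  shows "[det A = det B] (mod m)"
  unfolding det_def'[OF assms(1)] det_def'[OF assms(2)]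
  by (intro cong_sum cong_mult cong_refl cong_prod assms(3)) (auto simp: permutes_in_image)

section \<open>Dimension arguments modulo p by counting residue vectors\<close>

text \<open>Functions into \<open>{0..<m}\<close> represent vectors over the residues modulo
  \<open>m\<close>. Their number replaces the dimension of a space, so that the prime can remain a
  value.\<close>

lemma finite_residue_functions:
  "finite J \<Longrightarrow> finite (J \<rightarrow>\<^sub>E {0..<m::int})"
  "finite J \<Longrightarrow> m \<ge> 0 \<Longrightarrow> card (J \<rightarrow>\<^sub>E {0..<m::int}) = nat m ^ card J"
  by (auto intro: finite_PiE simp: card_PiE)

lemma residue_function_mem:
  "m > 1 \<Longrightarrow> restrict (\<lambda>i. f i mod m) I \<in> I \<rightarrow>\<^sub>E {0..<m::int}"
  by auto

lemma eq_of_dvd_residues: "x \<in> {0..<m} \<Longrightarrow> y \<in> {0..<m} \<Longrightarrow> m dvd x - y \<Longrightarrow> x = (y::int)"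
  by (metis atLeastLessThan_iff mod_eq_dvd_iff mod_pos_pos_trivial)

text \<open>Pigeonhole: there are more coefficient vectors than vectors of values, so two of them
  have the same values modulo \<open>m\<close>, and their difference is the dependence.\<close>

lemma cols_dependent_mod_of_fewer_rows:
  fixes f :: "'a \<Rightarrow> 'b \<Rightarrow> int"
  assumes "finite I" "finite J" "card I < card J" "m > 1"
  shows "\<exists>c. (\<exists>j\<in>J. \<not> m dvd c j) \<and> (\<forall>i\<in>I. m dvd (\<Sum>j\<in>J. c j * f i j))"
proof -
  define \<phi> where "\<phi> c = restrict (\<lambda>i. (\<Sum>j\<in>J. c j * f i j) mod m) I" for c
  let ?D = "J \<rightarrow>\<^sub>E {0..<m}" and ?R = "I \<rightarrow>\<^sub>E {0..<m}"
  have "\<phi> ` ?D \<subseteq> ?R" unfolding \<phi>_def by (intro image_subsetI residue_function_mem assms)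
  then have "card (\<phi> ` ?D) \<le> card ?R"
    using assms finite_residue_functions by (intro card_mono) auto
  also have "\<dots> < card ?D"
    using assms by (simp add: finite_residue_functions)
  finally have "\<not> inj_on \<phi> ?D" by (rule pigeonhole)
  then obtain c d where cd: "c \<in> ?D" "d \<in> ?D" "\<phi> c = \<phi> d" "c \<noteq> d" by (auto simp: inj_on_def)
  then obtain j where j: "j \<in> J" "c j \<noteq> d j" by (meson PiE_ext)
  have "c j \<in> {0..<m}" "d j \<in> {0..<m}" using cd j by auto
  then have "\<not> m dvd c j - d j" using j(2) eq_of_dvd_residues by blast
  moreover have "m dvd (\<Sum>j\<in>J. (c j - d j) * f i j)" if "i \<in> I" for i
    using fun_cong[OF cd(3), of i] that
    by (simp add: \<phi>_def left_diff_distrib sum_subtractf mod_eq_dvd_iff)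
  ultimately show ?thesis using j(1) by (intro exI[of _ "\<lambda>j. c j - d j"]) auto
qed

text \<open>Independence makes multiplication by \<open>M\<close> injective on residue vectors,
  hence surjective because there are finitely many. Preimages of the unit vectors form a right
  inverse of \<open>M\<close> modulo \<open>p\<close>.\<close>

lemma not_dvd_det_of_cols_independent_mod:
  assumes M: "M \<in> carrier_mat n n" and "p > 1" and ind: "cols_independent_mod p M {..<n}"
  shows "\<not> int p dvd det M"
proof
  assume dvd: "int p dvd det M"
  define \<phi> where "\<phi> c = restrict (\<lambda>i. (\<Sum>j<n. c j * M $$ (i, j)) mod int p) {..<n}" for c
  let ?D = "{..<n} \<rightarrow>\<^sub>E {0..<int p}"
  have p1: "int p > 1" using assms(2) by simp
  have sub: "\<phi> ` ?D \<subseteq> ?D" unfolding \<phi>_def by (intro image_subsetI residue_function_mem p1)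
  have "inj_on \<phi> ?D"
  proof (rule inj_onI)
    fix c d assume cd: "c \<in> ?D" "d \<in> ?D" "\<phi> c = \<phi> d"
    have *: "int p dvd (\<Sum>j<n. (c j - d j) * M $$ (i, j))" if "i < n" for i
      using fun_cong[OF cd(3), of i] that
      by (simp add: \<phi>_def left_diff_distrib sum_subtractf mod_eq_dvd_iff)
    have d: "int p dvd c j - d j" if "j < n" for j
    proof -
      have "\<forall>i<dim_row M. int p dvd (\<Sum>j<n. (c j - d j) * M $$ (i, j))" using * M by simp
      with ind that show ?thesis unfolding cols_independent_mod_def
        by (elim allE[of _ "\<lambda>j. c j - d j"]) simp
    qed
    show "c = d"
    proof (rule PiE_ext[OF cd(1,2)])
      fix j assume j: "j \<in> {..<n}"
      have "c j \<in> {0..<int p}" "d j \<in> {0..<int p}"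
        by (rule PiE_mem[OF cd(1) j], rule PiE_mem[OF cd(2) j])
      then show "c j = d j" using d[of j] j eq_of_dvd_residues by blast
    qed
  qed
  then have surj: "\<phi> ` ?D = ?D"
    using sub finite_residue_functions(1) by (metis endo_inj_surj finite_lessThan)
  have "\<exists>c. \<forall>i<n. [(\<Sum>j<n. c j * M $$ (i, j)) = (if i = k then 1 else 0)] (mod p)" for k
  proof -
    have "restrict (\<lambda>i. if i = k then 1 else 0) {..<n} \<in> ?D" using p1 by auto
    then obtain c where c: "restrict (\<lambda>i. if i = k then 1 else 0) {..<n} = \<phi> c" using surj by blast
    have "(if i = k then 1 else 0) = (\<Sum>j<n. c j * M $$ (i, j)) mod int p" if "i < n" for i
      using fun_cong[OF c, of i] that by (simp add: \<phi>_def)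
    then have "[(\<Sum>j<n. c j * M $$ (i, j)) = (if i = k then 1 else 0)] (mod p)" if "i < n" for i
      using that by (auto simp: cong_def)
    then show ?thesis by blast
  qed
  then obtain c where c: "\<And>k i. i < n \<Longrightarrow> [(\<Sum>j<n. c k j * M $$ (i, j)) = (if i = k then 1 else 0)] (mod p)"
    by metis
  define Y where "Y = mat n n (\<lambda>(j, k). c k j)"
  have Y: "Y \<in> carrier_mat n n" by (simp add: Y_def)
  have "[det (M * Y) = det (1\<^sub>m n)] (mod p)"
  proof (rule det_cong_mod)
    fix i k assume ik: "i < n" "k < n"
    have "(M * Y) $$ (i, k) = (\<Sum>j<n. c k j * M $$ (i, j))"
      using ik M by (auto simp: Y_def scalar_prod_def lessThan_atLeast0 intro!: sum.cong)
    then show "[(M * Y) $$ (i, k) = 1\<^sub>m n $$ (i, k)] (mod p)" using c[OF ik(1), of k] ik by simp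
  qed (use M Y in auto)
  then have "[det M * det Y = 1] (mod p)" by (simp add: det_mult[OF M Y])
  with dvd have "int p dvd 1" by (meson cong_dvd_iff dvd_mult2)
  with assms(2) show False by simp
qed

lemma mult_mat_vec_index:
  "M \<in> carrier_mat n m \<Longrightarrow> c \<in> carrier_vec m \<Longrightarrow> i < n \<Longrightarrow>
    (M *\<^sub>v c) $ i = (\<Sum>j<m. M $$ (i, j) * c $ j)"
  by (auto simp: scalar_prod_def lessThan_atLeast0 intro!: sum.cong)

lemma kernel_mod_of_dvd_det:
  assumes M: "M \<in> carrier_mat n n" and "p > 1" "int p dvd det M"
  obtains y where "y \<in> carrier_vec n" "dvd_vec p (M *\<^sub>v y)" "\<not> dvd_vec p y"
proof -
  from not_dvd_det_of_cols_independent_mod[OF assms(1,2)] assms(3)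
  obtain c j where c: "\<And>i. i < n \<Longrightarrow> int p dvd (\<Sum>j<n. c j * M $$ (i, j))" "j < n" "\<not> int p dvd c j"
    using M unfolding cols_independent_mod_def by auto
  show thesis
  proof (rule that[of "vec n c"])
    show "dvd_vec p (M *\<^sub>v vec n c)"
      unfolding dvd_vec_def using c(1) M
      by (auto simp: mult_mat_vec_index[OF M] mult.commute simp del: index_mult_mat_vec)
  qed (use c in \<open>auto simp: dvd_vec_def\<close>)
qed

text \<open>Extension to a basis, one column at a time. By counting, some residue vector lies
  outside the span of the columns in \<open>J\<close>; it becomes a new column, and a full
  independent set has determinant prime to \<open>p\<close>.\<close>

lemma extend_cols_independent_mod:
  assumes p: "prime p" and M: "M \<in> carrier_mat n n" and J: "J \<subseteq> {..<n}"
    and ind: "cols_independent_mod p M J"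
  shows "\<exists>N \<in> carrier_mat n n. (\<forall>i<n. \<forall>j\<in>J. N $$ (i, j) = M $$ (i, j)) \<and> \<not> int p dvd det N"
  using M J ind
proof (induction "card ({..<n} - J)" arbitrary: J M)
  case 0
  then have "J = {..<n}" by auto
  then show ?case
    using 0 not_dvd_det_of_cols_independent_mod[of M n p] prime_gt_1_nat[OF p] by blast
next
  case (Suc k)
  then obtain j where j: "j < n" "j \<notin> J" by (metis Diff_iff card.empty ex_in_conv lessThan_iff nat.distinct(1))
  have finJ: "finite J" using Suc.prems(2) finite_subset by blast
  have p1: "int p > 1" using prime_gt_1_nat[OF p] by simp
  define \<phi> where "\<phi> c = restrict (\<lambda>i. (\<Sum>j\<in>J. c j * M $$ (i, j)) mod int p) {..<n}" for c
  have "card (\<phi> ` (J \<rightarrow>\<^sub>E {0..<int p})) \<le> card (J \<rightarrow>\<^sub>E {0..<int p})"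
    using finJ finite_residue_functions by (intro card_image_le) auto
  also have "card J < n" using j Suc.prems(2) psubset_card_mono[of "{..<n}" J] by auto
  then have "card (J \<rightarrow>\<^sub>E {0..<int p}) < card ({..<n} \<rightarrow>\<^sub>E {0..<int p})"
    using finJ p1 by (simp add: finite_residue_functions)
  finally have "\<not> ({..<n} \<rightarrow>\<^sub>E {0..<int p}) \<subseteq> \<phi> ` (J \<rightarrow>\<^sub>E {0..<int p})"
    using finJ finite_residue_functions(1) card_mono
    by (metis finite_imageI leD)
  then obtain x where x: "x \<in> {..<n} \<rightarrow>\<^sub>E {0..<int p}" "x \<notin> \<phi> ` (J \<rightarrow>\<^sub>E {0..<int p})" by blast
  define M' where "M' = mat n n (\<lambda>(i, l). if l = j then x i else M $$ (i, l))"
  have M'J: "(\<Sum>l\<in>insert j J. c l * M' $$ (i, l)) = c j * x i + (\<Sum>l\<in>J. c l * M $$ (i, l))"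
    if "i < n" for c i
  proof -
    have "(\<Sum>l\<in>J. c l * M' $$ (i, l)) = (\<Sum>l\<in>J. c l * M $$ (i, l))"
    proof (rule sum.cong)
      fix l assume "l \<in> J"
      then have "l < n" "l \<noteq> j" using j Suc.prems(2) by auto
      then show "c l * M' $$ (i, l) = c l * M $$ (i, l)" using that by (simp add: M'_def)
    qed simp
    then show ?thesis using finJ j that by (simp add: M'_def)
  qed
  have "cols_independent_mod p M' (insert j J)"
    unfolding cols_independent_mod_def
  proof (intro allI impI)
    fix c assume "\<forall>i<dim_row M'. int p dvd (\<Sum>l\<in>insert j J. c l * M' $$ (i, l))"
    then have c: "int p dvd c j * x i + (\<Sum>l\<in>J. c l * M $$ (i, l))" if "i < n" for i
      using that M'J by (auto simp: M'_def)
    have cj: "int p dvd c j"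
    proof (rule ccontr)
      assume "\<not> int p dvd c j"
      then have "coprime (c j) (int p)" using p prime_imp_coprime coprime_commute
        by (metis prime_nat_int_transfer)
      then obtain d where d: "[c j * d = 1] (mod p)" using cong_solve_coprime_int by blast
      \<comment> \<open>With \<open>d\<close> inverse to \<open>c j\<close>, the relation can be
        solved for \<open>x\<close>, against its choice outside the span of the columns in
        \<open>J\<close>.\<close>
      have "x = \<phi> (restrict (\<lambda>l. (- d * c l) mod int p) J)"
      proof
        fix i
        show "x i = \<phi> (restrict (\<lambda>l. (- d * c l) mod int p) J) i"
        proof (cases "i < n")
          case True
          have "[(\<Sum>l\<in>J. restrict (\<lambda>l. (- d * c l) mod int p) J l * M $$ (i, l))
              = (\<Sum>l\<in>J. (- d * c l) * M $$ (i, l))] (mod p)"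
            by (intro cong_sum cong_mult) (auto simp: cong_def)
          also have "(\<Sum>l\<in>J. (- d * c l) * M $$ (i, l)) = - d * (\<Sum>l\<in>J. c l * M $$ (i, l))"
            by (simp add: sum_distrib_left mult.assoc)
          also have "[\<dots> = x i] (mod p)"
          proof -
            have "int p dvd (c j * d - 1) * x i - d * (c j * x i + (\<Sum>l\<in>J. c l * M $$ (i, l)))"
              using c[OF True] d unfolding cong_iff_dvd_diff
              by (metis dvd_diff dvd_mult dvd_mult2)
            also have "(c j * d - 1) * x i - d * (c j * x i + (\<Sum>l\<in>J. c l * M $$ (i, l)))
                = - d * (\<Sum>l\<in>J. c l * M $$ (i, l)) - x i"
              by (simp add: ring_distribs)
            finally show ?thesis unfolding cong_iff_dvd_diff .
          qed
          finally have "(\<Sum>l\<in>J. restrict (\<lambda>l. (- d * c l) mod int p) J l * M $$ (i, l)) mod int p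
              = x i mod int p" unfolding cong_def .
          also have "x i mod int p = x i" using True PiE_mem[OF x(1), of i] by simp
          finally show ?thesis using True by (simp only: \<phi>_def restrict_apply lessThan_iff if_True)
        next
          case False
          then show ?thesis using PiE_arb[OF x(1)] by (simp add: \<phi>_def)
        qed
      qed
      moreover have "restrict (\<lambda>l. (- d * c l) mod int p) J \<in> J \<rightarrow>\<^sub>E {0..<int p}"
        using p1 by auto
      ultimately show False using x(2) by blast
    qed
    have "int p dvd (\<Sum>l\<in>J. c l * M $$ (i, l))" if "i < n" for i
      using c[OF that] cj by (metis dvd_add_right_iff dvd_mult2)
    then have "\<forall>i<dim_row M. int p dvd (\<Sum>l\<in>J. c l * M $$ (i, l))" using Suc.prems(1) by simp
    then have "\<forall>l\<in>J. int p dvd c l"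
      using Suc.prems(3) unfolding cols_independent_mod_def by blast
    with cj show "\<forall>l\<in>insert j J. int p dvd c l" by blast
  qed
  moreover have "k = card ({..<n} - insert j J)"
    using Suc.hyps(2) j by (simp add: Diff_insert[of _ j J])
  ultimately obtain N where "N \<in> carrier_mat n n" "\<not> int p dvd det N"
      "\<forall>i<n. \<forall>l\<in>insert j J. N $$ (i, l) = M' $$ (i, l)"
    using Suc.hyps(1)[of "insert j J" M'] Suc.prems(2) j by (auto simp: M'_def)
  then show ?case using j Suc.prems(2) by (intro bexI[of _ N]) (auto simp: M'_def)
qed

section \<open>Kernels modulo prime powers in corank one\<close>

lemma mult_mat_vec_smult:
  fixes A :: "'a::comm_semiring_0 mat"
  assumes "A \<in> carrier_mat n m" "v \<in> carrier_vec m"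
  shows "A *\<^sub>v (k \<cdot>\<^sub>v v) = k \<cdot>\<^sub>v (A *\<^sub>v v)"
  using assms by (intro eq_vecI) auto

lemma smult_vec_cancel:
  fixes x y :: "'a::idom vec"
  assumes "k \<noteq> 0" "k \<cdot>\<^sub>v x = k \<cdot>\<^sub>v y"
  shows "x = y"
proof (rule eq_vecI)
  show dim: "dim_vec x = dim_vec y" using arg_cong[OF assms(2), of dim_vec] by simp
  fix i assume "i < dim_vec y"
  then have "k * x $ i = k * y $ i" using arg_cong[OF assms(2), of "\<lambda>v. v $ i"] dim by simp
  then show "x $ i = y $ i" using assms(1) by simp
qed

lemma vec_diff_add_cancel:
  fixes u v :: "int vec"
  shows "u \<in> carrier_vec m \<Longrightarrow> v \<in> carrier_vec m \<Longrightarrow> (u - v) + v = u"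
  by (intro eq_vecI) auto

lemma dvd_vec_diffE:
  assumes "dvd_vec q (x - z)" "x \<in> carrier_vec n" "z \<in> carrier_vec n"
  obtains y where "y \<in> carrier_vec n" "x = z + q \<cdot>\<^sub>v y"
proof -
  obtain y where y: "y \<in> carrier_vec n" "x - z = q \<cdot>\<^sub>v y"
    using dvd_vecE[OF assms(1), of n] assms by (metis minus_carrier_vec)
  have "x = z + q \<cdot>\<^sub>v y"
    unfolding y(2)[symmetric] using assms(2,3) by (intro eq_vecI) auto
  with y show thesis using that by blast
qed

text \<open>For a singular matrix this says that its rank modulo \<open>p\<close> is one less than its size.\<close>

definition corank1_mod :: "nat \<Rightarrow> int mat \<Rightarrow> bool" where
  "corank1_mod p W \<longleftrightarrow> (\<exists>j<dim_col W. \<exists>N\<in>carrier_mat (dim_row W) (dim_col W).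
     (\<forall>i<dim_row W. \<forall>k<dim_col W. k \<noteq> j \<longrightarrow> N $$ (i, k) = W $$ (i, k)) \<and> \<not> int p dvd det N)"

text \<open>Although the corank is known only modulo \<open>p\<close>, a kernel vector
  \<open>w\<close> that is nonzero modulo \<open>p\<close> generates the kernel of
  \<open>W\<^sup>T\<close> modulo \<open>p ^ c\<close>. The matrix \<open>N\<^sup>T\<close> is
  invertible modulo \<open>p\<close> and agrees with \<open>W\<^sup>T\<close> except in row
  \<open>j\<close>, so a kernel vector is determined by coordinate \<open>j\<close> of its image
  under \<open>N\<^sup>T\<close>.\<close>

lemma proportional_mod_of_corank1:
  assumes W: "W \<in> carrier_mat n n" and cr: "corank1_mod p W" and p: "prime p" and "c > 0"
    and x: "x \<in> carrier_vec n" "dvd_vec (int p ^ c) (W\<^sup>T *\<^sub>v x)"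
    and w: "w \<in> carrier_vec n" "dvd_vec (int p ^ c) (W\<^sup>T *\<^sub>v w)" "\<not> dvd_vec p w"
  obtains \<mu> y where "y \<in> carrier_vec n" "x = \<mu> \<cdot>\<^sub>v w + (int p ^ c) \<cdot>\<^sub>v y"
proof -
  from cr W obtain j N where j: "j < n" and N: "N \<in> carrier_mat n n" "\<not> int p dvd det N"
    and NW: "\<And>i k. i < n \<Longrightarrow> k < n \<Longrightarrow> k \<noteq> j \<Longrightarrow> N $$ (i, k) = W $$ (i, k)"
    unfolding corank1_mod_def by auto
  let ?q = "int p ^ c"
  have pI: "prime (int p)" using p by simp
  have cop: "coprime (int p) (det N\<^sup>T)"
    using N pI prime_imp_coprime det_transpose[OF N(1)] by metis
  have NT: "N\<^sup>T \<in> carrier_mat n n" using N by simp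
  have comp: "(N\<^sup>T *\<^sub>v v) $ k = (W\<^sup>T *\<^sub>v v) $ k" if "k < n" "k \<noteq> j" for k v
  proof -
    have "col N k = col W k" using NW N(1) W that by (intro eq_vecI) auto
    then show ?thesis using N(1) W that by simp
  qed
  define a where "a = (N\<^sup>T *\<^sub>v x) $ j"
  define b where "b = (N\<^sup>T *\<^sub>v w) $ j"
  \<comment> \<open>Otherwise \<open>N\<^sup>T\<close> would annihilate \<open>w\<close> modulo
    \<open>p\<close>, and its invertibility would force \<open>w\<close> to vanish there.\<close>
  have "\<not> int p dvd b"
  proof
    assume "int p dvd b"
    have "dvd_vec p (N\<^sup>T *\<^sub>v w)"
      unfolding dvd_vec_def
    proof (intro allI impI)
      fix k assume "k < dim_vec (N\<^sup>T *\<^sub>v w)"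
      then have k: "k < n" using N(1) by simp
      have "dvd_vec p (W\<^sup>T *\<^sub>v w)" using w(2) \<open>c > 0\<close> by (metis dvd_power dvd_vec_trans)
      then show "int p dvd (N\<^sup>T *\<^sub>v w) $ k"
        using comp[OF k] \<open>int p dvd b\<close> k W unfolding b_def dvd_vec_def
        by (cases "k = j") (auto simp del: index_mult_mat_vec)
    qed
    then show False using dvd_vec_mat_cancel[OF NT w(1) cop] w(3) by simp
  qed
  then have "coprime b ?q" using pI prime_imp_coprime coprime_commute
    by (metis coprime_power_right_iff)
  then obtain \<gamma> where \<gamma>: "[b * \<gamma> = 1] (mod ?q)" using cong_solve_coprime_int by blast
  \<comment> \<open>The coefficients \<open>a\<close> and \<open>b\<close> are chosen to cancel
    coordinate \<open>j\<close>; the other coordinates vanish because \<open>x\<close> and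
    \<open>w\<close> lie in the kernel of \<open>W\<^sup>T\<close>.\<close>
  have "dvd_vec ?q (N\<^sup>T *\<^sub>v (b \<cdot>\<^sub>v x - a \<cdot>\<^sub>v w))"
    unfolding dvd_vec_def
  proof (intro allI impI)
    fix k assume "k < dim_vec (N\<^sup>T *\<^sub>v (b \<cdot>\<^sub>v x - a \<cdot>\<^sub>v w))"
    then have k: "k < n" using N(1) by simp
    have eq: "(N\<^sup>T *\<^sub>v (b \<cdot>\<^sub>v x - a \<cdot>\<^sub>v w)) $ k = b * (N\<^sup>T *\<^sub>v x) $ k - a * (N\<^sup>T *\<^sub>v w) $ k"
      using k x(1) w(1) N(1)
      by (simp add: mult_minus_distrib_mat_vec[OF NT] mult_mat_vec_smult[OF NT x(1)] mult_mat_vec_smult[OF NT w(1)]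
          del: index_mult_mat_vec)
    show "?q dvd (N\<^sup>T *\<^sub>v (b \<cdot>\<^sub>v x - a \<cdot>\<^sub>v w)) $ k"
    proof (cases "k = j")
      case True
      show ?thesis unfolding eq unfolding True a_def[symmetric] b_def[symmetric] by simp
    next
      case False
      then have "?q dvd (N\<^sup>T *\<^sub>v x) $ k" "?q dvd (N\<^sup>T *\<^sub>v w) $ k"
        using comp[OF k] x(2) w(2) k W unfolding dvd_vec_def by auto
      then show ?thesis unfolding eq by (intro dvd_diff dvd_mult)
    qed
  qed
  then have q: "dvd_vec ?q (b \<cdot>\<^sub>v x - a \<cdot>\<^sub>v w)"
    using dvd_vec_mat_cancel[OF NT, of "b \<cdot>\<^sub>v x - a \<cdot>\<^sub>v w" ?q] x(1) w(1) cop by simp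
  have "dvd_vec ?q (x - (\<gamma> * a) \<cdot>\<^sub>v w)"
    unfolding dvd_vec_def
  proof (intro allI impI)
    fix i assume "i < dim_vec (x - (\<gamma> * a) \<cdot>\<^sub>v w)"
    then have i: "i < n" using w(1) by simp
    have 1: "?q dvd b * x $ i - a * w $ i" using q i x(1) w(1) unfolding dvd_vec_def by simp
    have 2: "?q dvd b * \<gamma> - 1" using \<gamma> by (simp add: cong_iff_dvd_diff)
    have "?q dvd \<gamma> * (b * x $ i - a * w $ i) - (b * \<gamma> - 1) * x $ i"
      by (rule dvd_diff[OF dvd_mult[OF 1] dvd_mult2[OF 2]])
    also have "\<gamma> * (b * x $ i - a * w $ i) - (b * \<gamma> - 1) * x $ i = (x - (\<gamma> * a) \<cdot>\<^sub>v w) $ i"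
      using i x(1) w(1) by (simp add: algebra_simps)
    finally show "?q dvd (x - (\<gamma> * a) \<cdot>\<^sub>v w) $ i" .
  qed
  then obtain y where "y \<in> carrier_vec n" "x = (\<gamma> * a) \<cdot>\<^sub>v w + ?q \<cdot>\<^sub>v y"
    using dvd_vec_diffE x(1) w(1) by (metis smult_carrier_vec)
  then show thesis using that by blast
qed

section \<open>Isotropic vectors modulo the square of an odd prime\<close>

lemma scalar_prod_combination:
  fixes x w :: "int vec"
  assumes "x \<in> carrier_vec n" "w \<in> carrier_vec n" "s \<in> carrier_vec n"
  shows "x \<bullet> (a \<cdot>\<^sub>v w + b \<cdot>\<^sub>v s) = a * (x \<bullet> w) + b * (x \<bullet> s)"
    "(a \<cdot>\<^sub>v w + b \<cdot>\<^sub>v s) \<bullet> x = a * (w \<bullet> x) + b * (s \<bullet> x)"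
  using assms
  by (simp_all add: scalar_prod_add_distrib[of _ n] add_scalar_prod_distrib[of _ n])

text \<open>For two graphs of one level, \<open>w\<close> and \<open>x\<close> will be columns of
  \<open>U\<close>, and \<open>y\<close> and \<open>y0\<close> columns of \<open>U'\<close>. Modulo
  \<open>p\<^sup>2\<close> the product \<open>x \<bullet> y\<close> is
  \<open>p * (\<alpha> * (w \<bullet> t) + \<beta> * (w \<bullet> s))\<close>, so it suffices that
  \<open>p\<close> divides \<open>w \<bullet> s\<close> and \<open>w \<bullet> t\<close>. The first
  follows from \<open>x \<bullet> w\<close>. The second makes a detour over \<open>y0\<close>, whose
  coefficient \<open>\<beta>0\<close> is a unit: \<open>y0 \<bullet> y0\<close> gives
  \<open>w \<bullet> t0\<close>, and then \<open>y \<bullet> y0\<close> gives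
  \<open>w \<bullet> t\<close>.\<close>

lemma prime_square_dvd_scalar_prod:
  fixes w x y y0 :: "int vec"
  assumes p: "prime p" "odd p"
    and c: "w \<in> carrier_vec n" "s \<in> carrier_vec n" "t \<in> carrier_vec n" "t0 \<in> carrier_vec n"
    and xd: "x = \<alpha> \<cdot>\<^sub>v w + int p \<cdot>\<^sub>v s" and yd: "y = \<beta> \<cdot>\<^sub>v w + int p \<cdot>\<^sub>v t"
    and y0d: "y0 = \<beta>0 \<cdot>\<^sub>v w + int p \<cdot>\<^sub>v t0"
    and d: "(int p)\<^sup>2 dvd w \<bullet> w" "(int p)\<^sup>2 dvd x \<bullet> w" "(int p)\<^sup>2 dvd y0 \<bullet> y0" "(int p)\<^sup>2 dvd y \<bullet> y0"
    and "\<not> dvd_vec p y0"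
  shows "(int p)\<^sup>2 dvd x \<bullet> y"
proof -
  let ?p = "int p"
  have pI: "prime ?p" "?p \<noteq> 0" using p(1) prime_gt_0_nat by auto
  note e = scalar_prod_combination[where n = n]
  have cm: "s \<bullet> w = w \<bullet> s" "t \<bullet> w = w \<bullet> t" "t0 \<bullet> w = w \<bullet> t0" "t0 \<bullet> t = t \<bullet> t0"
    using c by (auto intro: comm_scalar_prod)
  obtain k where k: "w \<bullet> w = ?p\<^sup>2 * k" using d(1) by blast
  have canc: "?p dvd r" if "?p\<^sup>2 dvd ?p * r" for r
    using that pI by (simp add: power2_eq_square)
  have "x \<bullet> w = \<alpha> * (?p\<^sup>2 * k) + ?p * (w \<bullet> s)"
    unfolding xd using c by (simp add: e cm k)
  then have ws: "?p dvd w \<bullet> s" using d(2) canc by (metis dvd_add_right_iff dvd_mult dvd_triv_left)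
  have b0: "\<not> ?p dvd \<beta>0"
  proof
    assume "?p dvd \<beta>0"
    then have "dvd_vec p y0" using c unfolding y0d dvd_vec_def by auto
    then show False using assms(14) by simp
  qed
  have "y0 \<bullet> y0 = ?p\<^sup>2 * (\<beta>0 * \<beta>0 * k + t0 \<bullet> t0) + ?p * (2 * \<beta>0 * (w \<bullet> t0))"
    unfolding y0d using c by (simp add: e cm k algebra_simps power2_eq_square)
  then have "?p dvd 2 * \<beta>0 * (w \<bullet> t0)" using d(3) canc by (metis dvd_add_right_iff dvd_triv_left)
  \<comment> \<open>The factor 2 comes from the two equal cross terms of
    \<open>y0 \<bullet> y0\<close>; cancelling it uses that \<open>p\<close> is odd.\<close>
  moreover have "\<not> ?p dvd 2"
    using p by (metis int_dvd_int_iff of_nat_numeral primes_dvd_imp_eq two_is_prime_nat even_numeral)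
  ultimately have wt0: "?p dvd w \<bullet> t0" using pI b0 by (simp add: prime_dvd_mult_iff)
  have "y \<bullet> y0 = ?p\<^sup>2 * (\<beta> * \<beta>0 * k + t \<bullet> t0) + ?p * (\<beta> * (w \<bullet> t0) + \<beta>0 * (w \<bullet> t))"
    unfolding y0d yd using c by (simp add: e cm k algebra_simps power2_eq_square)
  then have "?p dvd \<beta> * (w \<bullet> t0) + \<beta>0 * (w \<bullet> t)" using d(4) canc by (metis dvd_add_right_iff dvd_triv_left)
  then have "?p dvd \<beta>0 * (w \<bullet> t)" using wt0 by (metis dvd_add_right_iff dvd_mult)
  then have wt: "?p dvd w \<bullet> t" using pI b0 by (simp add: prime_dvd_mult_iff)
  have "x \<bullet> y = ?p\<^sup>2 * (\<alpha> * \<beta> * k + s \<bullet> t) + ?p * (\<alpha> * (w \<bullet> t) + \<beta> * (w \<bullet> s))"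
    unfolding xd yd using c by (simp add: e cm k algebra_simps power2_eq_square)
  moreover have "?p * ?p dvd ?p * (\<alpha> * (w \<bullet> t) + \<beta> * (w \<bullet> s))"
    using wt ws by (intro mult_dvd_mono dvd_refl dvd_add dvd_mult)
  ultimately show ?thesis by (metis dvd_add dvd_triv_left power2_eq_square)
qed

section \<open>Companion matrices and isotropic kernel vectors\<close>

text \<open>Coordinate \<open>Suc i\<close> of the eigenvector equation expresses
  \<open>v $ i\<close> through \<open>v $ Suc i\<close> and the last coordinate, so a zero at the
  end spreads down to all indices. Hence an eigenvector is determined modulo \<open>m\<close> by its
  last coordinate.\<close>

lemma companion_eigenvector_mod:
  fixes C :: "int mat"
  assumes C: "C \<in> carrier_mat n n"
    and comp: "\<And>i j. i < n \<Longrightarrow> j < n \<Longrightarrow>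
      C $$ (i, j) = (if j = n - 1 then \<gamma> i else if i = Suc j then 1 else 0)"
    and v: "v \<in> carrier_vec n" "dvd_vec m (C *\<^sub>v v - \<theta> \<cdot>\<^sub>v v)" "m dvd v $ (n - 1)"
  shows "dvd_vec m v"
proof -
  have step: "m dvd v $ i" if "m dvd v $ Suc i" "Suc i < n" for i
  proof -
    have "(C *\<^sub>v v) $ Suc i = (\<Sum>j<n. C $$ (Suc i, j) * v $ j)"
      by (rule mult_mat_vec_index[OF C v(1) that(2)])
    also have "\<dots> = (\<Sum>j<n. (if j = n - 1 then \<gamma> (Suc i) * v $ (n - 1) else 0) +
        (if j = i then v $ i else 0))"
      using comp[OF that(2)] that(2) by (intro sum.cong) auto
    also have "\<dots> = \<gamma> (Suc i) * v $ (n - 1) + v $ i"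
      using that(2) by (simp add: sum.distrib)
    finally have "(C *\<^sub>v v - \<theta> \<cdot>\<^sub>v v) $ Suc i
        = v $ i + (\<gamma> (Suc i) * v $ (n - 1) - \<theta> * v $ Suc i)"
      using that(2) v(1) C by (simp del: index_mult_mat_vec)
    moreover have "m dvd (C *\<^sub>v v - \<theta> \<cdot>\<^sub>v v) $ Suc i"
      using v that(2) unfolding dvd_vec_def by simp
    moreover have "m dvd \<gamma> (Suc i) * v $ (n - 1) - \<theta> * v $ Suc i"
      using v(3) that(1) by (intro dvd_diff dvd_mult)
    ultimately show ?thesis by (metis dvd_add_left_iff)
  qed
  have "m dvd v $ (n - Suc k)" if "k < n" for k
    using that
  proof (induction k)
    case (Suc k)
    then have "Suc (n - Suc (Suc k)) = n - Suc k" by simp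
    then show ?case using step[of "n - Suc (Suc k)"] Suc by simp
  qed (use v in simp)
  then show ?thesis unfolding dvd_vec_def using v(1)
    by (metis Suc_pred carrier_vecD diff_Suc_less diff_diff_cancel less_imp_le_nat zero_less_diff Suc_diff_Suc less_nat_zero_code gr0I)
qed

text \<open>This prevents the exact power \<open>p ^ a\<close> in \<open>det W\<close> from dividing
  the level. Isotropy puts \<open>d \<cdot>\<^sub>v u\<close> into the image of \<open>W\<close>, as
  \<open>W *\<^sub>v z\<close> with an eigenvector \<open>z\<close> of \<open>C\<close> modulo
  \<open>p\<close>. A kernel vector \<open>y\<close> of \<open>W\<close> modulo \<open>p\<close>
  turns out to have the same eigenvalue, which is incompatible with \<open>W *\<^sub>v z\<close>
  being nonzero modulo \<open>p\<close>.\<close>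

lemma no_isotropic_kernel_vector:
  fixes A W C :: "int mat"
  assumes n: "n > 0" and A: "A \<in> carrier_mat n n" "A\<^sup>T = A" and W: "W \<in> carrier_mat n n"
    and C: "C \<in> carrier_mat n n" and AW: "A * W = W * C"
    and comp: "\<And>i j. i < n \<Longrightarrow> j < n \<Longrightarrow>
      C $$ (i, j) = (if j = n - 1 then \<gamma> i else if i = Suc j then 1 else 0)"
    and p: "prime p" and det: "det W = int p ^ a * d" "a > 0" "\<not> int p dvd d"
    and cr: "corank1_mod p W"
    and u: "u \<in> carrier_vec n" "dvd_vec (int p ^ a) (W\<^sup>T *\<^sub>v u)" "\<not> dvd_vec p u"
    and uu: "int p ^ (2 * a) dvd u \<bullet> u" and uAu: "int p ^ (2 * a) dvd u \<bullet> (A *\<^sub>v u)"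
  shows False
proof -
  let ?q = "int p ^ a"
  have pI: "prime (int p)" using p by simp
  have q0: "?q \<noteq> 0" using p prime_gt_0_nat by simp
  have pq: "int p dvd ?q" using det(2) by (simp add: dvd_power)
  have q2: "?q * ?q = int p ^ (2 * a)" by (simp add: power_add mult_2)
  have d0: "d \<noteq> 0" "coprime (int p) d" using det(3) prime_imp_coprime[OF pI det(3)] by auto
  have detW: "det W \<noteq> 0" using det(1) q0 d0 by simp
  note line = proportional_mod_of_corank1[OF W cr p det(2)]
  note e = scalar_prod_combination[where n = n]
  have Wm: "W *\<^sub>v (c \<cdot>\<^sub>v x) = c \<cdot>\<^sub>v (W *\<^sub>v x)" if "x \<in> carrier_vec n" for c x
    using mult_mat_vec_smult[OF W that] .
  \<comment> \<open>Up to the unit \<open>d\<close>, the lattice spanned by the columns of \<open>W\<close> is the orthogonal complement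
    of \<open>u\<close> modulo \<open>p ^ a\<close>: the rows of the adjugate are proportional to \<open>u\<close>.\<close>
  have inL: "\<exists>z\<in>carrier_vec n. d \<cdot>\<^sub>v x = W *\<^sub>v z" if x: "x \<in> carrier_vec n" "?q dvd u \<bullet> x" for x
  proof -
    define R where "R = adj_mat W"
    have R: "R \<in> carrier_mat n n" "R * W = det W \<cdot>\<^sub>m 1\<^sub>m n" using adj_mat[OF W] unfolding R_def by auto
    have "dvd_vec ?q (R *\<^sub>v x)"
      unfolding dvd_vec_def
    proof (intro allI impI)
      fix i assume "i < dim_vec (R *\<^sub>v x)"
      then have i: "i < n" using R by simp
      have ri: "row R i \<in> carrier_vec n" using R by auto
      have "dvd_vec ?q (W\<^sup>T *\<^sub>v row R i)"
        unfolding dvd_vec_def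
      proof (intro allI impI)
        fix k assume "k < dim_vec (W\<^sup>T *\<^sub>v row R i)"
        then have k: "k < n" using W by simp
        have "(W\<^sup>T *\<^sub>v row R i) $ k = row R i \<bullet> col W k"
          using k W ri by (simp add: comm_scalar_prod[of _ n])
        also have "\<dots> = (R * W) $$ (i, k)" using i k R(1) W by simp
        also have "\<dots> = det W * (if i = k then 1 else 0)" unfolding R(2) using i k by simp
        finally show "?q dvd (W\<^sup>T *\<^sub>v row R i) $ k" using det(1) by simp
      qed
      from line[OF ri this u]
      obtain \<mu> y where y: "y \<in> carrier_vec n" "row R i = \<mu> \<cdot>\<^sub>v u + ?q \<cdot>\<^sub>v y" .
      have "(R *\<^sub>v x) $ i = \<mu> * (u \<bullet> x) + ?q * (y \<bullet> x)"
        using i R(1) e(2)[OF x(1) u(1) y(1)] y(2) by simp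
      then show "?q dvd (R *\<^sub>v x) $ i" using x(2) by simp
    qed
    then obtain z where z: "z \<in> carrier_vec n" "R *\<^sub>v x = ?q \<cdot>\<^sub>v z"
      using dvd_vecE[of ?q "R *\<^sub>v x" n] R(1) x(1) by (metis mult_mat_vec_carrier)
    have "?q \<cdot>\<^sub>v (W *\<^sub>v z) = W *\<^sub>v (R *\<^sub>v x)" unfolding z(2) by (rule Wm[OF z(1), symmetric])
    also have "\<dots> = ?q \<cdot>\<^sub>v (d \<cdot>\<^sub>v x)"
      unfolding R_def adj_mat_mult_vec(2)[OF W x(1)] det(1) by (simp add: smult_smult_assoc)
    finally have "W *\<^sub>v z = d \<cdot>\<^sub>v x" using smult_vec_cancel q0 by blast
    then show ?thesis using z(1) by metis
  qed
  have Au: "A *\<^sub>v u \<in> carrier_vec n" using A u by simp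
  \<comment> \<open>Since \<open>A * W = W * C\<close>, the kernel of \<open>W\<^sup>T\<close>
    modulo \<open>p ^ a\<close> is stable under \<open>A\<close>. It is generated by
    \<open>u\<close>, which is therefore an eigenvector of \<open>A\<close> modulo
    \<open>p ^ a\<close>.\<close>
  have "W\<^sup>T *\<^sub>v (A *\<^sub>v u) = (A * W)\<^sup>T *\<^sub>v u"
    using A W u(1) by (simp add: transpose_mult[OF A(1) W] assoc_mult_mat_vec[of _ n n _ n])
  also have "\<dots> = C\<^sup>T *\<^sub>v (W\<^sup>T *\<^sub>v u)"
    unfolding AW using C W u(1) by (simp add: transpose_mult[OF W C] assoc_mult_mat_vec[of _ n n _ n])
  finally have "dvd_vec ?q (W\<^sup>T *\<^sub>v (A *\<^sub>v u))"
    using u(2) C W by (simp add: dvd_vec_mult_mat)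
  from line[OF Au this u]
  obtain \<theta> m where m: "m \<in> carrier_vec n" "A *\<^sub>v u = \<theta> \<cdot>\<^sub>v u + ?q \<cdot>\<^sub>v m" .
  have quu: "?q dvd u \<bullet> u" using uu q2 by (metis dvd_mult_left)
  \<comment> \<open>Divisibility by the square of \<open>p ^ a\<close> matters here: after one
    factor \<open>p ^ a\<close> is cancelled, \<open>m\<close> is still orthogonal to
    \<open>u\<close> modulo \<open>p ^ a\<close>, so \<open>d \<cdot>\<^sub>v m\<close> is in the
    image of \<open>W\<close>.\<close>
  have "u \<bullet> (A *\<^sub>v u) = \<theta> * (u \<bullet> u) + ?q * (u \<bullet> m)"
    unfolding m(2) by (rule e(1)[OF u(1) u(1) m(1)])
  then have "?q * ?q dvd ?q * (u \<bullet> m)" using uu uAu unfolding q2 by (metis dvd_add_right_iff dvd_mult)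
  then have "?q dvd u \<bullet> m" using q0 by (metis dvd_mult_cancel_left)
  from inL[OF m(1) this] obtain z2 where z2: "z2 \<in> carrier_vec n" "d \<cdot>\<^sub>v m = W *\<^sub>v z2" by blast
  from inL[OF u(1) quu] obtain z where z: "z \<in> carrier_vec n" "d \<cdot>\<^sub>v u = W *\<^sub>v z" by blast
  have WC: "W *\<^sub>v (C *\<^sub>v v - \<theta> \<cdot>\<^sub>v v) = A *\<^sub>v (W *\<^sub>v v) - \<theta> \<cdot>\<^sub>v (W *\<^sub>v v)" if v: "v \<in> carrier_vec n" for v
  proof -
    have "W *\<^sub>v (C *\<^sub>v v) = A *\<^sub>v (W *\<^sub>v v)"
      using A(1) W C v AW by (metis assoc_mult_mat_vec)
    then show ?thesis using v C Wm by (simp add: mult_minus_distrib_mat_vec[OF W])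
  qed
  have cancel: "C *\<^sub>v v - \<theta> \<cdot>\<^sub>v v = y"
    if "v \<in> carrier_vec n" "y \<in> carrier_vec n" "A *\<^sub>v (W *\<^sub>v v) - \<theta> \<cdot>\<^sub>v (W *\<^sub>v v) = W *\<^sub>v y" for v y
    using mult_mat_vec_cancel[OF W _ that(2) detW] WC[OF that(1)] that C by simp
  \<comment> \<open>The difference \<open>A u - \<theta> u\<close> is \<open>p ^ a\<close> times
    \<open>m\<close>. As \<open>d u\<close> and \<open>d m\<close> are both in the image of
    \<open>W\<close>, the eigenvector equation can be pulled back through \<open>W\<close>.\<close>
  have z_eig: "dvd_vec p (C *\<^sub>v z - \<theta> \<cdot>\<^sub>v z)"
  proof -
    have "A *\<^sub>v (W *\<^sub>v z) - \<theta> \<cdot>\<^sub>v (W *\<^sub>v z) = d \<cdot>\<^sub>v (A *\<^sub>v u) - \<theta> \<cdot>\<^sub>v (d \<cdot>\<^sub>v u)"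
      unfolding z(2)[symmetric] using mult_mat_vec_smult[OF A(1) u(1)] by simp
    also have "\<dots> = ?q \<cdot>\<^sub>v (d \<cdot>\<^sub>v m)"
      unfolding m(2) using u(1) m(1) by (intro eq_vecI) (auto simp: algebra_simps)
    also have "\<dots> = W *\<^sub>v (?q \<cdot>\<^sub>v z2)" unfolding z2(2) Wm[OF z2(1)] ..
    finally have "C *\<^sub>v z - \<theta> \<cdot>\<^sub>v z = ?q \<cdot>\<^sub>v z2" using cancel z(1) z2(1) by simp
    then show ?thesis using dvd_vec_trans[OF pq] by simp
  qed
  have "int p dvd det W" using det(1) pq by simp
  then obtain y where y: "y \<in> carrier_vec n" "dvd_vec p (W *\<^sub>v y)" "\<not> dvd_vec p y"
    using kernel_mod_of_dvd_det[OF W prime_gt_1_nat[OF p]] by blast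
  then obtain x where x: "x \<in> carrier_vec n" "W *\<^sub>v y = int p \<cdot>\<^sub>v x"
    using dvd_vecE[OF y(2), of n] W by auto
  \<comment> \<open>By the symmetry of \<open>A\<close>, the vector \<open>A x - \<theta> x\<close>
    is orthogonal to \<open>u\<close> modulo \<open>p ^ a\<close>, so \<open>d\<close> times it is
    in the image of \<open>W\<close>. Multiplying by \<open>p\<close> and pulling back through
    \<open>W\<close> gives the equation for \<open>d y\<close>.\<close>
  have y_eig: "dvd_vec p (C *\<^sub>v y - \<theta> \<cdot>\<^sub>v y)"
  proof -
    let ?x = "A *\<^sub>v x - \<theta> \<cdot>\<^sub>v x"
    have xc: "?x \<in> carrier_vec n" using A x by simp
    have "u \<bullet> (A *\<^sub>v x) = (A *\<^sub>v u) \<bullet> x"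
      using transpose_vec_mult_scalar[OF A(1) x(1) u(1)] A(2) by simp
    also have "\<dots> = \<theta> * (u \<bullet> x) + ?q * (m \<bullet> x)"
      unfolding m(2) by (rule e(2)[OF x(1) u(1) m(1)])
    finally have "u \<bullet> ?x = ?q * (m \<bullet> x)"
      using A x u by (simp add: scalar_prod_minus_distrib[of _ n])
    then obtain z3 where z3: "z3 \<in> carrier_vec n" "d \<cdot>\<^sub>v ?x = W *\<^sub>v z3" using inL[OF xc] by auto
    have "A *\<^sub>v (W *\<^sub>v (d \<cdot>\<^sub>v y)) - \<theta> \<cdot>\<^sub>v (W *\<^sub>v (d \<cdot>\<^sub>v y)) =
        d \<cdot>\<^sub>v (int p \<cdot>\<^sub>v (A *\<^sub>v x)) - \<theta> \<cdot>\<^sub>v (d \<cdot>\<^sub>v (int p \<cdot>\<^sub>v x))"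
      unfolding Wm[OF y(1)] x(2) using x(1) A(1) by (simp add: mult_mat_vec_smult[OF A(1)])
    also have "\<dots> = int p \<cdot>\<^sub>v (d \<cdot>\<^sub>v ?x)"
      using x(1) A(1) by (intro eq_vecI) (auto simp: algebra_simps simp del: index_mult_mat_vec)
    also have "\<dots> = W *\<^sub>v (int p \<cdot>\<^sub>v z3)" unfolding z3(2) Wm[OF z3(1)] ..
    finally have "C *\<^sub>v (d \<cdot>\<^sub>v y) - \<theta> \<cdot>\<^sub>v (d \<cdot>\<^sub>v y) = int p \<cdot>\<^sub>v z3" using cancel y(1) z3(1) by simp
    moreover have "C *\<^sub>v (d \<cdot>\<^sub>v y) - \<theta> \<cdot>\<^sub>v (d \<cdot>\<^sub>v y) = d \<cdot>\<^sub>v (C *\<^sub>v y - \<theta> \<cdot>\<^sub>v y)"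
      unfolding mult_mat_vec_smult[OF C y(1)]
      using y(1) C by (intro eq_vecI) (auto simp: algebra_simps simp del: index_mult_mat_vec)
    ultimately have "dvd_vec p (d \<cdot>\<^sub>v (C *\<^sub>v y - \<theta> \<cdot>\<^sub>v y))" by simp
    then show ?thesis by (rule dvd_vec_smult_cancel[OF d0(2)])
  qed
  have eig: "dvd_vec p v" if "v \<in> carrier_vec n" "dvd_vec p (C *\<^sub>v v - \<theta> \<cdot>\<^sub>v v)" "int p dvd v $ (n - 1)" for v
    by (rule companion_eigenvector_mod[OF C _ that, of \<gamma>]) (rule comp)
  \<comment> \<open>Modulo \<open>p\<close> the eigenspaces of a companion matrix are lines, so \<open>y\<close> and \<open>z\<close> are proportional,
    although \<open>W\<close> annihilates only \<open>y\<close>.\<close>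
  define v where "v = (y $ (n - 1)) \<cdot>\<^sub>v z - (z $ (n - 1)) \<cdot>\<^sub>v y"
  have v: "v \<in> carrier_vec n" unfolding v_def using y z by simp
  have "C *\<^sub>v v - \<theta> \<cdot>\<^sub>v v = (y $ (n - 1)) \<cdot>\<^sub>v (C *\<^sub>v z - \<theta> \<cdot>\<^sub>v z) - (z $ (n - 1)) \<cdot>\<^sub>v (C *\<^sub>v y - \<theta> \<cdot>\<^sub>v y)"
  proof -
    have "C *\<^sub>v v = (y $ (n - 1)) \<cdot>\<^sub>v (C *\<^sub>v z) - (z $ (n - 1)) \<cdot>\<^sub>v (C *\<^sub>v y)"
      unfolding v_def using y z by (simp add: mult_minus_distrib_mat_vec[OF C] mult_mat_vec_smult[OF C])
    then show ?thesis unfolding v_def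
      using y(1) z(1) C by (intro eq_vecI) (auto simp: algebra_simps simp del: index_mult_mat_vec)
  qed
  then have "dvd_vec p (C *\<^sub>v v - \<theta> \<cdot>\<^sub>v v)"
    using z_eig y_eig y(1) z(1) C by (simp add: dvd_vec_diff dvd_vec_smultI)
  moreover have "int p dvd v $ (n - 1)" unfolding v_def using y(1) z(1) n by simp
  ultimately have "dvd_vec p v" using eig v by blast
  then have "dvd_vec p (W *\<^sub>v v)" using W v by (intro dvd_vec_mult_mat) auto
  moreover have "W *\<^sub>v v = (y $ (n - 1)) \<cdot>\<^sub>v (d \<cdot>\<^sub>v u) - (z $ (n - 1)) \<cdot>\<^sub>v (int p \<cdot>\<^sub>v x)"
    unfolding v_def z(2) x(2)[symmetric] using y z by (simp add: mult_minus_distrib_mat_vec[OF W] Wm)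
  ultimately have "dvd_vec p (((y $ (n - 1)) \<cdot>\<^sub>v (d \<cdot>\<^sub>v u) - (z $ (n - 1)) \<cdot>\<^sub>v (int p \<cdot>\<^sub>v x)) +
      (z $ (n - 1)) \<cdot>\<^sub>v (int p \<cdot>\<^sub>v x))"
    using u(1) x(1) by (intro dvd_vec_add dvd_vec_smultI[OF dvd_vec_smult]) auto
  also have "((y $ (n - 1)) \<cdot>\<^sub>v (d \<cdot>\<^sub>v u) - (z $ (n - 1)) \<cdot>\<^sub>v (int p \<cdot>\<^sub>v x)) + (z $ (n - 1)) \<cdot>\<^sub>v (int p \<cdot>\<^sub>v x)
      = (y $ (n - 1) * d) \<cdot>\<^sub>v u"
    using u(1) x(1) by (intro eq_vecI) auto
  finally have "dvd_vec p ((y $ (n - 1) * d) \<cdot>\<^sub>v u)" .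
  moreover have "\<not> int p dvd y $ (n - 1)" using eig[OF y(1) y_eig] y(3) by blast
  then have "coprime (int p) (y $ (n - 1) * d)" using prime_imp_coprime[OF pI] d0(2) by simp
  ultimately show False using u(3) dvd_vec_smult_cancel by blast
qed

section \<open>Krylov matrices modulo 2\<close>

definition krylov :: "int mat \<Rightarrow> nat \<Rightarrow> int vec" where
  "krylov A j = (A ^\<^sub>m j) *\<^sub>v vec (dim_row A) (\<lambda>_. 1)"

text \<open>This is the walk matrix, with an arbitrary integer matrix in place of the adjacency
  matrix.\<close>

definition krylov_mat :: "int mat \<Rightarrow> int mat" where
  "krylov_mat A = mat_of_cols (dim_row A) (map (krylov A) [0..<dim_row A])"

text \<open>For an adjacency matrix this is the number of walks of length \<open>k\<close>.\<close>

definition moment :: "int mat \<Rightarrow> nat \<Rightarrow> int" where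
  "moment A k = vec (dim_row A) (\<lambda>_. 1) \<bullet> krylov A k"

lemma pow_mult_vec_carrier:
  "A \<in> carrier_mat n n \<Longrightarrow> v \<in> carrier_vec n \<Longrightarrow> A ^\<^sub>m k *\<^sub>v v \<in> carrier_vec n"
  by (rule mult_mat_vec_carrier[OF pow_carrier_mat])

lemma pow_mat_mult_vec_Suc:
  fixes A :: "'a::comm_semiring_1 mat"
  assumes "A \<in> carrier_mat n n" "v \<in> carrier_vec n"
  shows "(A ^\<^sub>m Suc k) *\<^sub>v v = A *\<^sub>v (A ^\<^sub>m k *\<^sub>v v)"
  using assms(2)
proof (induction k arbitrary: v)
  case 0
  then show ?case using assms(1) by simp
next
  case (Suc k)
  have "(A ^\<^sub>m Suc (Suc k)) *\<^sub>v v = (A ^\<^sub>m Suc k) *\<^sub>v (A *\<^sub>v v)"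
    unfolding pow_mat.simps(2)[of A "Suc k"]
    by (rule assoc_mult_mat_vec[OF pow_carrier_mat[OF assms(1)] assms(1) Suc.prems])
  also have "\<dots> = A *\<^sub>v (A ^\<^sub>m k *\<^sub>v (A *\<^sub>v v))"
    using Suc.IH[of "A *\<^sub>v v"] assms(1) Suc.prems by simp
  also have "A ^\<^sub>m k *\<^sub>v (A *\<^sub>v v) = (A ^\<^sub>m Suc k) *\<^sub>v v"
    unfolding pow_mat.simps(2)
    by (rule assoc_mult_mat_vec[OF pow_carrier_mat[OF assms(1)] assms(1) Suc.prems, symmetric])
  finally show ?case .
qed

lemma pow_mat_mult_vec_add:
  fixes A :: "'a::comm_semiring_1 mat"
  assumes "A \<in> carrier_mat n n" "v \<in> carrier_vec n"
  shows "(A ^\<^sub>m (i + j)) *\<^sub>v v = A ^\<^sub>m i *\<^sub>v (A ^\<^sub>m j *\<^sub>v v)"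
proof (induction i)
  case 0
  have "A ^\<^sub>m j *\<^sub>v v \<in> carrier_vec n" by (rule pow_mult_vec_carrier[OF assms])
  then show ?case using assms by simp
next
  case (Suc i)
  have 1: "A ^\<^sub>m j *\<^sub>v v \<in> carrier_vec n" by (rule pow_mult_vec_carrier[OF assms])
  have "(A ^\<^sub>m (Suc i + j)) *\<^sub>v v = A *\<^sub>v (A ^\<^sub>m (i + j) *\<^sub>v v)"
    using pow_mat_mult_vec_Suc[OF assms, of "i + j"] by simp
  then show ?case unfolding Suc pow_mat_mult_vec_Suc[OF assms(1) 1] .
qed

lemma scalar_prod_symmetric_pow:
  fixes A :: "'a::comm_semiring_1 mat"
  assumes A: "A \<in> carrier_mat n n" "A\<^sup>T = A" and xy: "x \<in> carrier_vec n" "y \<in> carrier_vec n"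
  shows "x \<bullet> (A ^\<^sub>m k *\<^sub>v y) = (A ^\<^sub>m k *\<^sub>v x) \<bullet> y"
  using xy
proof (induction k arbitrary: x)
  case (Suc k)
  have "x \<bullet> (A ^\<^sub>m Suc k *\<^sub>v y) = x \<bullet> (A *\<^sub>v (A ^\<^sub>m k *\<^sub>v y))"
    using pow_mat_mult_vec_Suc[OF A(1) Suc.prems(2)] by simp
  also have "\<dots> = (A *\<^sub>v x) \<bullet> (A ^\<^sub>m k *\<^sub>v y)"
    using transpose_vec_mult_scalar[OF A(1) pow_mult_vec_carrier[OF A(1) Suc.prems(2)] Suc.prems(1)] A(2)
    by simp
  also have "\<dots> = (A ^\<^sub>m k *\<^sub>v (A *\<^sub>v x)) \<bullet> y" using Suc A by simp
  also have "A ^\<^sub>m k *\<^sub>v (A *\<^sub>v x) = A ^\<^sub>m Suc k *\<^sub>v x"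
    unfolding pow_mat.simps(2)
    by (rule assoc_mult_mat_vec[OF pow_carrier_mat[OF A(1)] A(1) Suc.prems(1), symmetric])
  finally show ?case .
qed (use A in simp)

context
  fixes A :: "int mat" and n :: nat
  assumes A: "A \<in> carrier_mat n n"
begin

lemma krylov_carrier [simp]: "krylov A j \<in> carrier_vec n"
  unfolding krylov_def using A by (intro pow_mult_vec_carrier) auto

lemma dim_krylov [simp]: "dim_vec (krylov A j) = n"
  using krylov_carrier by (rule carrier_vecD)

lemma krylov_0: "krylov A 0 = vec n (\<lambda>_. 1)"
  using A by (auto simp: krylov_def)

lemma krylov_Suc: "krylov A (Suc j) = A *\<^sub>v krylov A j"
  using pow_mat_mult_vec_Suc[OF A, of "vec n (\<lambda>_. 1)" j] A by (simp add: krylov_def)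

lemma pow_mult_krylov: "A ^\<^sub>m i *\<^sub>v krylov A j = krylov A (i + j)"
  using pow_mat_mult_vec_add[OF A, of "vec n (\<lambda>_. 1)" i j] A by (simp add: krylov_def)

lemma krylov_mat_carrier [simp]: "krylov_mat A \<in> carrier_mat n n"
  using mat_of_cols_carrier(1)[of n "map (krylov A) [0..<n]"] A by (simp add: krylov_mat_def)

lemma dim_krylov_mat [simp]: "dim_row (krylov_mat A) = n" "dim_col (krylov_mat A) = n"
  using krylov_mat_carrier by (rule carrier_matD)+

lemma krylov_mat_index: "i < n \<Longrightarrow> j < n \<Longrightarrow> krylov_mat A $$ (i, j) = krylov A j $ i"
  using A by (simp add: krylov_mat_def mat_of_cols_index)

lemma col_krylov_mat: "j < n \<Longrightarrow> col (krylov_mat A) j = krylov A j"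
  by (intro eq_vecI) (simp_all add: krylov_mat_index)

lemma scalar_prod_krylov_mat:
  assumes "x \<in> carrier_vec n" "y \<in> carrier_vec n"
  shows "x \<bullet> (krylov_mat A *\<^sub>v y) = (\<Sum>j<n. y $ j * (x \<bullet> krylov A j))"
proof -
  have "x \<bullet> (krylov_mat A *\<^sub>v y) = (\<Sum>i<n. \<Sum>j<n. x $ i * (krylov A j $ i * y $ j))"
    using assms by (simp add: scalar_prod_def krylov_mat_index lessThan_atLeast0 sum_distrib_left)
  also have "\<dots> = (\<Sum>j<n. y $ j * (x \<bullet> krylov A j))"
    by (subst sum.swap)
       (auto simp: scalar_prod_def lessThan_atLeast0 sum_distrib_left mult_ac intro!: sum.cong)
  finally show ?thesis .
qed

lemma transpose_krylov_mat_index: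
  assumes "x \<in> carrier_vec n" "j < n"
  shows "((krylov_mat A)\<^sup>T *\<^sub>v x) $ j = krylov A j \<bullet> x"
  using assms by (simp add: col_krylov_mat)

text \<open>By symmetry, powers of \<open>A\<close> move across the product. The Gram matrix of the
  Krylov vectors is thus the Hankel matrix of the moments.\<close>

lemma scalar_prod_krylov:
  assumes sym: "A\<^sup>T = A"
  shows "krylov A i \<bullet> krylov A j = moment A (i + j)"
proof -
  have "krylov A i \<bullet> krylov A j = (A ^\<^sub>m i *\<^sub>v vec n (\<lambda>_. 1)) \<bullet> krylov A j"
    using A by (simp add: krylov_def)
  also have "\<dots> = vec n (\<lambda>_. 1) \<bullet> (A ^\<^sub>m i *\<^sub>v krylov A j)"
    using scalar_prod_symmetric_pow[OF A sym, of "vec n (\<lambda>_. 1)" "krylov A j"] by simp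
  finally show ?thesis unfolding pow_mult_krylov moment_def using A by simp
qed

end

section \<open>Parity of the moments\<close>

lemma symmetric_double_sum:
  fixes f :: "nat \<Rightarrow> nat \<Rightarrow> int"
  assumes "\<And>i j. f i j = f j i"
  shows "(\<Sum>i<n. \<Sum>j<n. f i j) = (\<Sum>i<n. f i i) + 2 * (\<Sum>i<n. \<Sum>j<i. f i j)"
proof (induction n)
  case (Suc n)
  have "(\<Sum>i<Suc n. \<Sum>j<Suc n. f i j) = (\<Sum>i<n. \<Sum>j<n. f i j) + (\<Sum>i<n. f i n) + (\<Sum>j<n. f n j) + f n n"
    by (simp add: sum.distrib)
  also have "(\<Sum>i<n. f i n) = (\<Sum>j<n. f n j)" using assms by simp
  finally show ?case using Suc by simp
qed simp

context
  fixes A :: "int mat" and n :: nat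
  assumes A: "A \<in> carrier_mat n n" and sym: "A\<^sup>T = A" and diag: "\<And>i. i < n \<Longrightarrow> A $$ (i, i) = 0"
begin

text \<open>The off-diagonal terms come in equal pairs and the diagonal vanishes: \<open>A\<close>
  is alternating modulo 2.\<close>

lemma even_quadratic_form:
  assumes x: "x \<in> carrier_vec n"
  shows "even (x \<bullet> (A *\<^sub>v x))"
proof -
  define f where "f i j = (if i < n \<and> j < n then x $ i * A $$ (i, j) * x $ j else 0)" for i j
  have "A $$ (i, j) = A $$ (j, i)" if "i < n" "j < n" for i j
    using sym A that by (metis carrier_matD index_transpose_mat(1))
  then have f: "f i j = f j i" for i j by (auto simp: f_def)
  have "x \<bullet> (A *\<^sub>v x) = (\<Sum>i<n. \<Sum>j<n. f i j)"
    using x A by (auto simp: scalar_prod_def lessThan_atLeast0 sum_distrib_left f_def mult.assoc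
        intro!: sum.cong)
  also have "\<dots> = 2 * (\<Sum>i<n. \<Sum>j<i. f i j)"
    using symmetric_double_sum[of f n, OF f] diag by (simp add: f_def)
  finally show ?thesis by simp
qed

text \<open>A moment of odd index is a value of the quadratic form of \<open>A\<close> at a Krylov
  vector. A moment of index \<open>2 * i\<close> is a sum of squares, congruent modulo 2 to the sum
  of the same entries, which is the moment of index \<open>i\<close>.\<close>

lemma even_moment: "m > 0 \<Longrightarrow> even (moment A m)"
proof (induction m rule: less_induct)
  case (less m)
  have e: "vec n (\<lambda>_. 1) \<in> carrier_vec n" by simp
  show ?case
  proof (cases "even m")
    case False
    then obtain i where i: "m = i + Suc i" by (metis add_Suc_right mult_2 oddE Suc_eq_plus1)
    have "moment A m = krylov A i \<bullet> (A *\<^sub>v krylov A i)"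
      unfolding i scalar_prod_krylov[OF A sym, symmetric] krylov_Suc[OF A] ..
    then show ?thesis using even_quadratic_form[OF krylov_carrier[OF A]] by simp
  next
    case True
    then obtain i where i: "m = i + i" by (metis evenE mult_2)
    have k: "krylov A i \<in> carrier_vec n" using A by simp
    have "moment A m - moment A i = (\<Sum>j<n. krylov A i $ j * (krylov A i $ j - 1))"
      unfolding i scalar_prod_krylov[OF A sym, symmetric] using k A
      by (simp add: moment_def scalar_prod_def lessThan_atLeast0 sum_subtractf algebra_simps)
    moreover have "even (\<Sum>j<n. krylov A i $ j * (krylov A i $ j - 1))"
      by (intro dvd_sum) simp
    moreover have "even (moment A i)" using less i by simp
    ultimately show ?thesis by (metis dvd_diff_commute dvd_diffD dvd_add_left_iff diff_add_cancel)
  qed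
qed

end

lemma prod_if_lessThan: "(\<Prod>j<k. if j < i then 1 else (2::int)) = 2 ^ (k - i)"
  by (induction k) (auto simp: Suc_diff_le not_less power_Suc[symmetric] simp del: power_Suc)

lemma sum_even_index:
  fixes f :: "nat \<Rightarrow> int"
  shows "(\<Sum>i<n. if even i then f (i div 2) else 0) = (\<Sum>j | 2 * j < n. f j)"
proof -
  have "(\<Sum>i<n. if even i then f (i div 2) else 0) = (\<Sum>i | i < n \<and> even i. f (i div 2))"
    by (subst sum.inter_filter[symmetric]) (auto intro!: sum.cong)
  also have "\<dots> = (\<Sum>j | 2 * j < n. f j)"
    by (rule sum.reindex_bij_witness[of _ "\<lambda>j. 2 * j" "\<lambda>i. i div 2"]) auto
  finally show ?thesis .
qed

context
  fixes A :: "int mat" and n :: nat and d :: int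
  assumes A: "A \<in> carrier_mat n n" and sym: "A\<^sup>T = A" and diag: "\<And>i. i < n \<Longrightarrow> A $$ (i, i) = 0"
    and det: "det (krylov_mat A) = 2 ^ (n div 2) * d" and d: "odd d"
begin

text \<open>Only the moment of index 0 is not covered by \<open>even_moment\<close>; it equals
  \<open>n\<close>, and the bound on \<open>j\<close> excludes it when \<open>n\<close> is
  odd.\<close>

lemma even_moment_add: "j \<ge> n mod 2 \<Longrightarrow> even (moment A (i + j))"
proof (cases "i + j = 0")
  case True
  assume "j \<ge> n mod 2"
  with True have "even n" by (auto simp: even_iff_mod_2_eq_zero)
  then show ?thesis using True A by (simp add: moment_def krylov_0[OF A] scalar_prod_def)
qed (use even_moment[OF A sym diag] in simp)

text \<open>The Gram matrix of the Krylov vectors has even columns, apart from the first one if \<open>n\<close> is odd.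
  The determinant condition says that halving these columns leaves an odd determinant.\<close>

lemma even_of_gram_mult:
  assumes c: "c \<in> carrier_vec n" "odd n \<Longrightarrow> c $ 0 = 0"
    and dvd: "dvd_vec 4 ((krylov_mat A)\<^sup>T *\<^sub>v (krylov_mat A *\<^sub>v c))"
  shows "dvd_vec 2 c"
proof -
  let ?W = "krylov_mat A"
  \<comment> \<open>\<open>\<delta> j\<close> is the factor taken out of column \<open>j\<close>.
    For odd \<open>n\<close>, column 0 contains the odd entry \<open>moment A 0\<close> and keeps
    the factor 1.\<close>
  define \<delta> :: "nat \<Rightarrow> int" where "\<delta> j = (if j < n mod 2 then 1 else 2)" for j
  define T where "T = mat n n (\<lambda>(i, j). moment A (i + j) div \<delta> j)"
  define D where "D = mat n n (\<lambda>(i, j). if i = j then \<delta> j else 0)"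
  have W: "?W \<in> carrier_mat n n" using A by simp
  have T: "T \<in> carrier_mat n n" and D: "D \<in> carrier_mat n n" by (simp_all add: T_def D_def)
  have \<delta>: "\<delta> j dvd moment A (i + j)" for i j
    using even_moment_add[of j i] by (auto simp: \<delta>_def)
  have gram: "?W\<^sup>T * ?W = T * D"
  proof (rule eq_matI)
    fix i j assume "i < dim_row (T * D)" "j < dim_col (T * D)"
    then have ij: "i < n" "j < n" using T D by auto
    have "(?W\<^sup>T * ?W) $$ (i, j) = moment A (i + j)"
      using ij A by (simp add: col_krylov_mat[OF A] scalar_prod_krylov[OF A sym])
    also have "\<dots> = (\<Sum>k<n. T $$ (i, k) * (if k = j then \<delta> j else 0))"
      using ij \<delta>[of j i] by (subst sum.remove[of _ j]) (auto simp: T_def intro!: sum.neutral)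
    also have "\<dots> = (T * D) $$ (i, j)"
      using ij by (auto simp: T_def D_def scalar_prod_def lessThan_atLeast0 intro!: sum.cong)
    finally show "(?W\<^sup>T * ?W) $$ (i, j) = (T * D) $$ (i, j)" .
  qed (use T D A in auto)
  have "upper_triangular D" by (auto simp: D_def)
  then have "det D = prod_list (diag_mat D)" by (rule det_upper_triangular[OF _ D])
  also have "diag_mat D = map \<delta> [0..<n]" by (auto simp: diag_mat_def D_def)
  also have "prod_list (map \<delta> [0..<n]) = (\<Prod>j<n. \<delta> j)"
    by (simp add: prod.distinct_set_conv_list[symmetric] lessThan_atLeast0)
  also have "\<dots> = 2 ^ (n - n mod 2)" unfolding \<delta>_def by (rule prod_if_lessThan)
  also have "n - n mod 2 = n div 2 + n div 2" by presburger
  finally have detD: "det D = 2 ^ (n div 2) * 2 ^ (n div 2)" by (simp add: power_add)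
  \<comment> \<open>\<open>D\<close> absorbs exactly the square of \<open>2 ^ (n div 2)\<close>,
    which leaves \<open>det T = d * d\<close>.\<close>
  have "det T * det D = det ?W * det ?W"
    using arg_cong[OF gram, of det] det_mult[OF T D] det_mult[of "?W\<^sup>T" n ?W] det_transpose[OF W] W by simp
  then have "det T = d * d" unfolding detD det by simp
  then have "odd (det T)" using d by simp
  then have cop: "coprime 2 (det T)" by simp
  \<comment> \<open>For odd \<open>n\<close> the factor at index 0 is 1 instead of 2, but there
    \<open>c\<close> vanishes.\<close>
  have Dc: "D *\<^sub>v c = 2 \<cdot>\<^sub>v c"
  proof (rule eq_vecI)
    fix i assume "i < dim_vec (2 \<cdot>\<^sub>v c)"
    then have i: "i < n" using c(1) by simp
    have "(D *\<^sub>v c) $ i = (\<Sum>k<n. D $$ (i, k) * c $ k)"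
      by (rule mult_mat_vec_index[OF D c(1) i])
    also have "\<dots> = (\<Sum>k<n. (if k = i then \<delta> i * c $ i else 0))"
      using i by (intro sum.cong) (auto simp: D_def)
    also have "\<dots> = \<delta> i * c $ i" using i by simp
    also have "\<dots> = 2 * c $ i"
      using c(2) by (cases "odd n") (auto simp: \<delta>_def odd_iff_mod_2_eq_one)
    finally show "(D *\<^sub>v c) $ i = (2 \<cdot>\<^sub>v c) $ i" using i c(1) by simp
  qed (use D c in auto)
  have "?W\<^sup>T *\<^sub>v (?W *\<^sub>v c) = T *\<^sub>v (D *\<^sub>v c)"
    using arg_cong[OF gram, of "\<lambda>M. M *\<^sub>v c"] W T D c(1)
    by (simp add: assoc_mult_mat_vec[of _ n n _ n])
  also have "\<dots> = 2 \<cdot>\<^sub>v (T *\<^sub>v c)" unfolding Dc using T c(1) by (intro eq_vecI) auto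
  finally have "dvd_vec 2 (T *\<^sub>v c)" using dvd zdvd_mult_cancel[of 2 2] unfolding dvd_vec_def by auto
  then show ?thesis using dvd_vec_mat_cancel[OF T c(1) cop] by simp
qed

text \<open>The quadratic conditions become linear. Modulo 4, \<open>w\<close> may be replaced by
  \<open>krylov_mat A *\<^sub>v y\<close>, the mixed terms vanish, and in the diagonal terms
  \<open>y $ i\<close> may replace its square. What remains says that \<open>y\<close>, spread over
  the even indices, is in the kernel of the Gram matrix modulo 4. The bounds on the support of
  \<open>y\<close> make the moments even and \<open>2 * j\<close> a valid index.\<close>

lemma even_krylov_coefficients:
  assumes y: "y \<in> carrier_vec n" "\<And>j. j < n \<Longrightarrow> \<not> (n mod 2 \<le> j \<and> 2 * j < n) \<Longrightarrow> y $ j = 0"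
    and w: "w \<in> carrier_vec n" "\<And>k. 4 dvd w \<bullet> (A ^\<^sub>m k *\<^sub>v w)"
    and wy: "dvd_vec 2 (w - krylov_mat A *\<^sub>v y)"
  shows "dvd_vec 2 y"
proof -
  let ?W = "krylov_mat A"
  have W: "?W \<in> carrier_mat n n" using A by simp
  define x where "x = ?W *\<^sub>v y"
  have x: "x \<in> carrier_vec n" using W y by (simp add: x_def)
  obtain b where b: "b \<in> carrier_vec n" "w - x = 2 \<cdot>\<^sub>v b"
    using dvd_vecE[OF wy, of n] w x unfolding x_def by (metis minus_carrier_vec)
  have wx: "w = x + 2 \<cdot>\<^sub>v b"
    unfolding b(2)[symmetric] using x w(1) by (intro eq_vecI) auto
  have even_y: "even (y $ i * moment A (i + j))" if "i < n" for i j
    using y(2)[OF that] even_moment_add[of i j] by (cases "n mod 2 \<le> i") (auto simp: add.commute)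
  have 4: "4 dvd (\<Sum>i<n. y $ i * moment A (2 * i + k))" for k
  proof -
    let ?P = "A ^\<^sub>m k"
    have P: "?P \<in> carrier_mat n n" by (rule pow_carrier_mat[OF A])
    have Pw: "?P *\<^sub>v w = ?P *\<^sub>v x + 2 \<cdot>\<^sub>v (?P *\<^sub>v b)"
      unfolding wx mult_add_distrib_mat_vec[OF P x smult_carrier_vec[THEN iffD2, OF b(1)]]
      using P b by (intro arg_cong2[where f = "(+)"] eq_vecI) auto
    have Px: "?P *\<^sub>v x \<in> carrier_vec n" and Pb: "?P *\<^sub>v b \<in> carrier_vec n" using P x b by auto
    \<comment> \<open>In \<open>w = x + 2 b\<close> the two cross terms are equal by the symmetry of
      \<open>A\<close>, so together they contribute a multiple of 4.\<close>
    have "w \<bullet> (?P *\<^sub>v w) = x \<bullet> (?P *\<^sub>v x) + 2 * (x \<bullet> (?P *\<^sub>v b)) + (2 * (b \<bullet> (?P *\<^sub>v x)) + 4 * (b \<bullet> (?P *\<^sub>v b)))"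
      unfolding Pw unfolding wx using x b(1) Px Pb
      by (simp add: scalar_prod_add_distrib[of _ n] add_scalar_prod_distrib[of _ n])
    also have "b \<bullet> (?P *\<^sub>v x) = x \<bullet> (?P *\<^sub>v b)"
      using scalar_prod_symmetric_pow[OF A sym b(1) x] comm_scalar_prod[OF Pb x] by simp
    finally have "x \<bullet> (?P *\<^sub>v x) = w \<bullet> (?P *\<^sub>v w) - 4 * (x \<bullet> (?P *\<^sub>v b) + b \<bullet> (?P *\<^sub>v b))" by simp
    then have "4 dvd x \<bullet> (?P *\<^sub>v x)" using w(2)[of k] by simp
    also have "x \<bullet> (?P *\<^sub>v x) = (\<Sum>i<n. \<Sum>j<n. y $ i * y $ j * moment A (i + j + k))"
    proof -
      have "x \<bullet> (?P *\<^sub>v x) = (?P *\<^sub>v x) \<bullet> x" using comm_scalar_prod[OF x Px] .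
      also have "\<dots> = (\<Sum>i<n. y $ i * ((?P *\<^sub>v x) \<bullet> krylov A i))"
        using scalar_prod_krylov_mat[OF A Px y(1)] unfolding x_def .
      also have "\<dots> = (\<Sum>i<n. y $ i * (\<Sum>j<n. y $ j * moment A (i + j + k)))"
      proof (intro sum.cong arg_cong2[where f = "(*)"] refl)
        fix i
        have "(?P *\<^sub>v x) \<bullet> krylov A i = x \<bullet> krylov A (k + i)"
          using scalar_prod_symmetric_pow[OF A sym x krylov_carrier[OF A]]
          by (simp add: pow_mult_krylov[OF A])
        also have "\<dots> = krylov A (k + i) \<bullet> x" using A x by (intro comm_scalar_prod[of _ n]) auto
        also have "\<dots> = (\<Sum>j<n. y $ j * moment A (i + j + k))"
          using scalar_prod_krylov_mat[OF A krylov_carrier[OF A] y(1)] unfolding x_def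
          by (simp add: scalar_prod_krylov[OF A sym] add.commute add.left_commute)
        finally show "(?P *\<^sub>v x) \<bullet> krylov A i = (\<Sum>j<n. y $ j * moment A (i + j + k))" .
      qed
      finally show ?thesis by (simp add: sum_distrib_left mult.assoc)
    qed
    also have "\<dots> = (\<Sum>i<n. y $ i * y $ i * moment A (i + i + k)) +
        2 * (\<Sum>i<n. \<Sum>j<i. y $ i * y $ j * moment A (i + j + k))"
      by (rule symmetric_double_sum) (simp add: add.commute mult.commute)
    also have "(4 dvd \<dots>) \<longleftrightarrow> 4 dvd (\<Sum>i<n. y $ i * y $ i * moment A (i + i + k))"
    proof (rule dvd_add_left_iff)
      have "even (\<Sum>i<n. \<Sum>j<i. y $ i * y $ j * moment A (i + j + k))"
        using even_y by (intro dvd_sum) (auto simp: add.assoc)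
      then show "4 dvd 2 * (\<Sum>i<n. \<Sum>j<i. y $ i * y $ j * moment A (i + j + k))" by presburger
    qed
    finally have "4 dvd (\<Sum>i<n. y $ i * y $ i * moment A (i + i + k))" .
    \<comment> \<open>This replaces \<open>y $ i * y $ i\<close> by \<open>y $ i\<close>: if
      \<open>y $ i\<close> is nonzero, both the moment and \<open>(y $ i - 1) * y $ i\<close> are
      even.\<close>
    moreover have "4 dvd (\<Sum>i<n. (y $ i - 1) * (y $ i * moment A (i + i + k)))"
    proof (rule dvd_sum)
      fix i assume "i \<in> {..<n}"
      show "4 dvd (y $ i - 1) * (y $ i * moment A (i + i + k))"
      proof (cases "even (y $ i)")
        case True
        then have "even (y $ i * moment A (i + i + k))" by simp
        moreover have "4 dvd y $ i * moment A (i + i + k)"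
        proof (cases "y $ i = 0")
          case False
          then have "even (moment A (i + i + k))"
            using y(2)[of i] \<open>i \<in> {..<n}\<close> even_moment_add[of i "i + k"]
            by (metis add.assoc add.commute lessThan_iff)
          then show ?thesis using True mult_dvd_mono[of 2 "y $ i" 2] by simp
        qed simp
        ultimately show ?thesis by simp
      next
        case False
        then have "even (y $ i - 1)" by simp
        moreover have "even (y $ i * moment A (i + i + k))" using even_y[of i "i + k"] \<open>i \<in> {..<n}\<close> by (simp add: add.assoc)
        ultimately have "2 * 2 dvd (y $ i - 1) * (y $ i * moment A (i + i + k))" by (rule mult_dvd_mono)
        then show ?thesis by simp
      qed
    qed
    ultimately have "4 dvd (\<Sum>i<n. y $ i * y $ i * moment A (i + i + k)) -
        (\<Sum>i<n. (y $ i - 1) * (y $ i * moment A (i + i + k)))" by (rule dvd_diff)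
    also have "\<dots> = (\<Sum>i<n. y $ i * moment A (2 * i + k))"
      unfolding sum_subtractf[symmetric] by (intro sum.cong) (auto simp: left_diff_distrib mult_2 add.assoc mult.assoc)
    finally show ?thesis .
  qed
  \<comment> \<open>Column \<open>2 * j\<close> of the Krylov matrix receives the coefficient
    \<open>y $ j\<close>, so that the coordinates of the Gram product are the sums just
    treated.\<close>
  define c where "c = vec n (\<lambda>i. if even i then y $ (i div 2) else 0)"
  have c: "c \<in> carrier_vec n" by (simp add: c_def)
  have "dvd_vec 4 (?W\<^sup>T *\<^sub>v (?W *\<^sub>v c))"
    unfolding dvd_vec_def
  proof (intro allI impI)
    fix k assume "k < dim_vec (?W\<^sup>T *\<^sub>v (?W *\<^sub>v c))"
    then have k: "k < n" using A by simp
    have "(?W\<^sup>T *\<^sub>v (?W *\<^sub>v c)) $ k = krylov A k \<bullet> (?W *\<^sub>v c)"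
      using transpose_krylov_mat_index[OF A _ k] W c by simp
    also have "\<dots> = (\<Sum>i<n. if even i then y $ (i div 2) * moment A (2 * (i div 2) + k) else 0)"
      unfolding scalar_prod_krylov_mat[OF A krylov_carrier[OF A] c]
      by (intro sum.cong) (auto simp: c_def scalar_prod_krylov[OF A sym] add.commute)
    also have "\<dots> = (\<Sum>j | 2 * j < n. y $ j * moment A (2 * j + k))" by (rule sum_even_index)
    also have "\<dots> = (\<Sum>j<n. y $ j * moment A (2 * j + k))"
      using y(2) by (intro sum.mono_neutral_left) auto
    finally show "4 dvd (?W\<^sup>T *\<^sub>v (?W *\<^sub>v c)) $ k" using 4 by simp
  qed
  moreover have "c $ 0 = 0" if "odd n"
    using y(2)[of 0] that odd_pos[OF that] by (simp add: c_def odd_iff_mod_2_eq_one)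
  ultimately have c2: "dvd_vec 2 c" using even_of_gram_mult[OF c] by simp
  show ?thesis
    unfolding dvd_vec_def
  proof (intro allI impI)
    fix j assume "j < dim_vec y"
    then have j: "j < n" using y by simp
    show "2 dvd y $ j"
    proof (cases "2 * j < n")
      case True
      then have "2 dvd c $ (2 * j)" using c2 c unfolding dvd_vec_def by simp
      then show ?thesis using True by (simp add: c_def)
    qed (use y(2) j in auto)
  qed
qed

text \<open>Modulo 2 the Krylov vectors with these indices span an isotropic space, of dimension
  \<open>n div 2\<close>. By counting dimensions it is all of the kernel of the transposed Krylov matrix.\<close>

lemma krylov_cols_mod_2:
  assumes n: "n > 1" and u: "u \<in> carrier_vec n" "dvd_vec 2 ((krylov_mat A)\<^sup>T *\<^sub>v u)"
  shows "\<exists>y\<in>carrier_vec n. (\<forall>j<n. \<not> (n mod 2 \<le> j \<and> 2 * j < n) \<longrightarrow> y $ j = 0) \<and>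
    dvd_vec 2 (u - krylov_mat A *\<^sub>v y)"
proof (rule ccontr)
  let ?W = "krylov_mat A"
  have W: "?W \<in> carrier_mat n n" using A by simp
  \<comment> \<open>\<open>S\<close> indexes the isotropic Krylov vectors. \<open>J\<close> adds the
    index 0 if \<open>n\<close> is odd, and the last index, whose column will carry
    \<open>u\<close>.\<close>
  define S where "S = {j. n mod 2 \<le> j \<and> 2 * j < n}"
  define J where "J = insert (n - 1) {j. 2 * j < n}"
  assume "\<not> (\<exists>y\<in>carrier_vec n. (\<forall>j<n. \<not> (n mod 2 \<le> j \<and> 2 * j < n) \<longrightarrow> y $ j = 0) \<and>
    dvd_vec 2 (u - ?W *\<^sub>v y))"
  then have not_span: "\<not> dvd_vec 2 (u - ?W *\<^sub>v y)"
    if "y \<in> carrier_vec n" "\<And>j. j < n \<Longrightarrow> j \<notin> S \<Longrightarrow> y $ j = 0" for y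
    using that unfolding S_def by blast
  \<comment> \<open>Independence of the isotropic vectors modulo 2 is the preceding lemma for
    \<open>w = 0\<close>.\<close>
  have indep: "dvd_vec 2 y" if y: "y \<in> carrier_vec n" "\<And>j. j < n \<Longrightarrow> j \<notin> S \<Longrightarrow> y $ j = 0"
    and dvd: "dvd_vec 2 (?W *\<^sub>v y)" for y
  proof (rule even_krylov_coefficients[OF y(1), of "0\<^sub>v n"])
    show "dvd_vec 2 (0\<^sub>v n - ?W *\<^sub>v y)" using dvd W y(1) by (intro dvd_vec_diff) auto
    show "4 dvd 0\<^sub>v n \<bullet> (A ^\<^sub>m k *\<^sub>v 0\<^sub>v n)" for k
      using pow_mult_vec_carrier[OF A, of "0\<^sub>v n" k] by simp
  qed (use y in \<open>auto simp: S_def\<close>)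
  have u_krylov: "even (krylov A j \<bullet> u)" if "j < n" for j
  proof -
    have "even (((krylov_mat A)\<^sup>T *\<^sub>v u) $ j)"
      using u(2) that W unfolding dvd_vec_def by (simp del: index_mult_mat_vec)
    then show ?thesis unfolding transpose_krylov_mat_index[OF A u(1) that] .
  qed
  define M where "M = mat n n (\<lambda>(i, j). if j = n - 1 then u $ i else krylov A j $ i)"
  have M: "M \<in> carrier_mat n n" by (simp add: M_def)
  have J: "J \<subseteq> {..<n}" "finite {j. 2 * j < n}" and nJ: "n - 1 \<notin> {j. 2 * j < n}"
    using n by (auto simp: J_def intro: finite_subset[of _ "{..<n}"])
  \<comment> \<open>As \<open>u\<close> is assumed to be outside their span, it is an independent
    addition to the isotropic vectors, together with the all-ones vector if \<open>n\<close> is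
    odd.\<close>
  have "cols_independent_mod 2 M J"
    unfolding cols_independent_mod_def
  proof (intro allI impI)
    fix c :: "nat \<Rightarrow> int" assume c: "\<forall>i<dim_row M. int 2 dvd (\<Sum>j\<in>J. c j * M $$ (i, j))"
    have cM: "even (c (n - 1) * u $ i + (\<Sum>j | 2 * j < n. c j * krylov A j $ i))" if "i < n" for i
    proof -
      have "(\<Sum>j | 2 * j < n. c j * M $$ (i, j)) = (\<Sum>j | 2 * j < n. c j * krylov A j $ i)"
        using that nJ by (intro sum.cong) (auto simp: M_def)
      then have "(\<Sum>j\<in>J. c j * M $$ (i, j)) =
          c (n - 1) * u $ i + (\<Sum>j | 2 * j < n. c j * krylov A j $ i)"
        unfolding J_def sum.insert[OF J(2) nJ] using that n by (simp add: M_def)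
      moreover have "even (\<Sum>j\<in>J. c j * M $$ (i, j))" using c that M by simp
      ultimately show ?thesis by (simp only:)
    qed
    \<comment> \<open>Pairing the relation with the all-ones vector kills modulo 2 all terms except
      that of index 0, whose moment is the odd number \<open>n\<close>.\<close>
    have c0: "even (c 0)" if odd: "odd n"
    proof -
      have S0: "{j. 2 * j < n} = insert 0 (S)" using odd n by (auto simp: S_def odd_iff_mod_2_eq_one)
      have "even (\<Sum>i<n. c (n - 1) * u $ i + (\<Sum>j | 2 * j < n. c j * krylov A j $ i))"
        using cM by (intro dvd_sum) auto
      also have "(\<Sum>i<n. c (n - 1) * u $ i + (\<Sum>j | 2 * j < n. c j * krylov A j $ i)) =
          c (n - 1) * (krylov A 0 \<bullet> u) + (\<Sum>j | 2 * j < n. c j * moment A j)"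
        unfolding sum.distrib
        by (subst sum.swap) (use u(1) A in \<open>simp add: sum_distrib_left[symmetric] krylov_0[OF A]
            scalar_prod_def lessThan_atLeast0 moment_def\<close>)
      finally have "even (\<Sum>j | 2 * j < n. c j * moment A j)"
        using u_krylov[of 0] n by (simp add: dvd_add_right_iff)
      moreover have "(\<Sum>j | 2 * j < n. c j * moment A j) = c 0 * moment A 0 + (\<Sum>j\<in>S. c j * moment A j)"
        unfolding S0 using odd J(2)[unfolded S0] by (subst sum.insert) (auto simp: S_def odd_iff_mod_2_eq_one)
      moreover have "even (\<Sum>j\<in>S. c j * moment A j)"
        using even_moment_add[of _ 0] by (intro dvd_sum) (auto simp: S_def)
      ultimately have "even (c 0 * moment A 0)" by (simp add: dvd_add_left_iff)
      moreover have "moment A 0 = int n"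
        using A by (simp add: moment_def krylov_0[OF A] scalar_prod_def)
      ultimately show ?thesis using odd by simp
    qed
    define y where "y = vec n (\<lambda>j. if j \<in> S then c j else 0)"
    have y: "y \<in> carrier_vec n" "\<And>j. j < n \<Longrightarrow> j \<notin> S \<Longrightarrow> y $ j = 0" by (simp_all add: y_def)
    have Wy: "even (c (n - 1) * u $ i + (?W *\<^sub>v y) $ i)" if i: "i < n" for i
    proof -
      have "(?W *\<^sub>v y) $ i = (\<Sum>j<n. krylov A j $ i * y $ j)"
        using mult_mat_vec_index[OF W y(1) i] i by (simp add: krylov_mat_index[OF A])
      also have "\<dots> = (\<Sum>j | 2 * j < n. (if j \<in> S then c j else 0) * krylov A j $ i)"
        by (rule sum.mono_neutral_cong_right) (auto simp: y_def S_def)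
      finally have "(\<Sum>j | 2 * j < n. c j * krylov A j $ i) - (?W *\<^sub>v y) $ i =
          (\<Sum>j | 2 * j < n. (c j - (if j \<in> S then c j else 0)) * krylov A j $ i)"
        by (simp add: sum_subtractf left_diff_distrib)
      also have "even \<dots>"
      proof (rule dvd_sum)
        fix j assume "j \<in> {j. 2 * j < n}"
        then have "j \<in> S \<or> j = 0 \<and> odd n"
          by (auto simp: S_def; presburger)
        then show "even ((c j - (if j \<in> S then c j else 0)) * krylov A j $ i)" using c0 by auto
      qed
      finally show ?thesis using cM[OF i] by (simp add: even_diff_iff)
    qed
    have cn: "even (c (n - 1))"
    proof (rule ccontr)
      assume odd: "odd (c (n - 1))"
      have "dvd_vec 2 (u - ?W *\<^sub>v y)"
        unfolding dvd_vec_def using Wy odd u(1) W y(1) by (simp del: index_mult_mat_vec)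
      then show False using not_span[OF y] by blast
    qed
    then have "dvd_vec 2 (?W *\<^sub>v y)"
      unfolding dvd_vec_def using Wy W by (simp del: index_mult_mat_vec)
    from indep[OF y this] have "dvd_vec 2 y" by blast
    then have cS: "even (c j)" if j: "j \<in> S" for j
    proof -
      have "j < n" using j by (auto simp: S_def)
      then have "even (y $ j)" using \<open>dvd_vec 2 y\<close> y(1) unfolding dvd_vec_def by simp
      then show ?thesis using \<open>j < n\<close> j by (simp add: y_def)
    qed
    show "\<forall>j\<in>J. int 2 dvd c j"
    proof
      fix j assume "j \<in> J"
      then have "j = n - 1 \<or> j \<in> S \<or> j = 0 \<and> odd n"
        unfolding J_def S_def by (auto; presburger)
      then show "int 2 dvd c j" using cn cS c0 by auto
    qed
  qed
  then obtain N where N: "N \<in> carrier_mat n n" "\<And>i j. i < n \<Longrightarrow> j \<in> J \<Longrightarrow> N $$ (i, j) = M $$ (i, j)"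
    "odd (det N)"
    using extend_cols_independent_mod[OF two_is_prime_nat M J(1)] by auto
  have finS: "finite S" using J(2) by (rule rev_finite_subset) (auto simp: S_def)
  have "card {j. 2 * j < n} = (n + 1) div 2"
  proof -
    have "{j. 2 * j < n} = {..<(n + 1) div 2}" by auto
    then show ?thesis by simp
  qed
  then have cardJ: "card J = (n + 1) div 2 + 1" unfolding J_def using J(2) nJ by simp
  have "S = {n mod 2..<(n + 1) div 2}" by (auto simp: S_def)
  then have cardS: "card S = (n + 1) div 2 - n mod 2" by simp
  have "card ({..<n} - J) = n - card J" using J(1) by (simp add: card_Diff_subset finite_subset)
  moreover have "n = 2 * (n div 2) + n mod 2" "(n + 1) div 2 = n div 2 + n mod 2" by presburger+
  ultimately have "card ({..<n} - J) < card S" using cardJ cardS n by linarith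
  \<comment> \<open>\<open>S\<close> has \<open>n div 2\<close> elements, and only
    \<open>n div 2 - 1\<close> columns of \<open>N\<close> lie outside \<open>J\<close>. So a
    nontrivial combination of the isotropic vectors is orthogonal to these columns modulo 2; it is
    orthogonal to those in \<open>J\<close> anyway, and \<open>N\<close> is invertible.\<close>
  from cols_dependent_mod_of_fewer_rows[OF _ finS this, of 2 "\<lambda>i j. col N i \<bullet> krylov A j"]
  obtain c where c: "\<exists>j\<in>S. odd (c j)" "\<And>i. i < n \<Longrightarrow> i \<notin> J \<Longrightarrow> even (\<Sum>j\<in>S. c j * (col N i \<bullet> krylov A j))"
    by auto
  define y where "y = vec n (\<lambda>j. if j \<in> S then c j else 0)"
  have y: "y \<in> carrier_vec n" "\<And>j. j < n \<Longrightarrow> j \<notin> S \<Longrightarrow> y $ j = 0" by (simp_all add: y_def)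
  have xWy: "x \<bullet> (?W *\<^sub>v y) = (\<Sum>j\<in>S. c j * (x \<bullet> krylov A j))" if "x \<in> carrier_vec n" for x
    unfolding scalar_prod_krylov_mat[OF A that y(1)]
    by (rule sum.mono_neutral_cong_right) (auto simp: y_def S_def)
  have Wy: "?W *\<^sub>v y \<in> carrier_vec n" using W y by simp
  have "dvd_vec 2 (N\<^sup>T *\<^sub>v (?W *\<^sub>v y))"
    unfolding dvd_vec_def
  proof (intro allI impI)
    fix i assume "i < dim_vec (N\<^sup>T *\<^sub>v (?W *\<^sub>v y))"
    then have i: "i < n" using N(1) by simp
    have colN: "col N i \<in> carrier_vec n" using N(1) by auto
    have "(N\<^sup>T *\<^sub>v (?W *\<^sub>v y)) $ i = (\<Sum>j\<in>S. c j * (col N i \<bullet> krylov A j))"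
      unfolding xWy[OF colN, symmetric] using i N(1) by simp
    also have "even \<dots>"
    proof (cases "i \<in> J")
      case True
      have "even (col N i \<bullet> krylov A j)" if j: "j \<in> S" for j
      proof (cases "i = n - 1")
        case i1: True
        have "col N i = u" using N(1) N(2)[OF _ True] i i1 u(1) by (intro eq_vecI) (auto simp: M_def)
        then have "col N i \<bullet> krylov A j = krylov A j \<bullet> u"
          using comm_scalar_prod[OF u(1) krylov_carrier[OF A]] by simp
        then show ?thesis using u_krylov[of j] j by (simp add: S_def)
      next
        case False
        then have "col N i = krylov A i"
          using N(1) N(2)[OF _ True] i A by (intro eq_vecI) (auto simp: M_def)
        then show ?thesis using even_moment_add[of j i] j by (simp add: S_def scalar_prod_krylov[OF A sym])
      qed
      then show ?thesis by (intro dvd_sum) simp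
    qed (use c(2) i in blast)
    finally show "2 dvd (N\<^sup>T *\<^sub>v (?W *\<^sub>v y)) $ i" .
  qed
  moreover have "coprime 2 (det N\<^sup>T)" using N(3) det_transpose[OF N(1)] by simp
  moreover have "N\<^sup>T \<in> carrier_mat n n" using N(1) by simp
  ultimately have "dvd_vec 2 (?W *\<^sub>v y)" using dvd_vec_mat_cancel[OF _ Wy, of "N\<^sup>T" 2] by blast
  from indep[OF y this] have "dvd_vec 2 y" by blast
  obtain j where j: "j \<in> S" "odd (c j)" using c(1) by blast
  then have "j < n" by (auto simp: S_def)
  then have "even (y $ j)" using \<open>dvd_vec 2 y\<close> y(1) unfolding dvd_vec_def by simp
  then show False using \<open>j < n\<close> j by (simp add: y_def)
qed

text \<open>This excludes even levels, where the columns of \<open>U\<close> satisfy both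
  conditions. Modulo 2 a kernel vector is a combination of isotropic Krylov vectors, and the
  quadratic condition makes its coefficients even.\<close>

lemma even_of_even_quadratic_values:
  assumes n: "n > 0" and u: "u \<in> carrier_vec n" "dvd_vec 2 ((krylov_mat A)\<^sup>T *\<^sub>v u)"
    and q: "\<And>k. 4 dvd u \<bullet> (A ^\<^sub>m k *\<^sub>v u)"
  shows "dvd_vec 2 u"
proof (cases "n = 1")
  case True
  \<comment> \<open>For \<open>n = 1\<close> the determinant is odd, so the kernel modulo 2 is
    trivial.\<close>
  then have "coprime 2 (det (krylov_mat A)\<^sup>T)" using det d det_transpose[OF krylov_mat_carrier[OF A]] by simp
  then show ?thesis using dvd_vec_mat_cancel[OF _ u(1) _ u(2)] A by simp
next
  case False
  with n have "n > 1" by simp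
  then obtain y where y: "y \<in> carrier_vec n" "\<And>j. j < n \<Longrightarrow> \<not> (n mod 2 \<le> j \<and> 2 * j < n) \<Longrightarrow> y $ j = 0"
    and uy: "dvd_vec 2 (u - krylov_mat A *\<^sub>v y)"
    using krylov_cols_mod_2[OF _ u] by blast
  have Wy: "krylov_mat A *\<^sub>v y \<in> carrier_vec n"
    by (rule mult_mat_vec_carrier[OF krylov_mat_carrier[OF A] y(1)])
  have "dvd_vec 2 y" by (rule even_krylov_coefficients[OF y u(1) q uy])
  then have "dvd_vec 2 (krylov_mat A *\<^sub>v y)" using A y(1) by (intro dvd_vec_mult_mat) auto
  with uy have "dvd_vec 2 ((u - krylov_mat A *\<^sub>v y) + krylov_mat A *\<^sub>v y)"
    using Wy u(1) by (intro dvd_vec_add) auto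
  also have "(u - krylov_mat A *\<^sub>v y) + krylov_mat A *\<^sub>v y = u"
    by (rule vec_diff_add_cancel[OF u(1) Wy])
  finally show ?thesis .
qed

end

section \<open>Moments and characteristic polynomials\<close>

text \<open>The matrix determinant lemma for the all-ones matrix \<open>E * F\<close>. Column
  operations make the bordered matrix \<open>?B\<close> block triangular in two ways:
  \<open>?S\<close> shows that its determinant is the left-hand side, and \<open>?T\<close> yields
  the right-hand side up to the factor \<open>det M\<close>, which is cancelled.\<close>

lemma det_add_ones:
  fixes M :: "'a::idom mat"
  assumes M: "M \<in> carrier_mat n n" and "det M \<noteq> 0"
  shows "det (M + mat n n (\<lambda>_. 1)) = det M + (\<Sum>i<n. \<Sum>j<n. adj_mat M $$ (i, j))"
proof -
  define E :: "'a mat" where "E = mat n 1 (\<lambda>_. 1)"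
  define F :: "'a mat" where "F = mat 1 n (\<lambda>_. 1)"
  have E: "E \<in> carrier_mat n 1" and F: "F \<in> carrier_mat 1 n" by (simp_all add: E_def F_def)
  note R = adj_mat[OF M]
  let ?B = "four_block_mat M (- E) F (1\<^sub>m 1)"
  let ?S = "four_block_mat (1\<^sub>m n) (0\<^sub>m n 1) (- F) (1\<^sub>m 1)"
  let ?T = "four_block_mat (1\<^sub>m n) (adj_mat M * E) (0\<^sub>m 1 n) (det M \<cdot>\<^sub>m 1\<^sub>m 1)"
  have B: "?B \<in> carrier_mat (n + 1) (n + 1)" and S: "?S \<in> carrier_mat (n + 1) (n + 1)"
    and T: "?T \<in> carrier_mat (n + 1) (n + 1)" using M E F R by auto
  have EF: "E * F = mat n n (\<lambda>_. 1)" by (rule eq_matI) (auto simp: E_def F_def scalar_prod_def)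
  have "?B * ?S = four_block_mat (M * 1\<^sub>m n + (- E) * (- F)) (M * 0\<^sub>m n 1 + (- E) * 1\<^sub>m 1)
      (F * 1\<^sub>m n + 1\<^sub>m 1 * (- F)) (F * 0\<^sub>m n 1 + 1\<^sub>m 1 * 1\<^sub>m 1)"
    by (rule mult_four_block_mat) (use M E F in auto)
  also have "(- E) * (- F) = E * F" using E F by simp
  also have "F * 1\<^sub>m n + 1\<^sub>m 1 * (- F) = 0\<^sub>m 1 n" using F by auto
  finally have BS: "?B * ?S = four_block_mat (M + mat n n (\<lambda>_. 1)) (- E) (0\<^sub>m 1 n) (1\<^sub>m 1)"
    using M E F by (simp add: EF)
  have "det ?S = 1"
    using F by (subst det_four_block_mat_upper_right_zero[of _ n _ 1]) auto
  moreover have "det (?B * ?S) = det (M + mat n n (\<lambda>_. 1))"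
    unfolding BS using M E by (subst det_four_block_mat_lower_left_zero[of _ n _ 1]) auto
  ultimately have detB: "det ?B = det (M + mat n n (\<lambda>_. 1))" using det_mult[OF B S] by simp
  have RE: "adj_mat M * E \<in> carrier_mat n 1" using R E by simp
  have "?B * ?T = four_block_mat (M * 1\<^sub>m n + (- E) * 0\<^sub>m 1 n) (M * (adj_mat M * E) + (- E) * (det M \<cdot>\<^sub>m 1\<^sub>m 1))
      (F * 1\<^sub>m n + 1\<^sub>m 1 * 0\<^sub>m 1 n) (F * (adj_mat M * E) + 1\<^sub>m 1 * (det M \<cdot>\<^sub>m 1\<^sub>m 1))"
    by (rule mult_four_block_mat) (use M E F R RE in auto)
  also have "M * (adj_mat M * E) = det M \<cdot>\<^sub>m E"
    using M E R mult_smult_assoc_mat[OF one_carrier_mat E, of "det M"]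
    by (simp add: assoc_mult_mat[of _ n n _ n _ 1, symmetric])
  also have "(- E) * (det M \<cdot>\<^sub>m 1\<^sub>m 1) = - (det M \<cdot>\<^sub>m E)"
    using E by (intro eq_matI) (auto simp: scalar_prod_def)
  also have "det M \<cdot>\<^sub>m E + - (det M \<cdot>\<^sub>m E) = 0\<^sub>m n 1" using E by auto
  finally have BT: "?B * ?T = four_block_mat M (0\<^sub>m n 1) F (F * (adj_mat M * E) + det M \<cdot>\<^sub>m 1\<^sub>m 1)"
    using M E F by simp
  have "det ?T = det M"
    using RE by (subst det_four_block_mat_lower_left_zero[of _ n _ 1]) (auto simp: det_single)
  moreover have "det (?B * ?T) = det M * det (F * (adj_mat M * E) + det M \<cdot>\<^sub>m 1\<^sub>m 1)"
    unfolding BT using M F RE by (subst det_four_block_mat_upper_right_zero[of _ n _ 1]) auto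
  ultimately have "det ?B * det M = det (F * (adj_mat M * E) + det M \<cdot>\<^sub>m 1\<^sub>m 1) * det M"
    using det_mult[OF B T] by (metis mult.commute)
  then have "det ?B = det (F * (adj_mat M * E) + det M \<cdot>\<^sub>m 1\<^sub>m 1)" using assms(2) by simp
  also have "\<dots> = (F * (adj_mat M * E)) $$ (0, 0) + det M"
    using F RE by (subst det_single) auto
  also have "(F * (adj_mat M * E)) $$ (0, 0) = (\<Sum>i<n. \<Sum>j<n. adj_mat M $$ (i, j))"
    using F R(1) RE by (simp add: F_def E_def scalar_prod_def lessThan_atLeast0)
  finally show ?thesis unfolding detB by simp
qed

text \<open>This is the characteristic polynomial times
  \<open>e\<^sup>T (x - A)\<^sup>-\<^sup>1 e\<close>, whose expansion in \<open>1 / x\<close> has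
  the moments as coefficients.\<close>

definition resolvent_poly :: "int mat \<Rightarrow> int poly" where
  "resolvent_poly A = (\<Sum>i<dim_row A. \<Sum>j<dim_row A. adj_mat (char_poly_matrix A) $$ (i, j))"

text \<open>At \<open>-1 - x\<close> the characteristic matrix of \<open>B\<close> is minus the sum
  of that of \<open>A\<close> and the all-ones matrix, so \<open>det_add_ones\<close> applies. Given
  the spectrum of a graph, that of its complement therefore fixes
  \<open>resolvent_poly\<close>.\<close>

lemma char_poly_complement:
  fixes A :: "int mat"
  assumes A: "A \<in> carrier_mat n n"
  defines "B \<equiv> mat n n (\<lambda>(i, j). (if i = j then 0 else 1) - A $$ (i, j))"
  shows "char_poly B \<circ>\<^sub>p [:-1, -1:] = (-1) ^ n * (char_poly A + resolvent_poly A)"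
proof -
  let ?Y = "char_poly_matrix A"
  have Y: "?Y \<in> carrier_mat n n" using A by simp
  have B: "B \<in> carrier_mat n n" by (simp add: B_def)
  have "det ?Y \<noteq> 0" using degree_monic_char_poly[OF A] unfolding char_poly_def by auto
  have "char_poly B \<circ>\<^sub>p [:-1, -1:] = det (map_mat (\<lambda>q. q \<circ>\<^sub>p [:-1, -1:]) (char_poly_matrix B))"
    unfolding char_poly_def by (rule comm_ring_hom.hom_det[OF pcompose_hom.comm_ring_hom_axioms, symmetric])
  also have "map_mat (\<lambda>q. q \<circ>\<^sub>p [:-1, -1:]) (char_poly_matrix B) = (-1) \<cdot>\<^sub>m (?Y + mat n n (\<lambda>_. 1))"
    using A B by (intro eq_matI) (auto simp: char_poly_matrix_def B_def pcompose_pCons one_pCons)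
  also have "det \<dots> = (-1) ^ n * det (?Y + mat n n (\<lambda>_. 1))" using Y by simp
  also have "det (?Y + mat n n (\<lambda>_. 1)) = char_poly A + resolvent_poly A"
    unfolding det_add_ones[OF Y \<open>det ?Y \<noteq> 0\<close>] resolvent_poly_def char_poly_def using A by simp
  finally show ?thesis .
qed

section \<open>Krylov expansion of the adjugate\<close>

context
  fixes A :: "int mat" and n :: nat
  assumes A: "A \<in> carrier_mat n n" and n: "n > 0"
begin

definition adj_row_coeff :: "nat \<Rightarrow> int vec" where
  "adj_row_coeff k = vec n (\<lambda>i. poly.coeff (\<Sum>j<n. adj_mat (char_poly_matrix A) $$ (i, j)) k)"

lemma adj_row_coeff_carrier [simp]: "adj_row_coeff k \<in> carrier_vec n"
  by (simp add: adj_row_coeff_def)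

text \<open>Comparison of coefficients in \<open>(x - A) adj(x - A) e = char_poly A e\<close>, where
  \<open>adj_row_coeff k\<close> is the coefficient vector of \<open>x ^ k\<close> in
  \<open>adj(x - A) e\<close>.\<close>

lemma adj_row_coeff_rec:
  "A *\<^sub>v adj_row_coeff 0 = (- poly.coeff (char_poly A) 0) \<cdot>\<^sub>v krylov A 0"
  "adj_row_coeff k = A *\<^sub>v adj_row_coeff (Suc k) + poly.coeff (char_poly A) (Suc k) \<cdot>\<^sub>v krylov A 0"
proof -
  let ?Y = "char_poly_matrix A"
  define p where "p i = (\<Sum>j<n. adj_mat ?Y $$ (i, j))" for i
  have Y: "?Y \<in> carrier_mat n n" using A by simp
  note R = adj_mat[OF Y]
  have eq: "pCons 0 (p i) - (\<Sum>l<n. Polynomial.smult (A $$ (i, l)) (p l)) = char_poly A" if i: "i < n" for i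
  proof -
    have "char_poly A = (\<Sum>j<n. (?Y * adj_mat ?Y) $$ (i, j))"
      unfolding R(2) char_poly_def using i by (simp add: if_distrib[of "(*) _"] cong: if_cong)
    also have "\<dots> = (\<Sum>j<n. \<Sum>l<n. ?Y $$ (i, l) * adj_mat ?Y $$ (l, j))"
      using i Y R(1) by (auto simp: scalar_prod_def lessThan_atLeast0 intro!: sum.cong)
    also have "\<dots> = (\<Sum>l<n. ?Y $$ (i, l) * p l)"
      unfolding p_def sum_distrib_left by (rule sum.swap)
    also have "\<dots> = (\<Sum>l<n. (if l = i then pCons 0 (p i) else 0) - Polynomial.smult (A $$ (i, l)) (p l))"
      using i A by (intro sum.cong) (auto simp: char_poly_matrix_def algebra_simps)
    also have "\<dots> = pCons 0 (p i) - (\<Sum>l<n. Polynomial.smult (A $$ (i, l)) (p l))"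
      using i by (simp add: sum_subtractf)
    finally show ?thesis ..
  qed
  have Ab: "(A *\<^sub>v adj_row_coeff k) $ i = poly.coeff (\<Sum>l<n. Polynomial.smult (A $$ (i, l)) (p l)) k" if "i < n" for i k
    unfolding mult_mat_vec_index[OF A adj_row_coeff_carrier that]
    by (simp add: adj_row_coeff_def p_def coeff_sum)
  have b: "adj_row_coeff k $ i = poly.coeff (p i) k" if "i < n" for i k
    using that by (simp add: adj_row_coeff_def p_def)
  show "A *\<^sub>v adj_row_coeff 0 = (- poly.coeff (char_poly A) 0) \<cdot>\<^sub>v krylov A 0"
  proof (rule eq_vecI)
    fix i assume "i < dim_vec ((- poly.coeff (char_poly A) 0) \<cdot>\<^sub>v krylov A 0)"
    then have i: "i < n" by (simp add: krylov_0[OF A])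
    show "(A *\<^sub>v adj_row_coeff 0) $ i = ((- poly.coeff (char_poly A) 0) \<cdot>\<^sub>v krylov A 0) $ i"
      unfolding Ab[OF i] eq[OF i, symmetric] using i by (simp add: krylov_0[OF A])
  qed (use A in \<open>simp add: krylov_0[OF A]\<close>)
  show "adj_row_coeff k = A *\<^sub>v adj_row_coeff (Suc k) + poly.coeff (char_poly A) (Suc k) \<cdot>\<^sub>v krylov A 0"
  proof (rule eq_vecI)
    fix i assume "i < dim_vec (A *\<^sub>v adj_row_coeff (Suc k) + poly.coeff (char_poly A) (Suc k) \<cdot>\<^sub>v krylov A 0)"
    then have i: "i < n" by (simp add: krylov_0[OF A])
    have "(A *\<^sub>v adj_row_coeff (Suc k) + poly.coeff (char_poly A) (Suc k) \<cdot>\<^sub>v krylov A 0) $ i =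
        (A *\<^sub>v adj_row_coeff (Suc k)) $ i + poly.coeff (char_poly A) (Suc k)"
      using i A by (simp add: krylov_0[OF A] del: index_mult_mat_vec)
    then show "adj_row_coeff k $ i =
        (A *\<^sub>v adj_row_coeff (Suc k) + poly.coeff (char_poly A) (Suc k) \<cdot>\<^sub>v krylov A 0) $ i"
      unfolding Ab[OF i] b[OF i] eq[OF i, symmetric] by simp
  qed (use A in \<open>simp add: krylov_0[OF A] adj_row_coeff_def\<close>)
qed

lemma mult_zero_vec_add: "A *\<^sub>v 0\<^sub>v n + x = x" if "x \<in> carrier_vec n"
  using A that by (intro eq_vecI) auto

text \<open>The recursion itself gives the degree bound: far out all coefficients vanish, and for
  \<open>k \<ge> n\<close> this is carried back from \<open>Suc k\<close> to \<open>k\<close>,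
  because the characteristic polynomial has degree \<open>n\<close>.\<close>

lemma adj_row_coeff_eq_0: "k \<ge> n \<Longrightarrow> adj_row_coeff k = 0\<^sub>v n"
proof -
  define p where "p i = (\<Sum>j<n. adj_mat (char_poly_matrix A) $$ (i, j))" for i
  define K where "K = Suc (\<Sum>i<n. degree (p i))"
  have big: "adj_row_coeff k = 0\<^sub>v n" if "k \<ge> K" for k
  proof (rule eq_vecI)
    fix i assume "i < dim_vec (0\<^sub>v n :: int vec)"
    then have i: "i < n" by simp
    have "degree (p i) \<le> (\<Sum>i<n. degree (p i))" using i by (intro member_le_sum) auto
    then have "degree (p i) < k" using that unfolding K_def by simp
    then show "adj_row_coeff k $ i = 0\<^sub>v n $ i" using i by (simp add: adj_row_coeff_def p_def coeff_eq_0)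
  qed (simp add: adj_row_coeff_def)
  have "adj_row_coeff k = 0\<^sub>v n" if "k \<ge> n" "k + m \<ge> K" for k m
    using that
  proof (induction m arbitrary: k)
    case (Suc m)
    have "poly.coeff (char_poly A) (Suc k) = 0"
      using degree_monic_char_poly[OF A] Suc.prems by (intro coeff_eq_0) simp
    then show ?case
      using adj_row_coeff_rec(2)[of k] Suc.IH[of "Suc k"] Suc.prems
      by (simp add: mult_zero_vec_add krylov_0[OF A]) (auto intro!: eq_vecI)
  qed (use big in simp)
  from this[of k K] show "k \<ge> n \<Longrightarrow> adj_row_coeff k = 0\<^sub>v n" by simp
qed

text \<open>The recursion is solved from the top index \<open>n - 1\<close> downwards, as in
  Horner's scheme.\<close>

lemma adj_row_coeff_krylov:
  assumes "m < n" "i < n"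
  shows "adj_row_coeff (n - 1 - m) $ i = (\<Sum>k\<le>m. poly.coeff (char_poly A) (n - m + k) * krylov A k $ i)"
  using assms
proof (induction m arbitrary: i)
  case 0
  have "adj_row_coeff (n - 1) = poly.coeff (char_poly A) n \<cdot>\<^sub>v krylov A 0"
    using adj_row_coeff_rec(2)[of "n - 1"] adj_row_coeff_eq_0[of n] n
    by (simp add: mult_zero_vec_add krylov_0[OF A])
  then show ?case using 0 by (simp add: krylov_0[OF A])
next
  case (Suc m)
  let ?c = "poly.coeff (char_poly A)"
  have S: "n - 1 - m = Suc (n - 1 - Suc m)" "n - m = Suc (n - 1 - m)" using Suc.prems by auto
  have "adj_row_coeff (n - 1 - Suc m) = A *\<^sub>v adj_row_coeff (n - 1 - m) + ?c (n - 1 - m) \<cdot>\<^sub>v krylov A 0"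
    using adj_row_coeff_rec(2)[of "n - 1 - Suc m"] unfolding S(1) .
  then have "adj_row_coeff (n - 1 - Suc m) $ i =
      (A *\<^sub>v adj_row_coeff (n - 1 - m)) $ i + ?c (n - 1 - m) * krylov A 0 $ i"
    using Suc.prems A by (simp add: krylov_0[OF A] del: index_mult_mat_vec)
  also have "(A *\<^sub>v adj_row_coeff (n - 1 - m)) $ i =
      (\<Sum>l<n. A $$ (i, l) * (\<Sum>k\<le>m. ?c (n - m + k) * krylov A k $ l))"
    unfolding mult_mat_vec_index[OF A adj_row_coeff_carrier Suc.prems(2)]
    using Suc.IH Suc.prems by (intro sum.cong) auto
  also have "\<dots> = (\<Sum>k\<le>m. ?c (n - m + k) * krylov A (Suc k) $ i)"
    unfolding krylov_Suc[OF A] mult_mat_vec_index[OF A krylov_carrier[OF A] Suc.prems(2)]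
      sum_distrib_left by (subst sum.swap) (simp add: mult_ac)
  also have "\<dots> + ?c (n - 1 - m) * krylov A 0 $ i = (\<Sum>k\<le>Suc m. ?c (n - Suc m + k) * krylov A k $ i)"
    unfolding sum.atMost_Suc_shift using Suc.prems S by (simp add: add.commute)
  finally show ?case .
qed

text \<open>The Cayley-Hamilton theorem applied to the all-ones vector, obtained from the constant
  term of the recursion.\<close>

lemma krylov_recurrence:
  assumes "i < n"
  shows "krylov A n $ i = (\<Sum>k<n. - poly.coeff (char_poly A) k * krylov A k $ i)"
proof -
  let ?c = "poly.coeff (char_poly A)"
  have "- ?c 0 * krylov A 0 $ i = (A *\<^sub>v adj_row_coeff 0) $ i"
    unfolding adj_row_coeff_rec(1) using assms by (simp add: krylov_0[OF A])
  also have "\<dots> = (\<Sum>l<n. A $$ (i, l) * (\<Sum>k\<le>n - 1. ?c (Suc k) * krylov A k $ l))"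
    unfolding mult_mat_vec_index[OF A adj_row_coeff_carrier assms]
    using adj_row_coeff_krylov[of "n - 1"] n by (intro sum.cong) auto
  also have "\<dots> = (\<Sum>k\<le>n - 1. ?c (Suc k) * krylov A (Suc k) $ i)"
    unfolding krylov_Suc[OF A] mult_mat_vec_index[OF A krylov_carrier[OF A] assms]
      sum_distrib_left by (subst sum.swap) (simp add: mult_ac)
  also have "\<dots> = (\<Sum>k<n. ?c (Suc k) * krylov A (Suc k) $ i)"
    using n by (intro sum.cong) auto
  finally have "(\<Sum>k<Suc n. ?c k * krylov A k $ i) = 0"
    unfolding sum.lessThan_Suc_shift by simp
  moreover have "?c n = 1" using degree_monic_char_poly[OF A] by simp
  ultimately show ?thesis by (simp add: sum_negf)
qed

lemma coeff_resolvent_poly: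
  assumes "m < n"
  shows "poly.coeff (resolvent_poly A) (n - 1 - m) = (\<Sum>k\<le>m. poly.coeff (char_poly A) (n - m + k) * moment A k)"
proof -
  have "poly.coeff (resolvent_poly A) (n - 1 - m) = (\<Sum>i<n. adj_row_coeff (n - 1 - m) $ i)"
    using A by (simp add: resolvent_poly_def adj_row_coeff_def coeff_sum)
  also have "\<dots> = (\<Sum>i<n. \<Sum>k\<le>m. poly.coeff (char_poly A) (n - m + k) * krylov A k $ i)"
    using adj_row_coeff_krylov[OF assms] by simp
  also have "\<dots> = (\<Sum>k\<le>m. poly.coeff (char_poly A) (n - m + k) * moment A k)"
    by (subst sum.swap) (use A in \<open>simp add: moment_def scalar_prod_def lessThan_atLeast0 sum_distrib_left\<close>)
  finally show ?thesis .
qed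

lemma moment_recurrence:
  "moment A (m + n) = (\<Sum>k<n. - poly.coeff (char_poly A) k * moment A (m + k))"
proof -
  have "krylov A (m + n) $ i = (\<Sum>k<n. - poly.coeff (char_poly A) k * krylov A (m + k) $ i)" if "i < n" for i
    using that
  proof (induction m arbitrary: i)
    case 0
    then show ?case using krylov_recurrence by simp
  next
    case (Suc m)
    have "krylov A (Suc m + n) $ i = (\<Sum>l<n. A $$ (i, l) * krylov A (m + n) $ l)"
      using krylov_Suc[OF A, of "m + n"] mult_mat_vec_index[OF A krylov_carrier[OF A] Suc.prems] by simp
    also have "\<dots> = (\<Sum>l<n. A $$ (i, l) * (\<Sum>k<n. - poly.coeff (char_poly A) k * krylov A (m + k) $ l))"
      using Suc.IH by simp
    also have "\<dots> = (\<Sum>k<n. - poly.coeff (char_poly A) k * krylov A (Suc (m + k)) $ i)"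
      unfolding krylov_Suc[OF A] mult_mat_vec_index[OF A krylov_carrier[OF A] Suc.prems]
        sum_distrib_left by (subst sum.swap) (simp add: mult_ac)
    finally show ?case by simp
  qed
  then have "moment A (m + n) = (\<Sum>i<n. \<Sum>k<n. - poly.coeff (char_poly A) k * krylov A (m + k) $ i)"
    using A by (simp add: moment_def scalar_prod_def lessThan_atLeast0)
  also have "\<dots> = (\<Sum>k<n. - poly.coeff (char_poly A) k * moment A (m + k))"
    by (subst sum.swap) (use A in \<open>simp add: moment_def scalar_prod_def lessThan_atLeast0 sum_distrib_left\<close>)
  finally show ?thesis .
qed

end

text \<open>For \<open>m < n\<close> the coefficients of \<open>resolvent_poly\<close> give a
  triangular system for the moments, with the leading coefficient 1 of the characteristic polynomial
  in front of \<open>moment A m\<close>. Later moments follow from the recurrence.\<close>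

lemma moment_cong:
  assumes A: "A \<in> carrier_mat n n" and B: "B \<in> carrier_mat n n" and n: "n > 0"
    and c: "char_poly A = char_poly B" and r: "resolvent_poly A = resolvent_poly B"
  shows "moment A m = moment B m"
proof (induction m rule: less_induct)
  case (less m)
  show ?case
  proof (cases "m < n")
    case True
    have 1: "poly.coeff (char_poly B) n = 1" using degree_monic_char_poly[OF B] by simp
    have "(\<Sum>k\<le>m. poly.coeff (char_poly B) (n - m + k) * moment A k) =
        (\<Sum>k\<le>m. poly.coeff (char_poly B) (n - m + k) * moment B k)"
      using coeff_resolvent_poly[OF A n True] coeff_resolvent_poly[OF B n True] c r by simp
    moreover have "(\<Sum>k<m. poly.coeff (char_poly B) (n - m + k) * moment A k) =
        (\<Sum>k<m. poly.coeff (char_poly B) (n - m + k) * moment B k)" using less by simp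
    ultimately show ?thesis using 1 True by (simp add: lessThan_Suc_atMost[symmetric])
  next
    case False
    then have m: "m = (m - n) + n" by simp
    have "moment A (m - n + k) = moment B (m - n + k)" if "k < n" for k
      using less that False by simp
    then show ?thesis
      using moment_recurrence[OF A n, of "m - n"] moment_recurrence[OF B n, of "m - n"] c False by simp
  qed
qed

definition companion :: "int poly \<Rightarrow> nat \<Rightarrow> int mat" where
  "companion q n = mat n n (\<lambda>(i, j). if j = n - 1 then - poly.coeff q i else if i = Suc j then 1 else 0)"

lemma companion_carrier [simp]: "companion q n \<in> carrier_mat n n"
  by (simp add: companion_def)

text \<open>\<open>A\<close> shifts the Krylov vectors, and \<open>krylov_recurrence\<close> gives
  the last column.\<close>

lemma mult_krylov_mat:
  assumes A: "A \<in> carrier_mat n n" and n: "n > 0"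
  shows "A * krylov_mat A = krylov_mat A * companion (char_poly A) n"
proof (rule eq_matI)
  let ?C = "companion (char_poly A) n"
  fix i j assume "i < dim_row (krylov_mat A * ?C)" "j < dim_col (krylov_mat A * ?C)"
  then have ij: "i < n" "j < n" using A by (auto simp: companion_def)
  have "(A * krylov_mat A) $$ (i, j) = (A *\<^sub>v krylov A j) $ i"
    using ij A krylov_mat_carrier[OF A] by (simp add: col_krylov_mat[OF A])
  then have l: "(A * krylov_mat A) $$ (i, j) = krylov A (Suc j) $ i" using krylov_Suc[OF A] by simp
  have "(krylov_mat A * ?C) $$ (i, j) = (\<Sum>l<n. krylov A l $ i * ?C $$ (l, j))"
    using ij A krylov_mat_carrier[OF A]
    by (auto simp: scalar_prod_def lessThan_atLeast0 krylov_mat_index[OF A] companion_def intro!: sum.cong)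
  also have "\<dots> = krylov A (Suc j) $ i"
  proof (cases "j = n - 1")
    case True
    then show ?thesis using krylov_recurrence[OF A n ij(1)] n by (simp add: companion_def mult.commute)
  next
    case False
    then have "(\<Sum>l<n. krylov A l $ i * ?C $$ (l, j)) = (\<Sum>l<n. if l = Suc j then krylov A (Suc j) $ i else 0)"
      using ij by (intro sum.cong) (auto simp: companion_def)
    then show ?thesis using False ij by simp
  qed
  finally show "(A * krylov_mat A) $$ (i, j) = (krylov_mat A * ?C) $$ (i, j)" using l by simp
qed (use A krylov_mat_carrier[OF A] in \<open>auto simp: companion_def\<close>)

section \<open>Rational orthogonal similarity and its level\<close>

lemma mult_unit_vec:
  fixes M :: "'a::semiring_1 mat"
  shows "M \<in> carrier_mat n m \<Longrightarrow> j < m \<Longrightarrow> M *\<^sub>v unit_vec m j = col M j"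
  by (intro eq_vecI) auto

lemma smult_mat_cancel:
  fixes X Y :: "'a::idom mat"
  assumes "c \<noteq> 0" "c \<cdot>\<^sub>m X = c \<cdot>\<^sub>m Y"
  shows "X = Y"
proof (rule eq_matI)
  show r: "dim_row X = dim_row Y" using arg_cong[OF assms(2), of dim_row] by simp
  show c: "dim_col X = dim_col Y" using arg_cong[OF assms(2), of dim_col] by simp
  fix i j assume "i < dim_row Y" "j < dim_col Y"
  then have "c * X $$ (i, j) = c * Y $$ (i, j)"
    using arg_cong[OF assms(2), of "\<lambda>M. M $$ (i, j)"] r c by simp
  then show "X $$ (i, j) = Y $$ (i, j)" using assms(1) by simp
qed

lemma mult_mat_left_cancel:
  fixes X :: "'a::idom mat"
  assumes X: "X \<in> carrier_mat n n" "det X \<noteq> 0" and P: "P \<in> carrier_mat n m" and Q: "Q \<in> carrier_mat n m"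
    and eq: "X * P = X * Q"
  shows "P = Q"
proof -
  note R = adj_mat[OF X(1)]
  have a: "adj_mat X * (X * Z) = det X \<cdot>\<^sub>m Z" if "Z \<in> carrier_mat n m" for Z
    using assoc_mult_mat[OF R(1) X(1) that] R(3) mult_smult_assoc_mat[OF one_carrier_mat that] that
    by simp
  have "det X \<cdot>\<^sub>m P = det X \<cdot>\<^sub>m Q" using a[OF P] a[OF Q] eq by simp
  then show ?thesis by (rule smult_mat_cancel[OF X(2)])
qed

lemma mult_mat_scalar_commute:
  fixes X :: "'a::idom mat"
  assumes X: "X \<in> carrier_mat n n" and Y: "Y \<in> carrier_mat n n" and c: "c \<noteq> 0"
    and eq: "X * Y = c \<cdot>\<^sub>m 1\<^sub>m n"
  shows "Y * X = c \<cdot>\<^sub>m 1\<^sub>m n"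
proof (rule mult_mat_left_cancel[OF X])
  have "det X * det Y = c ^ n" using arg_cong[OF eq, of det] det_mult[OF X Y] by simp
  then show "det X \<noteq> 0" using c by auto
  have "X * (Y * X) = (c \<cdot>\<^sub>m 1\<^sub>m n) * X" unfolding assoc_mult_mat[OF X Y X, symmetric] eq ..
  also have "\<dots> = c \<cdot>\<^sub>m X" using mult_smult_assoc_mat[OF one_carrier_mat X] X by simp
  also have "\<dots> = X * (c \<cdot>\<^sub>m 1\<^sub>m n)" using mult_smult_distrib[OF X one_carrier_mat] X by simp
  finally show "X * (Y * X) = X * (c \<cdot>\<^sub>m 1\<^sub>m n)" .
qed (use X Y in auto)

text \<open>\<open>U / l\<close> is a rational orthogonal matrix fixing the all-ones vector and conjugating \<open>A\<close> to \<open>B\<close>.\<close>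

definition scaled_similarity :: "nat \<Rightarrow> int mat \<Rightarrow> int mat \<Rightarrow> int \<Rightarrow> int mat \<Rightarrow> bool" where
  "scaled_similarity n A B l U \<longleftrightarrow> U \<in> carrier_mat n n \<and> l \<noteq> 0 \<and> U\<^sup>T * U = l\<^sup>2 \<cdot>\<^sub>m 1\<^sub>m n \<and>
     A * U = U * B \<and> U *\<^sub>v vec n (\<lambda>_. 1) = l \<cdot>\<^sub>v vec n (\<lambda>_. 1)"

text \<open>The condition says that \<open>l\<close> is the level: no prime divisor of
  \<open>l\<close> can be cancelled from \<open>U\<close>. It supplies, for each such prime, a
  column to which the kernel arguments apply.\<close>

definition primitive_similarity :: "nat \<Rightarrow> int mat \<Rightarrow> int mat \<Rightarrow> nat \<Rightarrow> int mat \<Rightarrow> bool" where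
  "primitive_similarity n A B l U \<longleftrightarrow> scaled_similarity n A B (int l) U \<and>
     (\<forall>p. prime p \<and> p dvd l \<longrightarrow> (\<exists>j<n. \<not> dvd_vec p (col U j)))"

text \<open>Cancels a common factor: -1 to make \<open>l\<close> positive, and a prime in the
  descent to the level.\<close>

lemma scaled_similarity_divide:
  assumes A: "A \<in> carrier_mat n n" and B: "B \<in> carrier_mat n n" and V: "V \<in> carrier_mat n n" and c: "c \<noteq> 0"
    and s: "scaled_similarity n A B (c * l) (c \<cdot>\<^sub>m V)"
  shows "scaled_similarity n A B l V"
proof -
  let ?e = "vec n (\<lambda>_. 1 :: int)"
  have VT: "V\<^sup>T \<in> carrier_mat n n" using V by simp
  have s': "(c \<cdot>\<^sub>m V)\<^sup>T * (c \<cdot>\<^sub>m V) = (c * l)\<^sup>2 \<cdot>\<^sub>m 1\<^sub>m n" "A * (c \<cdot>\<^sub>m V) = (c \<cdot>\<^sub>m V) * B"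
    "(c \<cdot>\<^sub>m V) *\<^sub>v ?e = (c * l) \<cdot>\<^sub>v ?e" "l \<noteq> 0"
    using s unfolding scaled_similarity_def by auto
  have "(c \<cdot>\<^sub>m V)\<^sup>T * (c \<cdot>\<^sub>m V) = c\<^sup>2 \<cdot>\<^sub>m (V\<^sup>T * V)"
    using V by (intro eq_matI) (auto simp: power2_eq_square)
  moreover have "(c * l)\<^sup>2 \<cdot>\<^sub>m 1\<^sub>m n = c\<^sup>2 \<cdot>\<^sub>m (l\<^sup>2 \<cdot>\<^sub>m 1\<^sub>m n)" by (intro eq_matI) (auto simp: power_mult_distrib)
  ultimately have "c\<^sup>2 \<cdot>\<^sub>m (V\<^sup>T * V) = c\<^sup>2 \<cdot>\<^sub>m (l\<^sup>2 \<cdot>\<^sub>m 1\<^sub>m n)" using s'(1) by simp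
  then have 1: "V\<^sup>T * V = l\<^sup>2 \<cdot>\<^sub>m 1\<^sub>m n" using smult_mat_cancel c by (metis power_eq_0_iff zero_less_numeral)
  have "c \<cdot>\<^sub>m (A * V) = c \<cdot>\<^sub>m (V * B)"
    using s'(2) mult_smult_distrib[OF A V] mult_smult_assoc_mat[OF V B] by simp
  then have 2: "A * V = V * B" by (rule smult_mat_cancel[OF c])
  have "(c \<cdot>\<^sub>m V) *\<^sub>v ?e = c \<cdot>\<^sub>v (V *\<^sub>v ?e)" using V by (intro eq_vecI) auto
  then have "c \<cdot>\<^sub>v (V *\<^sub>v ?e) = c \<cdot>\<^sub>v (l \<cdot>\<^sub>v ?e)" using s'(3) by (simp add: smult_smult_assoc)
  then have 3: "V *\<^sub>v ?e = l \<cdot>\<^sub>v ?e" by (rule smult_vec_cancel[OF c])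
  show ?thesis unfolding scaled_similarity_def using V s'(4) 1 2 3 by blast
qed

text \<open>The matrix is \<open>W V\<^sup>-\<^sup>1\<close> for the two Krylov matrices, with
  denominators cleared by the adjugate of \<open>V\<close>. Equal moments give equal Gram matrices,
  which makes \<open>V\<close> invertible and the quotient orthogonal.\<close>

lemma exists_scaled_similarity:
  assumes A: "A \<in> carrier_mat n n" "A\<^sup>T = A" and B: "B \<in> carrier_mat n n" "B\<^sup>T = B" and n: "n > 0"
    and c: "char_poly A = char_poly B" and m: "\<And>k. moment A k = moment B k"
    and det: "det (krylov_mat A) \<noteq> 0"
  shows "\<exists>l U. scaled_similarity n A B l U"
proof -
  define W where "W = krylov_mat A"
  define V where "V = krylov_mat B"
  define C where "C = companion (char_poly A) n"
  have W: "W \<in> carrier_mat n n" and V: "V \<in> carrier_mat n n" and C: "C \<in> carrier_mat n n"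
    using krylov_mat_carrier[OF A(1)] krylov_mat_carrier[OF B(1)] by (simp_all add: W_def V_def C_def)
  let ?e = "vec n (\<lambda>_. 1 :: int)"
  have gram: "W\<^sup>T * W = V\<^sup>T * V"
  proof (rule eq_matI)
    fix i j assume "i < dim_row (V\<^sup>T * V)" "j < dim_col (V\<^sup>T * V)"
    then have ij: "i < n" "j < n" using V by auto
    have "(W\<^sup>T * W) $$ (i, j) = moment A (i + j)"
      using ij W by (simp add: W_def col_krylov_mat[OF A(1)] scalar_prod_krylov[OF A])
    also have "\<dots> = (V\<^sup>T * V) $$ (i, j)"
      using ij V by (simp add: V_def col_krylov_mat[OF B(1)] scalar_prod_krylov[OF B] m)
    finally show "(W\<^sup>T * W) $$ (i, j) = (V\<^sup>T * V) $$ (i, j)" .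
  qed (use W V in auto)
  have WT: "W\<^sup>T \<in> carrier_mat n n" and VT: "V\<^sup>T \<in> carrier_mat n n" using W V by auto
  have "det W * det W = det V * det V"
    using arg_cong[OF gram, of det] det_mult[OF WT W] det_mult[OF VT V] det_transpose[OF W] det_transpose[OF V]
    by simp
  then have detV: "det V \<noteq> 0" using det by (auto simp: W_def)
  define D where "D = det V"
  define R where "R = adj_mat V"
  have R: "R \<in> carrier_mat n n" and VR: "V * R = D \<cdot>\<^sub>m 1\<^sub>m n"
    using adj_mat[OF V] by (simp_all add: R_def D_def)
  have RT: "R\<^sup>T \<in> carrier_mat n n" using R by simp
  define U where "U = W * R"
  have U: "U \<in> carrier_mat n n" using W R by (simp add: U_def)
  have "U\<^sup>T * U = (V * R)\<^sup>T * (V * R)"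
  proof -
    have "U\<^sup>T * U = (R\<^sup>T * W\<^sup>T) * (W * R)" unfolding U_def transpose_mult[OF W R] ..
    also have "\<dots> = R\<^sup>T * ((W\<^sup>T * W) * R)"
      using RT WT W R by (simp add: assoc_mult_mat[of _ n n _ n _ n])
    also have "\<dots> = (R\<^sup>T * V\<^sup>T) * (V * R)"
      unfolding gram using RT VT V R by (simp add: assoc_mult_mat[of _ n n _ n _ n])
    finally show ?thesis unfolding transpose_mult[OF V R] .
  qed
  also have "\<dots> = D\<^sup>2 \<cdot>\<^sub>m 1\<^sub>m n"
    unfolding VR by (intro eq_matI) (auto simp: power2_eq_square)
  finally have UU: "U\<^sup>T * U = D\<^sup>2 \<cdot>\<^sub>m 1\<^sub>m n" .
  \<comment> \<open>\<open>A\<close> and \<open>B\<close> are similar to one companion matrix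
    through their Krylov matrices, so the adjugate of \<open>V\<close> intertwines \<open>C\<close>
    and \<open>B\<close>.\<close>
  have CR: "C * R = R * B"
  proof (rule mult_mat_left_cancel[OF V detV])
    have VRc: "V * R * B = D \<cdot>\<^sub>m B"
      unfolding VR using mult_smult_assoc_mat[OF one_carrier_mat B(1)] B(1) by simp
    have "V * C = B * V" using mult_krylov_mat[OF B(1) n] c by (simp add: V_def C_def)
    then have "V * (C * R) = B * (V * R)"
      unfolding assoc_mult_mat[OF V C R, symmetric] assoc_mult_mat[OF B(1) V R, symmetric] by simp
    also have "\<dots> = D \<cdot>\<^sub>m B" unfolding VR using mult_smult_distrib[OF B(1) one_carrier_mat] B(1) by simp
    also have "\<dots> = V * (R * B)" unfolding VRc[symmetric] by (rule assoc_mult_mat[OF V R B(1)])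
    finally show "V * (C * R) = V * (R * B)" .
  qed (use C R B in auto)
  have "A * U = W * C * R"
    unfolding U_def assoc_mult_mat[OF A(1) W R, symmetric]
    using mult_krylov_mat[OF A(1) n] by (simp add: W_def C_def)
  also have "\<dots> = U * B"
    unfolding U_def assoc_mult_mat[OF W C R] CR assoc_mult_mat[OF W R B(1)] ..
  finally have AU: "A * U = U * B" .
  \<comment> \<open>The first Krylov vector of both matrices is the all-ones vector, which is
    therefore fixed up to the factor \<open>D\<close>.\<close>
  have "V *\<^sub>v unit_vec n 0 = ?e"
    using n V by (simp add: mult_unit_vec[of _ n n] V_def col_krylov_mat[OF B(1) n] krylov_0[OF B(1)])
  then have "R *\<^sub>v ?e = D \<cdot>\<^sub>v unit_vec n 0"
    using adj_mat_mult_vec(1)[OF V, of "unit_vec n 0"] by (simp add: R_def D_def)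
  then have "U *\<^sub>v ?e = W *\<^sub>v (D \<cdot>\<^sub>v unit_vec n 0)"
    unfolding U_def using assoc_mult_mat_vec[OF W R, of ?e] by simp
  also have "\<dots> = D \<cdot>\<^sub>v (W *\<^sub>v unit_vec n 0)" by (rule mult_mat_vec_smult[OF W]) simp
  also have "W *\<^sub>v unit_vec n 0 = ?e"
    using n W by (simp add: mult_unit_vec[of _ n n] W_def col_krylov_mat[OF A(1) n] krylov_0[OF A(1)])
  finally have "U *\<^sub>v ?e = D \<cdot>\<^sub>v ?e" .
  then show ?thesis unfolding scaled_similarity_def using U UU AU detV D_def by blast
qed

text \<open>Descent to the least positive \<open>l\<close>: a prime dividing \<open>l\<close> and
  every entry of the matrix could be cancelled from both.\<close>

lemma exists_primitive_similarity:
  assumes A: "A \<in> carrier_mat n n" and B: "B \<in> carrier_mat n n"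
    and ex: "\<exists>l U. scaled_similarity n A B l U"
  shows "\<exists>l U. l > 0 \<and> primitive_similarity n A B l U"
proof -
  define P where "P l \<longleftrightarrow> l > 0 \<and> (\<exists>U. scaled_similarity n A B (int l) U)" for l :: nat
  obtain l U where lU: "scaled_similarity n A B l U" using ex by blast
  have "P (nat \<bar>l\<bar>)"
  proof (cases "l > 0")
    case True
    then show ?thesis using lU by (auto simp: P_def)
  next
    case False
    have U: "U \<in> carrier_mat n n" "l \<noteq> 0" using lU by (auto simp: scaled_similarity_def)
    have "scaled_similarity n A B (-1 * - l) (-1 \<cdot>\<^sub>m (- U))"
    proof -
      have "-1 \<cdot>\<^sub>m (- U) = U" using U by (intro eq_matI) auto
      then show ?thesis using lU by simp
    qed
    then have "scaled_similarity n A B (- l) (- U)"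
      using scaled_similarity_divide[OF A B, of "- U" "-1" "- l"] U by simp
    then show ?thesis using False U by (auto simp: P_def)
  qed
  then obtain m where m: "P m" "\<And>k. k < m \<Longrightarrow> \<not> P k" using exists_least_iff[of P] by blast
  then obtain V where V: "m > 0" "scaled_similarity n A B (int m) V" by (auto simp: P_def)
  have Vc: "V \<in> carrier_mat n n" using V by (simp add: scaled_similarity_def)
  have "\<exists>j<n. \<not> dvd_vec p (col V j)" if p: "prime p" "p dvd m" for p
  proof (rule ccontr)
    assume "\<not> (\<exists>j<n. \<not> dvd_vec p (col V j))"
    then have d: "int p dvd V $$ (i, j)" if "i < n" "j < n" for i j
      using that Vc unfolding dvd_vec_def by auto
    obtain k where k: "m = p * k" using p by blast
    define V' where "V' = map_mat (\<lambda>x. x div int p) V"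
    have "V = int p \<cdot>\<^sub>m V'" using Vc d by (intro eq_matI) (auto simp: V'_def)
    moreover have "V' \<in> carrier_mat n n" using Vc by (simp add: V'_def)
    ultimately have "scaled_similarity n A B (int k) V'"
      using scaled_similarity_divide[OF A B, of V' "int p" "int k"] V(2) p prime_gt_0_nat k by auto
    then have "P k" using V(1) k by (auto simp: P_def)
    moreover have "k < m" using V(1) k prime_gt_1_nat[OF p(1)] by simp
    ultimately show False using m(2) by blast
  qed
  then show ?thesis using V unfolding primitive_similarity_def by blast
qed

text \<open>The hypothesis makes \<open>l\<close> squarefree, so a prime has multiplicity at most 2
  in its square, and multiplicities can be compared prime by prime.\<close>

lemma square_dvd_of_prime_squares:
  fixes l :: nat and x :: int
  assumes "l > 0" "\<And>p. prime p \<Longrightarrow> p dvd l \<Longrightarrow> \<not> p\<^sup>2 dvd l \<and> (int p)\<^sup>2 dvd x"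
  shows "(int l)\<^sup>2 dvd x"
proof (cases "x = 0")
  case False
  have "l\<^sup>2 dvd nat \<bar>x\<bar>"
  proof (rule multiplicity_le_imp_dvd)
    fix p :: nat assume p: "prime p"
    show "multiplicity p (l\<^sup>2) \<le> multiplicity p (nat \<bar>x\<bar>)"
    proof (cases "p dvd l")
      case True
      then have d: "\<not> p ^ 2 dvd l" "(int p)\<^sup>2 dvd x" using assms(2)[OF p] by auto
      have "multiplicity p l < 2" using d(1) assms(1) p by (intro multiplicity_lessI) auto
      then have "multiplicity p (l\<^sup>2) \<le> 2"
        using p assms(1) by (subst prime_elem_multiplicity_power_distrib) auto
      also have "int (p\<^sup>2) dvd int (nat \<bar>x\<bar>)" using d(2) by simp
      then have "p\<^sup>2 dvd nat \<bar>x\<bar>" by (simp only: int_dvd_int_iff)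
      then have "2 \<le> multiplicity p (nat \<bar>x\<bar>)"
        using False p by (intro multiplicity_geI) auto
      finally show ?thesis .
    next
      case False
      then have "\<not> p dvd l\<^sup>2" using p prime_dvd_power by blast
      then show ?thesis by (simp add: not_dvd_imp_multiplicity_0)
    qed
  qed (use assms(1) in simp)
  then have "int (l\<^sup>2) dvd int (nat \<bar>x\<bar>)" by (simp only: int_dvd_int_iff)
  then show ?thesis by simp
qed simp

lemma scaled_similarity_simps:
  assumes A: "A \<in> carrier_mat n n" "A\<^sup>T = A" and B: "B \<in> carrier_mat n n" "B\<^sup>T = B"
    and s: "scaled_similarity n A B l U"
  shows "U \<in> carrier_mat n n" "U\<^sup>T * U = l\<^sup>2 \<cdot>\<^sub>m 1\<^sub>m n" "U * U\<^sup>T = l\<^sup>2 \<cdot>\<^sub>m 1\<^sub>m n" "A * U = U * B"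
    "B * U\<^sup>T = U\<^sup>T * A" "U *\<^sub>v vec n (\<lambda>_. 1) = l \<cdot>\<^sub>v vec n (\<lambda>_. 1)"
    "U\<^sup>T *\<^sub>v vec n (\<lambda>_. 1) = l \<cdot>\<^sub>v vec n (\<lambda>_. 1)" "l \<noteq> 0"
proof -
  let ?e = "vec n (\<lambda>_. 1 :: int)"
  show U: "U \<in> carrier_mat n n" and UU: "U\<^sup>T * U = l\<^sup>2 \<cdot>\<^sub>m 1\<^sub>m n" and AU: "A * U = U * B"
    and Ue: "U *\<^sub>v ?e = l \<cdot>\<^sub>v ?e" and l: "l \<noteq> 0"
    using s by (auto simp: scaled_similarity_def)
  have UT: "U\<^sup>T \<in> carrier_mat n n" using U by simp
  show "U * U\<^sup>T = l\<^sup>2 \<cdot>\<^sub>m 1\<^sub>m n" using mult_mat_scalar_commute[OF UT U _ UU] l by simp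
  show "B * U\<^sup>T = U\<^sup>T * A"
    using arg_cong[OF AU, of transpose_mat] transpose_mult[OF A(1) U] transpose_mult[OF U B(1)] A(2) B(2)
    by simp
  have "l \<cdot>\<^sub>v (U\<^sup>T *\<^sub>v ?e) = U\<^sup>T *\<^sub>v (U *\<^sub>v ?e)"
    unfolding Ue by (rule mult_mat_vec_smult[OF UT, symmetric]) simp
  also have "\<dots> = (U\<^sup>T * U) *\<^sub>v ?e" by (rule assoc_mult_mat_vec[OF UT U, symmetric]) simp
  also have "\<dots> = l \<cdot>\<^sub>v (l \<cdot>\<^sub>v ?e)"
    unfolding UU by (intro eq_vecI) (auto simp: row_smult smult_scalar_prod_distrib[of _ n] power2_eq_square)
  finally show "U\<^sup>T *\<^sub>v ?e = l \<cdot>\<^sub>v ?e" by (rule smult_vec_cancel[OF l])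
qed

lemma similarity_krylov:
  assumes A: "A \<in> carrier_mat n n" "A\<^sup>T = A" and B: "B \<in> carrier_mat n n" "B\<^sup>T = B"
    and s: "scaled_similarity n A B l U"
  shows "U\<^sup>T *\<^sub>v krylov A j = l \<cdot>\<^sub>v krylov B j"
proof (induction j)
  note S = scaled_similarity_simps[OF A B s]
  case 0
  then show ?case using S(7) by (simp add: krylov_0[OF A(1)] krylov_0[OF B(1)])
next
  note S = scaled_similarity_simps[OF A B s]
  have UT: "U\<^sup>T \<in> carrier_mat n n" using S(1) by simp
  case (Suc j)
  have "U\<^sup>T *\<^sub>v krylov A (Suc j) = (U\<^sup>T * A) *\<^sub>v krylov A j"
    unfolding krylov_Suc[OF A(1)] by (rule assoc_mult_mat_vec[OF UT A(1) krylov_carrier[OF A(1)], symmetric])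
  also have "\<dots> = B *\<^sub>v (U\<^sup>T *\<^sub>v krylov A j)"
    unfolding S(5)[symmetric] by (rule assoc_mult_mat_vec[OF B(1) UT krylov_carrier[OF A(1)]])
  also have "\<dots> = l \<cdot>\<^sub>v krylov B (Suc j)"
    unfolding Suc krylov_Suc[OF B(1)] by (rule mult_mat_vec_smult[OF B(1) krylov_carrier[OF B(1)]])
  finally show ?case .
qed

text \<open>\<open>U\<^sup>T\<close> sends each \<open>krylov A j\<close> to \<open>l\<close> times
  \<open>krylov B j\<close>.\<close>

lemma dvd_vec_similarity_col:
  assumes A: "A \<in> carrier_mat n n" "A\<^sup>T = A" and B: "B \<in> carrier_mat n n" "B\<^sup>T = B"
    and s: "scaled_similarity n A B l U" and c: "c < n"
  shows "dvd_vec l ((krylov_mat A)\<^sup>T *\<^sub>v col U c)"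
  unfolding dvd_vec_def
proof (intro allI impI)
  note S = scaled_similarity_simps[OF A B s]
  fix j assume "j < dim_vec ((krylov_mat A)\<^sup>T *\<^sub>v col U c)"
  then have j: "j < n" using krylov_mat_carrier[OF A(1)] by simp
  have uc: "col U c \<in> carrier_vec n" using S(1) by (rule col_carrier_vec[OF c])
  have "((krylov_mat A)\<^sup>T *\<^sub>v col U c) $ j = krylov A j \<bullet> col U c"
    by (rule transpose_krylov_mat_index[OF A(1) uc j])
  also have "\<dots> = (U\<^sup>T *\<^sub>v krylov A j) $ c"
    using comm_scalar_prod[OF krylov_carrier[OF A(1)] uc] c S(1) by simp
  also have "\<dots> = l * krylov B j $ c"
    unfolding similarity_krylov[OF A B s] using c krylov_carrier[OF B(1), of j] by simp
  finally show "l dvd ((krylov_mat A)\<^sup>T *\<^sub>v col U c) $ j" by simp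
qed

text \<open>From \<open>A ^ k U = U B ^ k\<close> and \<open>U\<^sup>T U = l\<^sup>2\<close>, the
  product is \<open>l\<^sup>2\<close> times an entry of \<open>B ^ k\<close>.\<close>

lemma square_dvd_similarity_cols:
  assumes A: "A \<in> carrier_mat n n" "A\<^sup>T = A" and B: "B \<in> carrier_mat n n" "B\<^sup>T = B"
    and s: "scaled_similarity n A B l U" and c: "c < n" "c' < n"
  shows "l\<^sup>2 dvd col U c \<bullet> (A ^\<^sub>m k *\<^sub>v col U c')"
proof -
  note S = scaled_similarity_simps[OF A B s]
  have UT: "U\<^sup>T \<in> carrier_mat n n" using S(1) by simp
  have pw: "A ^\<^sub>m k *\<^sub>v (U *\<^sub>v x) = U *\<^sub>v (B ^\<^sub>m k *\<^sub>v x)" if x: "x \<in> carrier_vec n" for x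
  proof (induction k)
    case 0
    then show ?case using A(1) B(1) S(1) x by simp
  next
    case (Suc k)
    have Bx: "B ^\<^sub>m k *\<^sub>v x \<in> carrier_vec n" by (rule pow_mult_vec_carrier[OF B(1) x])
    have "A ^\<^sub>m Suc k *\<^sub>v (U *\<^sub>v x) = A *\<^sub>v (U *\<^sub>v (B ^\<^sub>m k *\<^sub>v x))"
      using pow_mat_mult_vec_Suc[OF A(1), of "U *\<^sub>v x" k] Suc S(1) x by simp
    also have "\<dots> = (A * U) *\<^sub>v (B ^\<^sub>m k *\<^sub>v x)" by (rule assoc_mult_mat_vec[OF A(1) S(1) Bx, symmetric])
    also have "\<dots> = U *\<^sub>v (B *\<^sub>v (B ^\<^sub>m k *\<^sub>v x))" unfolding S(4) by (rule assoc_mult_mat_vec[OF S(1) B(1) Bx])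
    finally show ?case unfolding pow_mat_mult_vec_Suc[OF B(1) x] .
  qed
  let ?x = "unit_vec n c :: int vec" and ?y = "B ^\<^sub>m k *\<^sub>v unit_vec n c'"
  have y: "?y \<in> carrier_vec n" by (rule pow_mult_vec_carrier[OF B(1)]) simp
  have "col U c \<bullet> (A ^\<^sub>m k *\<^sub>v col U c') = (U *\<^sub>v ?x) \<bullet> (U *\<^sub>v ?y)"
    using pw[of "unit_vec n c'"] mult_unit_vec[OF S(1)] c by simp
  also have "\<dots> = (U\<^sup>T *\<^sub>v (U *\<^sub>v ?x)) \<bullet> ?y"
    using transpose_vec_mult_scalar[OF S(1) y, of "U *\<^sub>v ?x"] S(1) by simp
  also have "U\<^sup>T *\<^sub>v (U *\<^sub>v ?x) = (U\<^sup>T * U) *\<^sub>v ?x" by (rule assoc_mult_mat_vec[OF UT S(1), symmetric]) simp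
  also have "\<dots> = l\<^sup>2 \<cdot>\<^sub>v ?x"
    unfolding S(2) by (intro eq_vecI) (auto simp: row_smult smult_scalar_prod_distrib[of _ n])
  also have "(l\<^sup>2 \<cdot>\<^sub>v ?x) \<bullet> ?y = l\<^sup>2 * (?x \<bullet> ?y)"
    using y by (intro smult_scalar_prod_distrib[of _ n]) auto
  finally show ?thesis by simp
qed

text \<open>In each row the entries and their squares both have sum 1, and \<open>x * x - x\<close>
  is nonnegative for integers, so all entries are 0 or 1. The norms of rows and columns then leave a
  single 1 in each.\<close>

lemma permutation_of_orthogonal_int_mat:
  fixes V :: "int mat"
  assumes V: "V \<in> carrier_mat n n" and o: "V\<^sup>T * V = 1\<^sub>m n" "V * V\<^sup>T = 1\<^sub>m n"
    and e: "V *\<^sub>v vec n (\<lambda>_. 1) = vec n (\<lambda>_. 1)"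
  obtains \<sigma> where "bij_betw \<sigma> {..<n} {..<n}"
    "\<And>i j. i < n \<Longrightarrow> j < n \<Longrightarrow> V $$ (i, j) = (if j = \<sigma> i then 1 else 0)"
proof -
  have row1: "(\<Sum>j<n. V $$ (i, j) * V $$ (i, j)) = 1" if "i < n" for i
    using arg_cong[OF o(2), of "\<lambda>M. M $$ (i, i)"] that V by (simp add: scalar_prod_def lessThan_atLeast0)
  have col1: "(\<Sum>i<n. V $$ (i, j) * V $$ (i, j)) = 1" if "j < n" for j
    using arg_cong[OF o(1), of "\<lambda>M. M $$ (j, j)"] that V by (simp add: scalar_prod_def lessThan_atLeast0)
  have rs: "(\<Sum>j<n. V $$ (i, j)) = 1" if "i < n" for i
    using arg_cong[OF e, of "\<lambda>v. v $ i"] that V by (simp add: scalar_prod_def lessThan_atLeast0)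
  have bin: "V $$ (i, j) = 0 \<or> V $$ (i, j) = 1" if ij: "i < n" "j < n" for i j
  proof -
    have nonneg: "0 \<le> x * x - x" for x :: int
    proof (cases "x \<ge> 1")
      case True
      then have "x * 1 \<le> x * x" by (intro mult_left_mono) auto
      then show ?thesis by simp
    next
      case False
      then have "0 \<le> x * x" "x \<le> 0" by auto
      then show ?thesis by linarith
    qed
    have "(\<Sum>j<n. V $$ (i, j) * V $$ (i, j) - V $$ (i, j)) = 0"
      using row1[OF ij(1)] rs[OF ij(1)] by (simp add: sum_subtractf)
    then have "V $$ (i, j) * V $$ (i, j) - V $$ (i, j) = 0"
      using sum_nonneg_eq_0_iff[of "{..<n}" "\<lambda>j. V $$ (i, j) * V $$ (i, j) - V $$ (i, j)"] nonneg ij(2)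
      by simp
    then have "V $$ (i, j) * (V $$ (i, j) - 1) = 0" by (simp add: algebra_simps)
    then show ?thesis by simp
  qed
  have count: "\<exists>!j. j < n \<and> f j = (1::int)" if f: "(\<Sum>j<n. f j * f j) = 1" "\<And>j. j < n \<Longrightarrow> f j = 0 \<or> f j = 1" for f
  proof -
    have "(\<Sum>j<n. f j * f j) = (\<Sum>j<n. if f j = 1 then 1 else 0)" using f(2) by (intro sum.cong) auto
    also have "\<dots> = int (card {j. j < n \<and> f j = 1})" by (simp add: sum.If_cases lessThan_def Int_def)
    finally have "card {j. j < n \<and> f j = 1} = 1" using f(1) by simp
    then obtain a where "{j. j < n \<and> f j = 1} = {a}" by (auto simp: card_1_singleton_iff)
    then show ?thesis by (intro ex1I[of _ a]) auto
  qed
  have "\<exists>!j. j < n \<and> V $$ (i, j) = 1" if "i < n" for i using count row1 bin that by simp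
  then obtain \<sigma> where \<sigma>: "\<And>i. i < n \<Longrightarrow> \<sigma> i < n \<and> V $$ (i, \<sigma> i) = 1"
    "\<And>i j. i < n \<Longrightarrow> j < n \<Longrightarrow> V $$ (i, j) = 1 \<Longrightarrow> j = \<sigma> i" by metis
  have colu: "\<exists>!i. i < n \<and> V $$ (i, j) = 1" if "j < n" for j
    using count[of "\<lambda>i. V $$ (i, j)"] col1 bin that by simp
  have "inj_on \<sigma> {..<n}"
    using \<sigma>(1) colu by (intro inj_onI) (metis lessThan_iff)
  moreover have "\<sigma> ` {..<n} \<subseteq> {..<n}" using \<sigma>(1) by auto
  ultimately have "bij_betw \<sigma> {..<n} {..<n}"
    by (simp add: bij_betw_def endo_inj_surj)
  then show thesis
  proof (rule that)
    fix i j assume "i < n" "j < n"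
    then show "V $$ (i, j) = (if j = \<sigma> i then 1 else 0)" using \<sigma> bin by metis
  qed
qed

section \<open>Levels under the determinant and rank conditions\<close>

locale cube_free_krylov =
  fixes A :: "int mat" and n :: nat and d :: int
  assumes A: "A \<in> carrier_mat n n" and sym: "A\<^sup>T = A" and diag: "\<And>i. i < n \<Longrightarrow> A $$ (i, i) = 0"
    and n: "n > 0" and det: "det (krylov_mat A) = 2 ^ (n div 2) * d" and d: "odd d"
    and cube: "\<And>p. prime p \<Longrightarrow> odd p \<Longrightarrow> \<not> int p ^ 3 dvd d"
    and rank: "\<And>p. prime p \<Longrightarrow> odd p \<Longrightarrow> int p dvd det (krylov_mat A) \<Longrightarrow> corank1_mod p (krylov_mat A)"
begin

text \<open>By primitivity some column \<open>u\<close> of \<open>U\<close> is nonzero modulo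
  \<open>p\<close>. For \<open>p = 2\<close> this contradicts
  \<open>even_of_even_quadratic_values\<close>. Otherwise \<open>p\<close> divides the determinant,
  since \<open>u\<close> is in the kernel of the transpose, and its exponent is 1 or 2. The exact
  power cannot divide \<open>l\<close>: this rules out exponent 1, and for exponent 2 it keeps
  \<open>p\<^sup>2\<close> from dividing \<open>l\<close>.\<close>

lemma level_prime_factor:
  assumes B: "B \<in> carrier_mat n n" "B\<^sup>T = B" and s: "primitive_similarity n A B l U"
    and p: "prime p" "p dvd l"
  shows "odd p" "(int p)\<^sup>2 dvd det (krylov_mat A)" "\<not> p\<^sup>2 dvd l"
proof -
  let ?W = "krylov_mat A"
  have W: "?W \<in> carrier_mat n n" by (rule krylov_mat_carrier[OF A])
  have s': "scaled_similarity n A B (int l) U" using s by (simp add: primitive_similarity_def)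
  note S = scaled_similarity_simps[OF A sym B s']
  obtain c where c: "c < n" "\<not> dvd_vec p (col U c)" using s p by (auto simp: primitive_similarity_def)
  define u where "u = col U c"
  have u: "u \<in> carrier_vec n" "\<not> dvd_vec p u" using c S(1) by (auto simp: u_def)
  have Wu: "dvd_vec m (?W\<^sup>T *\<^sub>v u)" if "m dvd int l" for m
    using dvd_vec_trans[OF that dvd_vec_similarity_col[OF A sym B s' c(1)]] by (simp add: u_def)
  have uu: "m\<^sup>2 dvd u \<bullet> (A ^\<^sub>m k *\<^sub>v u)" if "m dvd int l" for m k
    using square_dvd_similarity_cols[OF A sym B s' c(1) c(1), of k] dvd_power_same[OF that, of 2]
    unfolding u_def by (rule dvd_trans[rotated])
  show "odd p"
  proof
    assume "even p"
    then have p2: "p = 2" using p(1) primes_dvd_imp_eq two_is_prime_nat by blast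
    then have "2 dvd int l" using p(2) by auto
    then have "dvd_vec 2 u"
      using even_of_even_quadratic_values[OF A sym diag det d n u(1) Wu] uu[of 2] by simp
    then show False using u(2) p2 by simp
  qed
  have pI: "prime (int p)" using p(1) by simp
  have pl: "int p dvd int l" using p(2) by simp
  have pdet: "int p dvd det ?W"
  proof (rule ccontr)
    assume "\<not> int p dvd det ?W"
    then have "coprime (int p) (det ?W\<^sup>T)" using prime_imp_coprime[OF pI] det_transpose[OF W] by metis
    then show False using dvd_vec_mat_cancel[OF _ u(1) _ Wu[OF pl]] u(2) W by simp
  qed
  have cube': "\<not> int p ^ 3 dvd det ?W"
  proof
    assume "int p ^ 3 dvd det ?W"
    moreover have "coprime (int p) 2" using prime_imp_coprime[OF pI, of 2] \<open>odd p\<close>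
      by (metis coprime_commute coprime_left_2_iff_odd even_of_nat_iff)
    then have "coprime (int p ^ 3) (2 ^ (n div 2))" by simp
    ultimately have "int p ^ 3 dvd d" unfolding det by (simp add: coprime_dvd_mult_right_iff)
    then show False using cube[OF p(1) \<open>odd p\<close>] by blast
  qed
  have key: False if a: "det ?W = int p ^ a * d'" "a > 0" "\<not> int p dvd d'" "int p ^ a dvd int l" for a d'
  proof (rule no_isotropic_kernel_vector[OF n A sym W companion_carrier mult_krylov_mat[OF A n] _ p(1) a(1-3)
        rank[OF p(1) \<open>odd p\<close> pdet] u(1) Wu[OF a(4)] u(2)])
    fix i j assume "i < n" "j < n"
    then show "companion (char_poly A) n $$ (i, j) =
        (if j = n - 1 then - poly.coeff (char_poly A) i else if i = Suc j then 1 else 0)"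
      by (simp add: companion_def)
  next
    show "int p ^ (2 * a) dvd u \<bullet> u"
      using uu[OF a(4), of 0] A u(1) by (simp add: power_mult[symmetric] mult.commute)
    show "int p ^ (2 * a) dvd u \<bullet> (A *\<^sub>v u)"
      using uu[OF a(4), of 1] A u(1) by (simp add: power_mult[symmetric] mult.commute)
  qed
  show p2: "(int p)\<^sup>2 dvd det ?W"
  proof (rule ccontr)
    assume np2: "\<not> (int p)\<^sup>2 dvd det ?W"
    obtain d' where d': "det ?W = int p * d'" using pdet by blast
    then have "\<not> int p dvd d'" using np2 by (auto simp: power2_eq_square)
    then show False using key[of 1 d'] d' pl by simp
  qed
  show "\<not> p\<^sup>2 dvd l"
  proof
    assume "p\<^sup>2 dvd l"
    then have l2: "int p ^ 2 dvd int l" by (metis int_dvd_int_iff of_nat_power)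
    obtain d' where d': "det ?W = int p ^ 2 * d'" using p2 by blast
    then have "\<not> int p dvd d'" using cube' by (auto simp: power2_eq_square power3_eq_cube)
    then show False using key[of 2 d'] d' l2 by simp
  qed
qed

text \<open>\<open>U\<^sup>T U'\<close> is divisible by \<open>l\<^sup>2\<close>, checked prime by
  prime since \<open>l\<close> is squarefree. The quotient is an integral orthogonal matrix fixing
  the all-ones vector, hence a permutation matrix, and it conjugates \<open>B\<close> to
  \<open>B'\<close>.\<close>

lemma permutation_similar_of_same_level:
  assumes B: "B \<in> carrier_mat n n" "B\<^sup>T = B" and s: "primitive_similarity n A B l U"
    and B': "B' \<in> carrier_mat n n" "B'\<^sup>T = B'" and s': "primitive_similarity n A B' l U'"
  obtains \<sigma> where "bij_betw \<sigma> {..<n} {..<n}"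
    "\<And>i j. i < n \<Longrightarrow> j < n \<Longrightarrow> B $$ (i, j) = B' $$ (\<sigma> i, \<sigma> j)"
proof -
  let ?W = "krylov_mat A"
  let ?e = "vec n (\<lambda>_. 1 :: int)"
  have W: "?W \<in> carrier_mat n n" by (rule krylov_mat_carrier[OF A])
  have t: "scaled_similarity n A B (int l) U" "scaled_similarity n A B' (int l) U'"
    using s s' by (simp_all add: primitive_similarity_def)
  note S = scaled_similarity_simps[OF A sym B t(1)]
  note S' = scaled_similarity_simps[OF A sym B' t(2)]
  have UT: "U\<^sup>T \<in> carrier_mat n n" and UT': "U'\<^sup>T \<in> carrier_mat n n" using S(1) S'(1) by auto
  have "(int l)\<^sup>2 dvd (U\<^sup>T * U') $$ (i, j)" if ij: "i < n" "j < n" for i j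
  proof (rule square_dvd_of_prime_squares)
    show "l > 0" using S(8) by simp
    fix p assume p: "prime p" "p dvd l"
    note L = level_prime_factor[OF B s p]
    have "int p dvd det ?W" using L(2) by (metis dvd_mult_left power2_eq_square)
    note cr = rank[OF p(1) L(1) this]
    have pl: "int p dvd int l" using p(2) by simp
    have pl2: "(int p)\<^sup>2 dvd (int l)\<^sup>2" using pl by (rule dvd_power_same)
    \<comment> \<open>Column \<open>c\<close> of \<open>U\<close> becomes \<open>w\<close> and
      column \<open>c'\<close> of \<open>U'\<close> becomes \<open>y0\<close> in
      \<open>prime_square_dvd_scalar_prod\<close>. The kernel is a line modulo \<open>p\<close>, so
      every column of \<open>U\<close> and \<open>U'\<close> is a multiple of \<open>w\<close>
      modulo \<open>p\<close>.\<close>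
    obtain c where c: "c < n" "\<not> dvd_vec p (col U c)" using s p by (auto simp: primitive_similarity_def)
    obtain c' where c': "c' < n" "\<not> dvd_vec p (col U' c')" using s' p by (auto simp: primitive_similarity_def)
    have cU: "col U k \<in> carrier_vec n" "col U' k \<in> carrier_vec n" if "k < n" for k
      using S(1) S'(1) that by auto
    have ker: "dvd_vec (int p ^ 1) (?W\<^sup>T *\<^sub>v col U k)" "dvd_vec (int p ^ 1) (?W\<^sup>T *\<^sub>v col U' k)" if "k < n" for k
      using dvd_vec_trans[OF pl dvd_vec_similarity_col[OF A sym B t(1) that]]
        dvd_vec_trans[OF pl dvd_vec_similarity_col[OF A sym B' t(2) that]] by auto
    have one: "(0::nat) < 1" by simp
    have line: "\<exists>\<mu> y. y \<in> carrier_vec n \<and> x = \<mu> \<cdot>\<^sub>v col U c + int p \<cdot>\<^sub>v y"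
      if "x \<in> carrier_vec n" "dvd_vec (int p ^ 1) (?W\<^sup>T *\<^sub>v x)" for x
      using proportional_mod_of_corank1[OF W cr p(1) one that cU(1)[OF c(1)] ker(1)[OF c(1)] c(2)]
      by (metis power_one_right)
    have sq: "(int p)\<^sup>2 dvd col U k \<bullet> col U m" "(int p)\<^sup>2 dvd col U' k \<bullet> col U' m" if "k < n" "m < n" for k m
      using square_dvd_similarity_cols[OF A sym B t(1) that, of 0]
        square_dvd_similarity_cols[OF A sym B' t(2) that, of 0] A cU that pl2
      by (auto intro: dvd_trans)
    obtain \<alpha> x where x: "x \<in> carrier_vec n" "col U i = \<alpha> \<cdot>\<^sub>v col U c + int p \<cdot>\<^sub>v x"
      using line[OF cU(1)[OF ij(1)] ker(1)[OF ij(1)]] by blast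
    obtain \<beta> y where y: "y \<in> carrier_vec n" "col U' j = \<beta> \<cdot>\<^sub>v col U c + int p \<cdot>\<^sub>v y"
      using line[OF cU(2)[OF ij(2)] ker(2)[OF ij(2)]] by blast
    obtain \<beta>0 y0 where y0: "y0 \<in> carrier_vec n" "col U' c' = \<beta>0 \<cdot>\<^sub>v col U c + int p \<cdot>\<^sub>v y0"
      using line[OF cU(2)[OF c'(1)] ker(2)[OF c'(1)]] by blast
    have "(int p)\<^sup>2 dvd col U i \<bullet> col U' j"
      by (rule prime_square_dvd_scalar_prod[OF p(1) L(1) cU(1)[OF c(1)] x(1) y(1) y0(1) x(2) y(2) y0(2)
            sq(1)[OF c(1) c(1)] sq(1)[OF ij(1) c(1)] sq(2)[OF c'(1) c'(1)] sq(2)[OF ij(2) c'(1)] c'(2)])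
    then have "(int p)\<^sup>2 dvd (U\<^sup>T * U') $$ (i, j)" using ij S(1) S'(1) by simp
    then show "\<not> p\<^sup>2 dvd l \<and> (int p)\<^sup>2 dvd (U\<^sup>T * U') $$ (i, j)" using L(3) by simp
  qed
  then have dv: "(int l)\<^sup>2 dvd (U\<^sup>T * U') $$ (i, j)" if "i < n" "j < n" for i j using that by blast
  define V where "V = map_mat (\<lambda>x. x div (int l)\<^sup>2) (U\<^sup>T * U')"
  have V: "V \<in> carrier_mat n n" using S(1) S'(1) by (simp add: V_def)
  have UV: "U\<^sup>T * U' = (int l)\<^sup>2 \<cdot>\<^sub>m V"
    using S(1) S'(1) dv by (intro eq_matI) (auto simp: V_def simp del: index_mult_mat(1))
  have l2: "(int l)\<^sup>2 \<noteq> 0" using S(8) by simp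
  have VT: "V\<^sup>T \<in> carrier_mat n n" using V by simp
  have "(int l)\<^sup>2 \<cdot>\<^sub>m ((int l)\<^sup>2 \<cdot>\<^sub>m (V\<^sup>T * V)) = (U\<^sup>T * U')\<^sup>T * (U\<^sup>T * U')"
    unfolding UV using V by (intro eq_matI) auto
  also have "\<dots> = U'\<^sup>T * ((U * U\<^sup>T) * U')"
    using S(1) S'(1) UT UT' by (simp add: transpose_mult[OF UT S'(1)] assoc_mult_mat[of _ n n _ n _ n])
  also have "\<dots> = (int l)\<^sup>2 \<cdot>\<^sub>m (U'\<^sup>T * U')"
    unfolding S(3) using S'(1) UT' mult_smult_assoc_mat[OF one_carrier_mat S'(1)] mult_smult_distrib[OF UT' S'(1)]
    by simp
  finally have "(int l)\<^sup>2 \<cdot>\<^sub>m (V\<^sup>T * V) = U'\<^sup>T * U'" by (rule smult_mat_cancel[OF l2])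
  then have VTV: "V\<^sup>T * V = 1\<^sub>m n" unfolding S'(2) by (rule smult_mat_cancel[OF l2])
  have one_smult: "1 \<cdot>\<^sub>m 1\<^sub>m n = (1\<^sub>m n :: int mat)" by (intro eq_matI) auto
  from VTV have VVT: "V * V\<^sup>T = 1\<^sub>m n" using mult_mat_scalar_commute[OF VT V, of 1] one_smult by simp
  have "(int l)\<^sup>2 \<cdot>\<^sub>v (V *\<^sub>v ?e) = (U\<^sup>T * U') *\<^sub>v ?e"
    unfolding UV using V by (intro eq_vecI) auto
  also have "\<dots> = U\<^sup>T *\<^sub>v (int l \<cdot>\<^sub>v ?e)"
    using assoc_mult_mat_vec[OF UT S'(1), of ?e] S'(6) by simp
  also have "\<dots> = int l \<cdot>\<^sub>v (int l \<cdot>\<^sub>v ?e)" using mult_mat_vec_smult[OF UT, of ?e] S(7) by simp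
  also have "\<dots> = (int l)\<^sup>2 \<cdot>\<^sub>v ?e" by (intro eq_vecI) (auto simp: power2_eq_square)
  finally have Ve: "V *\<^sub>v ?e = ?e" by (rule smult_vec_cancel[OF l2])
  have "(int l)\<^sup>2 \<cdot>\<^sub>m (B * V) = B * (U\<^sup>T * U')" unfolding UV by (rule mult_smult_distrib[OF B(1) V, symmetric])
  also have "\<dots> = (U\<^sup>T * A) * U'" unfolding S(5)[symmetric] by (rule assoc_mult_mat[OF B(1) UT S'(1), symmetric])
  also have "\<dots> = U\<^sup>T * (U' * B')" unfolding S'(4)[symmetric] by (rule assoc_mult_mat[OF UT A S'(1)])
  also have "\<dots> = (int l)\<^sup>2 \<cdot>\<^sub>m (V * B')"
    unfolding assoc_mult_mat[OF UT S'(1) B'(1), symmetric] UV by (rule mult_smult_assoc_mat[OF V B'(1)])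
  finally have BV: "B * V = V * B'" by (rule smult_mat_cancel[OF l2])
  obtain \<sigma> where \<sigma>: "bij_betw \<sigma> {..<n} {..<n}"
    "\<And>i j. i < n \<Longrightarrow> j < n \<Longrightarrow> V $$ (i, j) = (if j = \<sigma> i then 1 else 0)"
    using permutation_of_orthogonal_int_mat[OF V VTV VVT Ve] by blast
  have \<sigma>n: "\<sigma> i < n" if "i < n" for i using \<sigma>(1) that bij_betwE by blast
  show thesis
  proof (rule that[OF \<sigma>(1)])
    fix i j assume ij: "i < n" "j < n"
    have "(B * V) $$ (i, \<sigma> j) = (\<Sum>m<n. B $$ (i, m) * V $$ (m, \<sigma> j))"
      using B(1) V ij \<sigma>n by (auto simp: scalar_prod_def lessThan_atLeast0 intro!: sum.cong)
    \<comment> \<open>Column \<open>\<sigma> j\<close> of \<open>V\<close> has its only 1 in row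
      \<open>j\<close>.\<close>
    also have "\<dots> = (\<Sum>m<n. if m = j then B $$ (i, j) else 0)"
      using \<sigma>(2) \<sigma>n ij bij_betw_imp_inj_on[OF \<sigma>(1)] by (intro sum.cong) (auto dest: inj_onD)
    also have "\<dots> = B $$ (i, j)" using ij by simp
    finally have l: "(B * V) $$ (i, \<sigma> j) = B $$ (i, j)" .
    have "(V * B') $$ (i, \<sigma> j) = (\<Sum>m<n. V $$ (i, m) * B' $$ (m, \<sigma> j))"
      using B'(1) V ij \<sigma>n by (auto simp: scalar_prod_def lessThan_atLeast0 intro!: sum.cong)
    also have "\<dots> = (\<Sum>m<n. if m = \<sigma> i then B' $$ (\<sigma> i, \<sigma> j) else 0)"
      using \<sigma>(2) ij by (intro sum.cong) auto
    also have "\<dots> = B' $$ (\<sigma> i, \<sigma> j)" using ij \<sigma>n by simp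
    finally show "B $$ (i, j) = B' $$ (\<sigma> i, \<sigma> j)" using l BV by simp
  qed
qed

end

section \<open>Graphs\<close>

text \<open>A squarefree number is the product of its prime divisors. This recovers a level from the
  set of its primes.\<close>

lemma dvd_of_prime_divisors:
  fixes l m :: nat
  assumes "l > 0" "m > 0" "\<And>p. prime p \<Longrightarrow> p dvd l \<Longrightarrow> \<not> p\<^sup>2 dvd l \<and> p dvd m"
  shows "l dvd m"
proof (rule multiplicity_le_imp_dvd)
  fix p :: nat assume p: "prime p"
  show "multiplicity p l \<le> multiplicity p m"
  proof (cases "p dvd l")
    case True
    then have d: "\<not> p ^ 2 dvd l" "p ^ 1 dvd m" using assms(3)[OF p] by auto
    have "multiplicity p l < 2" using d(1) assms(1) p by (intro multiplicity_lessI) auto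
    moreover have "1 \<le> multiplicity p m" using d(2) assms(2) p by (intro multiplicity_geI) auto
    ultimately show ?thesis by simp
  qed (simp add: not_dvd_imp_multiplicity_0)
qed (use assms in simp)

text \<open>An independent set of \<open>n - 1\<close> columns attains the maximum; completing it to
  a basis exchanges only the remaining column.\<close>

lemma corank1_mod_of_rank_mod:
  assumes p: "prime p" and W: "W \<in> carrier_mat n n" and n: "n > 0" and r: "rank_mod p W = n - 1"
  shows "corank1_mod p W"
proof -
  let ?R = "{card J | J. J \<subseteq> {..<dim_col W} \<and> cols_independent_mod p W J}"
  have "?R \<subseteq> card ` Pow {..<dim_col W}" by auto
  then have "finite ?R" by (rule finite_subset) auto
  moreover have "card {} \<in> ?R"
    by (intro CollectI exI[of _ "{}"]) (auto simp: cols_independent_mod_def)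
  ultimately have "Max ?R \<in> ?R" by (intro Max_in) auto
  then obtain J where J: "J \<subseteq> {..<n}" "cols_independent_mod p W J" "card J = n - 1"
    using r W unfolding rank_mod_def by auto
  have "card ({..<n} - J) = 1"
    using J(1,3) n by (simp add: card_Diff_subset finite_subset)
  then obtain j where j: "{..<n} - J = {j}" by (auto simp: card_1_singleton_iff)
  obtain N where "N \<in> carrier_mat n n" "\<forall>i<n. \<forall>k\<in>J. N $$ (i, k) = W $$ (i, k)" "\<not> int p dvd det N"
    using extend_cols_independent_mod[OF p W J(1,2)] by blast
  moreover have "j < n" using j by blast
  moreover have "k \<in> J" if "k < n" "k \<noteq> j" for k using j that by blast
  ultimately show ?thesis
    unfolding corank1_mod_def using W by (intro exI[of _ j] conjI bexI[of _ N]) auto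
qed

lemma adjacency_matrix_carrier [simp]: "adjacency_matrix H \<in> carrier_mat (card (pverts H)) (card (pverts H))"
  by (simp add: adjacency_matrix_def Let_def)

lemma adjacency_matrix_index:
  "i < card (pverts H) \<Longrightarrow> j < card (pverts H) \<Longrightarrow> adjacency_matrix H $$ (i, j) =
    (if (sorted_list_of_set (pverts H) ! i, sorted_list_of_set (pverts H) ! j) \<in> parcs H then 1 else 0)"
  by (simp add: adjacency_matrix_def Let_def)

lemma walk_matrix_eq_krylov_mat: "walk_matrix H = krylov_mat (adjacency_matrix H)"
proof -
  have dim: "dim_row (adjacency_matrix H) = card (pverts H)" by (rule carrier_matD(1)[OF adjacency_matrix_carrier])
  have "krylov (adjacency_matrix H) =
      (\<lambda>j. (adjacency_matrix H ^\<^sub>m j) *\<^sub>v vec (card (pverts H)) (\<lambda>_. 1))"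
    by (rule ext) (simp add: krylov_def dim)
  then show ?thesis by (simp add: walk_matrix_def krylov_mat_def dim Let_def)
qed

lemma adjacency_matrix_symmetric:
  assumes "pair_graph H"
  shows "(adjacency_matrix H)\<^sup>T = adjacency_matrix H"
proof -
  interpret pair_graph H by fact
  have "(u, v) \<in> parcs H \<longleftrightarrow> (v, u) \<in> parcs H" for u v
    using pair_sym_arcs by (auto simp: symmetric_def sym_def)
  then show ?thesis by (intro eq_matI) (auto simp: adjacency_matrix_def Let_def)
qed

lemma adjacency_matrix_diag:
  assumes "pair_graph H" "i < card (pverts H)"
  shows "adjacency_matrix H $$ (i, i) = 0"
proof -
  interpret pair_graph H by fact
  have "(u, u) \<notin> parcs H" for u using pair_no_loops[of "(u, u)"] by auto
  then show ?thesis using assms(2) by (simp add: adjacency_matrix_index)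
qed

lemma adjacency_matrix_complement:
  assumes "pair_graph H"
  shows "adjacency_matrix (graph_complement H) = mat (card (pverts H)) (card (pverts H))
    (\<lambda>(i, j). (if i = j then 0 else 1) - adjacency_matrix H $$ (i, j))"
proof (rule eq_matI)
  interpret pair_graph H by fact
  let ?vs = "sorted_list_of_set (pverts H)" and ?n = "card (pverts H)"
  fix i j assume "i < dim_row (mat ?n ?n (\<lambda>(i, j). (if i = j then 0 else 1) - adjacency_matrix H $$ (i, j)))"
    "j < dim_col (mat ?n ?n (\<lambda>(i, j). (if i = j then 0 else 1) - adjacency_matrix H $$ (i, j)))"
  then have ij: "i < ?n" "j < ?n" by auto
  have "?vs ! i \<in> pverts H" "?vs ! j \<in> pverts H"
    using ij finite_verts nth_mem[of i ?vs] nth_mem[of j ?vs] by auto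
  moreover have "?vs ! i = ?vs ! j \<longleftrightarrow> i = j" using ij by (simp add: nth_eq_iff_index_eq)
  moreover have "(u, u) \<notin> parcs H" for u using pair_no_loops[of "(u, u)"] by auto
  ultimately show "adjacency_matrix (graph_complement H) $$ (i, j) =
      mat ?n ?n (\<lambda>(i, j). (if i = j then 0 else 1) - adjacency_matrix H $$ (i, j)) $$ (i, j)"
    using ij by (auto simp: adjacency_matrix_index graph_complement_def
        adjacency_matrix_def[of "graph_complement H"] Let_def)
qed (auto simp: adjacency_matrix_def graph_complement_def Let_def)

text \<open>A monic complex polynomial is determined by its multiset of roots, and integer
  polynomials embed into the complex ones.\<close>

lemma char_poly_eq_of_Spec_eq:
  assumes "Spec G = Spec H"
  shows "char_poly (adjacency_matrix G) = char_poly (adjacency_matrix H)"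
proof -
  let ?c = "\<lambda>K. char_poly (map_mat complex_of_int (adjacency_matrix K))"
  have decomp: "?c K = (\<Prod>x\<in>#Spec K. [:-x, 1:])" for K :: "'c::linorder pair_pre_digraph"
  proof -
    have "map_mat complex_of_int (adjacency_matrix K) \<in> carrier_mat (card (pverts K)) (card (pverts K))"
      by simp
    then have "lead_coeff (?c K) = 1" using degree_monic_char_poly by metis
    then show ?thesis using complex_poly_decompose_multiset[of "?c K"] by (simp add: Spec_def)
  qed
  have "of_int_poly (char_poly (adjacency_matrix G)) = (of_int_poly (char_poly (adjacency_matrix H)) :: complex poly)"
    using decomp[of G] decomp[of H] assms of_int_hom.char_poly_hom[OF adjacency_matrix_carrier]
    by metis
  then show ?thesis by simp
qed

lemma card_pverts_eq_of_char_poly_eq: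
  "char_poly (adjacency_matrix G) = char_poly (adjacency_matrix H) \<Longrightarrow> card (pverts G) = card (pverts H)"
  using degree_monic_char_poly[OF adjacency_matrix_carrier] by metis

text \<open>The order is the degree of the characteristic polynomial; the complement's spectrum then
  fixes \<open>resolvent_poly\<close> by \<open>char_poly_complement\<close>.\<close>

lemma cospectral_invariants:
  assumes G: "pair_graph G" and H: "pair_graph H" and gs: "generalized_spectrum G = generalized_spectrum H"
  shows "char_poly (adjacency_matrix G) = char_poly (adjacency_matrix H)"
    "card (pverts G) = card (pverts H)"
    "resolvent_poly (adjacency_matrix G) = resolvent_poly (adjacency_matrix H)"
proof -
  show c: "char_poly (adjacency_matrix G) = char_poly (adjacency_matrix H)"
    using gs by (intro char_poly_eq_of_Spec_eq) (simp add: generalized_spectrum_def)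
  show n: "card (pverts G) = card (pverts H)" by (rule card_pverts_eq_of_char_poly_eq[OF c])
  have "char_poly (adjacency_matrix (graph_complement G)) = char_poly (adjacency_matrix (graph_complement H))"
    using gs by (intro char_poly_eq_of_Spec_eq) (simp add: generalized_spectrum_def)
  then have "(-1) ^ card (pverts H) * (char_poly (adjacency_matrix H) + resolvent_poly (adjacency_matrix G)) =
      (-1) ^ card (pverts H) * (char_poly (adjacency_matrix H) + resolvent_poly (adjacency_matrix H))"
    using char_poly_complement[OF adjacency_matrix_carrier[of G]] char_poly_complement[OF adjacency_matrix_carrier[of H]]
    unfolding adjacency_matrix_complement[OF G] adjacency_matrix_complement[OF H] c n by metis
  then show "resolvent_poly (adjacency_matrix G) = resolvent_poly (adjacency_matrix H)" by simp
qed

lemma graph_iso_of_permutation: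
  assumes G: "pair_graph G" and H: "pair_graph H"
    and n: "card (pverts G) = n" "card (pverts H) = n" and \<sigma>: "bij_betw \<sigma> {..<n} {..<n}"
    and eq: "\<And>i j. i < n \<Longrightarrow> j < n \<Longrightarrow>
      adjacency_matrix G $$ (i, j) = adjacency_matrix H $$ (\<sigma> i, \<sigma> j)"
  shows "graph_iso G H"
proof -
  let ?v = "\<lambda>i. sorted_list_of_set (pverts G) ! i" and ?w = "\<lambda>i. sorted_list_of_set (pverts H) ! i"
  interpret G: pair_graph G by fact
  interpret H: pair_graph H by fact
  have v: "bij_betw ?v {..<n} (pverts G)" and w: "bij_betw ?w {..<n} (pverts H)"
    using n by (auto intro!: bij_betw_nth simp: lessThan_atLeast0)
  define f where "f = ?w \<circ> \<sigma> \<circ> inv_into {..<n} ?v"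
  have "bij_betw f (pverts G) (pverts H)"
    unfolding f_def by (intro bij_betw_trans[OF bij_betw_inv_into[OF v]] bij_betw_trans[OF \<sigma> w])
  moreover have "(x, y) \<in> parcs G \<longleftrightarrow> (f x, f y) \<in> parcs H" if xy: "x \<in> pverts G" "y \<in> pverts G" for x y
  proof -
    obtain i j where ij: "i < n" "j < n" "x = ?v i" "y = ?v j"
      using xy v unfolding bij_betw_def by (metis imageE lessThan_iff)
    have f: "f (?v k) = ?w (\<sigma> k)" if "k < n" for k
      using that v by (simp add: f_def bij_betw_def)
    have "\<sigma> i < n" "\<sigma> j < n" using \<sigma> ij bij_betwE by blast+
    then show ?thesis
      using eq[OF ij(1,2)] ij n by (auto simp: adjacency_matrix_index f split: if_splits)
  qed
  ultimately show ?thesis unfolding graph_iso_iff[OF G H] by blast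
qed

section \<open>Encoding mates by the primes of their levels\<close>

theorem theorem2:
  fixes G :: "'a::linorder pair_pre_digraph" and n k :: nat
  assumes "n > 0"
    and "G \<in> graph_family n"
    and "k = card {p :: nat. prime p \<and> odd p \<and> (int p)\<^sup>2 dvd det (walk_matrix G)}"
  shows "finite (isomorphism_classes (generalized_cospectral_mates G :: nat pair_pre_digraph set)) \<and>
    card (isomorphism_classes (generalized_cospectral_mates G :: nat pair_pre_digraph set)) \<le> 2 ^ k - 1"
proof -
  define A where "A = adjacency_matrix G"
  have G: "pair_graph G" and card: "card (pverts G) = n" using assms(2) by (auto simp: graph_family_def)
  have W: "walk_matrix G = krylov_mat A" by (simp add: A_def walk_matrix_eq_krylov_mat)
  have A: "A \<in> carrier_mat n n" "A\<^sup>T = A" "\<And>i. i < n \<Longrightarrow> A $$ (i, i) = 0"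
    using adjacency_matrix_carrier[of G] adjacency_matrix_symmetric[OF G] adjacency_matrix_diag[OF G] card
    by (simp_all add: A_def)
  obtain d where d: "rat_of_int (det (krylov_mat A)) / 2 ^ (n div 2) = rat_of_int d" "odd d" "cube_free d"
    using assms(2)[unfolded graph_family_def mem_Collect_eq W] by blast
  have "rat_of_int (det (krylov_mat A)) = rat_of_int (2 ^ (n div 2) * d)"
    using d(1) by (simp add: field_simps)
  then have det: "det (krylov_mat A) = 2 ^ (n div 2) * d" by (simp only: of_int_eq_iff)
  have cube: "\<not> int p ^ 3 dvd d" if "prime p" "odd p" for p :: nat
    using d(3) that unfolding cube_free_def by simp
  have rank: "corank1_mod p (krylov_mat A)" if "prime p" "odd p" "int p dvd det (krylov_mat A)" for p
    using that assms(2)[unfolded graph_family_def mem_Collect_eq W]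
      corank1_mod_of_rank_mod[OF that(1) krylov_mat_carrier[OF A(1)] assms(1)] by blast
  have det0: "det (krylov_mat A) \<noteq> 0" using det d(2) by auto
  interpret K: cube_free_krylov A n d
    by unfold_locales (fact A assms(1) det d(2) cube rank)+
  note level = K.level_prime_factor and perm = K.permutation_similar_of_same_level
  define M :: "nat pair_pre_digraph set" where "M = generalized_cospectral_mates G"
  have M: "pair_graph H" "\<not> graph_iso G H" "card (pverts H) = n"
    "adjacency_matrix H \<in> carrier_mat n n" "(adjacency_matrix H)\<^sup>T = adjacency_matrix H"
    "\<exists>l>0. \<exists>U. primitive_similarity n A (adjacency_matrix H) l U"
    if "H \<in> M" for H
  proof -
    show H: "pair_graph H" and "\<not> graph_iso G H" using that by (auto simp: M_def generalized_cospectral_mates_def)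
    have gs: "generalized_spectrum G = generalized_spectrum H"
      using that by (simp add: M_def generalized_cospectral_mates_def)
    note I = cospectral_invariants[OF G H gs]
    show n: "card (pverts H) = n" using I(2) card by simp
    show B: "adjacency_matrix H \<in> carrier_mat n n" using adjacency_matrix_carrier[of H] n by simp
    show BT: "(adjacency_matrix H)\<^sup>T = adjacency_matrix H" by (rule adjacency_matrix_symmetric[OF H])
    have mom: "moment A m = moment (adjacency_matrix H) m" for m
      using moment_cong[OF A(1) B assms(1)] I(1,3) by (simp add: A_def)
    show "\<exists>l>0. \<exists>U. primitive_similarity n A (adjacency_matrix H) l U"
      using exists_primitive_similarity[OF A(1) B]
        exists_scaled_similarity[OF A(1,2) B BT assms(1) _ mom det0] I(1) unfolding A_def by blast
  qed
  \<comment> \<open>One level is chosen for each mate; the argument works for any choice.\<close>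
  define lev where "lev H = (SOME l. l > 0 \<and> (\<exists>U. primitive_similarity n A (adjacency_matrix H) l U))" for H :: "nat pair_pre_digraph"
  have lev: "lev H > 0 \<and> (\<exists>U. primitive_similarity n A (adjacency_matrix H) (lev H) U)" if "H \<in> M" for H
    unfolding lev_def by (rule someI_ex[OF M(6)[OF that]])
  \<comment> \<open>Levels are squarefree, so the set of primes dividing the level encodes it. These
    sets are subsets of \<open>Q\<close>, which has \<open>k\<close> elements.\<close>
  define P where "P H = {p. prime p \<and> p dvd lev H}" for H
  define Q where "Q = {p :: nat. prime p \<and> odd p \<and> (int p)\<^sup>2 dvd det (krylov_mat A)}"
  have lev_prime: "odd p \<and> (int p)\<^sup>2 dvd det (krylov_mat A) \<and> \<not> p\<^sup>2 dvd lev H"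
    if "H \<in> M" "prime p" "p dvd lev H" for H p
    using lev[OF that(1)] level[OF M(4,5)[OF that(1)] _ that(2,3)] by blast
  have PQ: "P H \<subseteq> Q" if "H \<in> M" for H using lev_prime[OF that] by (auto simp: P_def Q_def)
  have P_nonempty: "P H \<noteq> {}" if H: "H \<in> M" for H
  proof
    assume "P H = {}"
    then have "lev H = 1" using prime_factor_nat[of "lev H"] by (auto simp: P_def)
    then obtain U where U: "primitive_similarity n A (adjacency_matrix H) 1 U" using lev[OF H] by auto
    \<comment> \<open>\<open>G\<close> itself has level 1 through the identity matrix, so a mate of
      level 1 would be isomorphic to \<open>G\<close>.\<close>
    have "scaled_similarity n A A 1 (1\<^sub>m n)"
      using A(1) unfolding scaled_similarity_def by (auto intro!: eq_matI)
    then have "primitive_similarity n A A 1 (1\<^sub>m n)" by (simp add: primitive_similarity_def)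
    from perm[OF A(1,2) this M(4,5)[OF H] U]
    obtain \<sigma> where "bij_betw \<sigma> {..<n} {..<n}"
      "\<And>i j. i < n \<Longrightarrow> j < n \<Longrightarrow> A $$ (i, j) = adjacency_matrix H $$ (\<sigma> i, \<sigma> j)" by blast
    then have "graph_iso G H"
      using graph_iso_of_permutation[OF G M(1)[OF H] card M(3)[OF H]] by (simp add: A_def)
    then show False using M(2)[OF H] by simp
  qed
  have iso: "graph_iso H K" if HK: "H \<in> M" "K \<in> M" "P H = P K" for H K
  proof -
    have PHK: "p dvd lev H \<longleftrightarrow> p dvd lev K" if "prime p" for p using HK(3) that by (auto simp: P_def)
    have "lev H = lev K"
    proof (rule dvd_antisym)
      show "lev H dvd lev K" using lev[OF HK(1)] lev[OF HK(2)] lev_prime[OF HK(1)] PHK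
        by (intro dvd_of_prime_divisors) auto
      show "lev K dvd lev H" using lev[OF HK(1)] lev[OF HK(2)] lev_prime[OF HK(2)] PHK
        by (intro dvd_of_prime_divisors) auto
    qed
    then obtain U U' where "primitive_similarity n A (adjacency_matrix H) (lev H) U"
      "primitive_similarity n A (adjacency_matrix K) (lev H) U'" using lev[OF HK(1)] lev[OF HK(2)] by auto
    from perm[OF M(4,5)[OF HK(1)] this(1) M(4,5)[OF HK(2)] this(2)]
    obtain \<sigma> where "bij_betw \<sigma> {..<n} {..<n}"
      "\<And>i j. i < n \<Longrightarrow> j < n \<Longrightarrow> adjacency_matrix H $$ (i, j) = adjacency_matrix K $$ (\<sigma> i, \<sigma> j)" by blast
    then show ?thesis
      using graph_iso_of_permutation[OF M(1)[OF HK(1)] M(1)[OF HK(2)] M(3)[OF HK(1)] M(3)[OF HK(2)]] by blast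
  qed
  have finQ: "finite Q"
  proof (rule finite_subset)
    show "Q \<subseteq> {..nat \<bar>det (krylov_mat A)\<bar>}"
    proof
      fix p assume "p \<in> Q"
      then have "int p dvd det (krylov_mat A)" by (auto simp: Q_def power2_eq_square elim: dvd_mult_left)
      then show "p \<in> {..nat \<bar>det (krylov_mat A)\<bar>}" using dvd_imp_le_int[OF det0] by fastforce
    qed
  qed simp
  define R where "R = {(G, H). G \<in> M \<and> H \<in> M \<and> graph_iso G H}"
  have R: "equiv M R" unfolding R_def by (rule equiv_graph_iso) (rule M(1))
  \<comment> \<open>Representatives turn the encoding of mates into an injective map on isomorphism
    classes.\<close>
  define r where "r X = (SOME H. H \<in> X)" for X :: "nat pair_pre_digraph set"
  have r: "r X \<in> X" "r X \<in> M" if "X \<in> M // R" for X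
  proof -
    show "r X \<in> X" unfolding r_def some_in_eq by (rule in_quotient_imp_non_empty[OF R that])
    then show "r X \<in> M" using in_quotient_imp_subset[OF R that] by blast
  qed
  have inj: "inj_on (\<lambda>X. P (r X)) (M // R)"
  proof (rule inj_onI)
    fix X Y assume XY: "X \<in> M // R" "Y \<in> M // R" "P (r X) = P (r Y)"
    then have "(r X, r Y) \<in> R" using r iso by (simp add: R_def)
    then show "X = Y" using quotient_eq_iff[OF R XY(1,2)] r XY(1,2) by blast
  qed
  \<comment> \<open>Excluding the empty set, which belongs to level 1, accounts for the subtracted 1
    in the bound.\<close>
  have sub: "(\<lambda>X. P (r X)) ` (M // R) \<subseteq> Pow Q - {{}}" using r(2) PQ P_nonempty by blast
  have "finite (M // R)" using inj sub finQ by (meson finite_Diff finite_Pow_iff inj_on_finite)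
  moreover have "card (M // R) \<le> card (Pow Q - {{}})" using inj sub finQ by (intro card_inj_on_le) auto
  moreover have "card (Pow Q - {{}}) = 2 ^ k - 1" using finQ assms(3) by (simp add: card_Pow Q_def W)
  ultimately show ?thesis unfolding isomorphism_classes_def M_def[symmetric] R_def[symmetric] by simp
qed

end
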